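(* Let $n\in\mathbb{N}$, let $V=\mathbb{R}^n$ and let $h:\mathbb{N}^n\to\mathbb{R}$. Then for any $k\in\mathbb{N}$, $$\mathrm{rk}(M_{p_h,k})=\dim (V^{\otimes k})^{\mathrm{Stab}(h)},$$ where $p_h$ is the partition function of the vertex model $h$, $M_{p_h,k}$ is the $k$-th edge connection matrix of $p_h$, and $\mathrm{Stab}(h)\subseteq O(n)$ is the stabilizer of $h$ in the real orthogonal group.
   Context: Conventions: $\mathbb{N}=\{0,1,2,\ldots\}$ and $[n]=\{1,\ldots,n\}$. Graphs: $\mathcal{G}$ is the set of isomorphism classes of (finite) graphs, allowing multiple edges, loops and circles; a circle is a loop which does not contain any vertex (it is an element of the edge set, incident with no vertex). $VG$ and $EG$ denote the vertex and edge set of $G$. Vertex models and partition functions: any map $h:\mathbb{N}^n\to\mathbb{R}$ is called a vertex model. For $G\in\mathcal{G}$, a map $\phi:EG\to[n]$ and $v\in VG$, let $\delta(v)$ be the multiset of edges incident with $v$ (a loop at $v$ counts twice), and view the multiset $\phi(\delta(v))$ as the element $\alpha\in\mathbb{N}^n$ whose $i$-th coordinate is the number of elements of $\delta(v)$, counted with multiplicity, that $\phi$ maps to $i$. The partition function of $h$ is the map $p_h:\mathcal{G}\to\mathbb{R}$ defined by $$p_h(G)=\sum_{\phi:EG\to[n]}\ \prod_{v\in VG}h(\phi(\delta(v))).$$ Fragments and edge connection matrices: a $k$-fragment is a (finite) graph, allowing multiple edges, loops and circles (a circle being a loop which does not contain any vertex), in which $k$ of its vertices are labeled $1,\ldots,k$,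 each of these having degree one. The labeled vertices are called open ends, and the edge connected to an open end is called a half edge. $\mathcal{F}_k$ is the collection of all $k$-fragments (up to label-preserving isomorphism), and $\mathcal{F}_0$ is identified with $\mathcal{G}$. For $F,H\in\mathcal{F}_k$, the graph $F*H\in\mathcal{G}$ is obtained by connecting, for each label $i\in[k]$, the half edges of $F$ and of $H$ incident with the open ends labeled $i$ to form single edges, with the open ends erased. (Glueing half edges both of whose endpoints are open ends may thereby create circles.) For a map $p:\mathcal{G}\to\mathbb{R}$, the $k$-th edge connection matrix $M_{p,k}$ is the (infinite) $\mathcal{F}_k\times\mathcal{F}_k$ matrix with entries $M_{p,k}(F,H)=p(F*H)$; its rank is the dimension of its row space. Group actions: $O(n)=\{U\in\mathbb{R}^{n\times n}\mid U^TU=I\}$. Let $R=\mathbb{R}[x_1,\ldots,x_n]$. $O(n)$ acts on $R$ by $(Uq)(v)=q(U^{-1}v)$ for $q\in R$, $v\in\mathbb{R}^n$, and on the space $R^*$ of linear functions $R\to\mathbb{R}$ by $(Uh)(q)=h(U^{-1}q)$. A map $h:\mathbb{N}^n\to\mathbb{R}$ is identified with the linear function $h:R\to\mathbb{R}$ determined by $h(x_1^{\alpha_1}\cdots x_n^{\alpha_n})=h(\alpha)$ for $\alpha\in\mathbb{N}^n$. Then $\mathrm{Stab}(h)=\{U\in O(n)\mid Uh=h\}$. $O(n)$ acts on $V^{\otimes k}$ diagonally, $U(v_1\otimes\cdots\otimes v_k)=Uv_1\otimes\cdots\otimes Uv_k$ (trivially on $V^{\otimes 0}=\mathbb{R}$),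 and for a subgroup $H\subseteq O(n)$, $(V^{\otimes k})^H=\{v\in V^{\otimes k}\mid Uv=v\text{ for all }U\in H\}$. *)

theory Defs
  imports
    Complex_Main
    "HOL-Library.FuncSet"
    "HOL-Library.Multiset"
    "HOL-Library.Poly_Mapping"
    "HOL-Library.Extended_Nat"
    "HOL-Library.Function_Algebras"
    "Jordan_Normal_Form.Determinant"
begin

section \<open>Graphs and fragments\<close>

text \<open>
  Each edge carries the multiset of its endpoints: two vertices for an ordinary edge, the same
  vertex twice for a loop, and the empty multiset for a circle.
\<close>

record ('v, 'e) graph =
  verts :: "'v set"
  edges :: "'e set"
  ends :: "'e \<Rightarrow> 'v multiset"

definition wf_graph :: "('v, 'e, 'x) graph_scheme \<Rightarrow> bool" where
  "wf_graph G \<longleftrightarrow> finite (verts G) \<and> finite (edges G) \<and>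
     (\<forall>e\<in>edges G. set_mset (ends G e) \<subseteq> verts G \<and> size (ends G e) \<in> {0, 2})"

definition incident_edges :: "('v, 'e, 'x) graph_scheme \<Rightarrow> 'v \<Rightarrow> 'e multiset" where
  "incident_edges G v = (\<Sum>e\<in>edges G. replicate_mset (count (ends G e) v) e)"

text \<open>The list \<open>opens F\<close> enumerates the open ends: the vertex labelled \<open>i + 1\<close> is \<open>opens F ! i\<close>.\<close>

record ('v, 'e) fragment = "('v, 'e) graph" +
  opens :: "'v list"

definition wf_fragment :: "nat \<Rightarrow> ('v, 'e) fragment \<Rightarrow> bool" where
  "wf_fragment k F \<longleftrightarrow> wf_graph F \<and> distinct (opens F) \<and> length (opens F) = k \<and>
     set (opens F) \<subseteq> verts F \<and> (\<forall>v\<in>set (opens F). size (incident_edges F v) = 1)"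

definition iso_by ::
    "('v \<Rightarrow> 'w) \<Rightarrow> ('e \<Rightarrow> 'f) \<Rightarrow> ('v, 'e, 'x) graph_scheme \<Rightarrow> ('w, 'f, 'y) graph_scheme \<Rightarrow> bool" where
  "iso_by f g G H \<longleftrightarrow> bij_betw f (verts G) (verts H) \<and> bij_betw g (edges G) (edges H) \<and>
     (\<forall>e\<in>edges G. ends H (g e) = image_mset f (ends G e))"

definition graph_iso :: "('v, 'e) graph \<Rightarrow> ('w, 'f) graph \<Rightarrow> bool" where
  "graph_iso G H \<longleftrightarrow> (\<exists>f g. iso_by f g G H)"

definition fragment_iso :: "('v, 'e) fragment \<Rightarrow> ('w, 'f) fragment \<Rightarrow> bool" where
  "fragment_iso F H \<longleftrightarrow> (\<exists>f g. iso_by f g F H \<and> opens H = map f (opens F))"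

text \<open>
  Every finite graph has isomorphic copies on natural numbers, so an isomorphism class is
  represented by the set of those copies.
\<close>

type_synonym graph_class = "(nat, nat) graph set"
type_synonym fragment_class = "(nat, nat) fragment set"

definition graph_class :: "('v, 'e) graph \<Rightarrow> graph_class" where
  "graph_class G = {G'. graph_iso G G'}"

definition fragment_class :: "('v, 'e) fragment \<Rightarrow> fragment_class" where
  "fragment_class F = {F'. fragment_iso F F'}"

definition graphs :: "graph_class set" where
  "graphs = {graph_class G | G :: (nat, nat) graph. wf_graph G}"

definition fragments :: "nat \<Rightarrow> fragment_class set" where
  "fragments k = {fragment_class F | F :: (nat, nat) fragment. wf_fragment k F}"


section \<open>Partition functions\<close>

text \<open>
  Colours are \<open>{..<n}\<close>. A multi-index in \<open>\<nat>\<^sup>n\<close> is a finitely supported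
  \<open>\<alpha> :: nat \<Rightarrow>\<^sub>0 nat\<close> with \<open>Poly_Mapping.keys \<alpha> \<subseteq> {..<n}\<close>;
  the values of a vertex model at other arguments are never used.
\<close>

definition colour_count :: "('e \<Rightarrow> nat) \<Rightarrow> 'e multiset \<Rightarrow> (nat \<Rightarrow>\<^sub>0 nat)" where
  "colour_count \<phi> M = (\<Sum>e\<in>#M. Poly_Mapping.single (\<phi> e) 1)"

lemma lookup_colour_count: "Poly_Mapping.lookup (colour_count \<phi> M) i = count (image_mset \<phi> M) i"
  by (induction M) (simp_all add: colour_count_def Poly_Mapping.lookup_add
      Poly_Mapping.lookup_single when_def)

definition graph_partition_function ::
    "nat \<Rightarrow> ((nat \<Rightarrow>\<^sub>0 nat) \<Rightarrow> real) \<Rightarrow> ('v, 'e) graph \<Rightarrow> real" where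
  "graph_partition_function n h G =
     (\<Sum>\<phi>\<in>edges G \<rightarrow>\<^sub>E {..<n}. \<Prod>v\<in>verts G. h (colour_count \<phi> (incident_edges G v)))"

text \<open>The partition function on isomorphism classes; see \<open>partition_function_class\<close> below.\<close>

definition partition_function ::
    "nat \<Rightarrow> ((nat \<Rightarrow>\<^sub>0 nat) \<Rightarrow> real) \<Rightarrow> graph_class \<Rightarrow> real" where
  "partition_function n h C = the_elem (graph_partition_function n h ` C)"


section \<open>Gluing\<close>

definition glue_step ::
    "('v, 'e) fragment \<Rightarrow> ('w, 'f) fragment \<Rightarrow> (('e + 'f) \<times> ('e + 'f)) set" where
  "glue_step F H = {(Inl e, Inr e') | e e'. e \<in> edges F \<and> e' \<in> edges H \<and>
     (\<exists>i<length (opens F). opens F ! i \<in># ends F e \<and> opens H ! i \<in># ends H e')}"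

definition remaining_ends ::
    "('v, 'e) fragment \<Rightarrow> ('w, 'f) fragment \<Rightarrow> 'e + 'f \<Rightarrow> ('v + 'w) multiset" where
  "remaining_ends F H x = (case x of
       Inl e \<Rightarrow> image_mset Inl (filter_mset (\<lambda>v. v \<notin> set (opens F)) (ends F e))
     | Inr e \<Rightarrow> image_mset Inr (filter_mset (\<lambda>v. v \<notin> set (opens H)) (ends H e)))"

text \<open>
  An edge of the glued graph is a maximal set of edges of the disjoint union that are joined
  successively at equally labelled open ends. Its endpoints are the endpoints of its members other
  than open ends; a closed chain is left with none and becomes a circle.
\<close>

definition glue :: "('v, 'e) fragment \<Rightarrow> ('w, 'f) fragment \<Rightarrow> ('v + 'w, ('e + 'f) set) graph" where
  "glue F H = \<lparr>
     verts = (verts F - set (opens F)) <+> (verts H - set (opens H)),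
     edges = (edges F <+> edges H) // (glue_step F H \<union> (glue_step F H)\<inverse>)\<^sup>*,
     ends = (\<lambda>C. \<Sum>x\<in>C. remaining_ends F H x) \<rparr>"

text \<open>The classes in the union are all equal; see \<open>glue_class_fragment_class\<close> below.\<close>

definition glue_class :: "fragment_class \<Rightarrow> fragment_class \<Rightarrow> graph_class" where
  "glue_class C D = (\<Union>F\<in>C. \<Union>H\<in>D. graph_class (glue F H))"


section \<open>Edge connection matrices and their rank\<close>

definition fun_scale :: "real \<Rightarrow> ('a \<Rightarrow> real) \<Rightarrow> 'a \<Rightarrow> real" where
  "fun_scale c f = (\<lambda>x. c * f x)"

global_interpretation fun_space: vector_space fun_scale
  by standard (auto simp: fun_scale_def algebra_simps)

text \<open>\<open>fun_space.dim\<close> is \<open>0\<close> on infinite-dimensional spaces; \<open>fun_dim\<close> is \<open>\<infinity>\<close> there.\<close>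

definition fun_dim :: "('a \<Rightarrow> real) set \<Rightarrow> enat" where
  "fun_dim S = (if \<exists>B. finite B \<and> S \<subseteq> fun_space.span B then enat (fun_space.dim S) else \<infinity>)"

text \<open>The rows of a matrix with column index set \<open>J\<close> are extended by \<open>0\<close> outside \<open>J\<close>.\<close>

definition matrix_rank :: "'i set \<Rightarrow> 'j set \<Rightarrow> ('i \<Rightarrow> 'j \<Rightarrow> real) \<Rightarrow> enat" where
  "matrix_rank I J M = fun_dim (fun_space.span ((\<lambda>i j. if j \<in> J then M i j else 0) ` I))"

definition edge_connection_matrix ::
    "(graph_class \<Rightarrow> real) \<Rightarrow> fragment_class \<Rightarrow> fragment_class \<Rightarrow> real" where
  "edge_connection_matrix p F H = p (glue_class F H)"

definition edge_connection_rank :: "(graph_class \<Rightarrow> real) \<Rightarrow> nat \<Rightarrow> enat" where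
  "edge_connection_rank p k = matrix_rank (fragments k) (fragments k) (edge_connection_matrix p)"


section \<open>The orthogonal group and its actions\<close>

definition orthogonal_group :: "nat \<Rightarrow> real mat set" where
  "orthogonal_group n = {U \<in> carrier_mat n n. transpose_mat U * U = 1\<^sub>m n}"

text \<open>Polynomials in the indeterminates with indices in \<open>{..<n}\<close>.\<close>

type_synonym mpoly = "(nat \<Rightarrow>\<^sub>0 nat) \<Rightarrow>\<^sub>0 real"

definition polys :: "nat \<Rightarrow> mpoly set" where
  "polys n = {q. \<forall>\<alpha>\<in>Poly_Mapping.keys q. Poly_Mapping.keys \<alpha> \<subseteq> {..<n}}"

definition poly_eval :: "mpoly \<Rightarrow> real vec \<Rightarrow> real" where
  "poly_eval q v = (\<Sum>\<alpha>\<in>Poly_Mapping.keys q. Poly_Mapping.lookup q \<alpha> *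
     (\<Prod>i\<in>Poly_Mapping.keys \<alpha>. (v $ i) ^ Poly_Mapping.lookup \<alpha> i))"

text \<open>\<open>linear_subst A q\<close> is the polynomial \<open>q(A x)\<close>; see \<open>poly_eval_linear_subst\<close> below.\<close>

definition linear_form :: "real vec \<Rightarrow> mpoly" where
  "linear_form a = (\<Sum>j<dim_vec a. Poly_Mapping.single (Poly_Mapping.single j 1) (a $ j))"

definition linear_subst :: "real mat \<Rightarrow> mpoly \<Rightarrow> mpoly" where
  "linear_subst A q = (\<Sum>\<alpha>\<in>Poly_Mapping.keys q. Poly_Mapping.single 0 (Poly_Mapping.lookup q \<alpha>) *
     (\<Prod>i\<in>Poly_Mapping.keys \<alpha>. linear_form (row A i) ^ Poly_Mapping.lookup \<alpha> i))"

text \<open>For \<open>U\<close> in the orthogonal group, the inverse of \<open>U\<close> is its transpose; see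
  \<open>orthogonal_group_inverse\<close> below.\<close>

definition poly_act :: "real mat \<Rightarrow> mpoly \<Rightarrow> mpoly" where
  "poly_act U q = linear_subst (transpose_mat U) q"

definition linear_extension :: "((nat \<Rightarrow>\<^sub>0 nat) \<Rightarrow> real) \<Rightarrow> mpoly \<Rightarrow> real" where
  "linear_extension h q = (\<Sum>\<alpha>\<in>Poly_Mapping.keys q. Poly_Mapping.lookup q \<alpha> * h \<alpha>)"

definition dual_act :: "real mat \<Rightarrow> (mpoly \<Rightarrow> real) \<Rightarrow> mpoly \<Rightarrow> real" where
  "dual_act U L q = L (poly_act (transpose_mat U) q)"

definition stabilizer :: "nat \<Rightarrow> ((nat \<Rightarrow>\<^sub>0 nat) \<Rightarrow> real) \<Rightarrow> real mat set" where
  "stabilizer n h = {U \<in> orthogonal_group n.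
     \<forall>q\<in>polys n. dual_act U (linear_extension h) q = linear_extension h q}"

text \<open>
  A tensor in \<open>V\<^sup>\<otimes>\<^sup>k\<close>, \<open>V = \<real>\<^sup>n\<close>, is given by its coordinates in the basis
  of tensor products of standard basis vectors, indexed by the lists of length \<open>k\<close> over
  \<open>{..<n}\<close>. On pure tensors \<open>tensor_act\<close> is the diagonal action; see
  \<open>tensor_act_pure_tensor\<close> below.
\<close>

definition multi_indices :: "nat \<Rightarrow> nat \<Rightarrow> nat list set" where
  "multi_indices n k = {is. set is \<subseteq> {..<n} \<and> length is = k}"

definition tensor_power :: "nat \<Rightarrow> nat \<Rightarrow> (nat list \<Rightarrow> real) set" where
  "tensor_power n k = {T. \<forall>is. is \<notin> multi_indices n k \<longrightarrow> T is = 0}"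

definition pure_tensor :: "nat \<Rightarrow> real vec list \<Rightarrow> nat list \<Rightarrow> real" where
  "pure_tensor n vs = (\<lambda>is. if is \<in> multi_indices n (length vs)
     then \<Prod>l<length vs. (vs ! l) $ (is ! l) else 0)"

definition tensor_act ::
    "nat \<Rightarrow> nat \<Rightarrow> real mat \<Rightarrow> (nat list \<Rightarrow> real) \<Rightarrow> nat list \<Rightarrow> real" where
  "tensor_act n k U T = (\<lambda>is. if is \<in> multi_indices n k
     then \<Sum>js\<in>multi_indices n k. (\<Prod>l<k. U $$ (is ! l, js ! l)) * T js else 0)"

definition tensor_invariants :: "nat \<Rightarrow> nat \<Rightarrow> real mat set \<Rightarrow> (nat list \<Rightarrow> real) set" where
  "tensor_invariants n k H = {T \<in> tensor_power n k. \<forall>U\<in>H. tensor_act n k U T = T}"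


section \<open>Well-definedness\<close>

lemma graph_iso_sym:
  assumes "graph_iso G H" "wf_graph G"
  shows "graph_iso H G"
proof -
  obtain f g where fg: "bij_betw f (verts G) (verts H)" "bij_betw g (edges G) (edges H)"
    "\<And>e. e \<in> edges G \<Longrightarrow> ends H (g e) = image_mset f (ends G e)"
    using assms(1) unfolding graph_iso_def iso_by_def by blast
  let ?f = "inv_into (verts G) f" and ?g = "inv_into (edges G) g"
  have "ends G (?g e) = image_mset ?f (ends H e)" if "e \<in> edges H" for e
  proof -
    have e: "?g e \<in> edges G" "g (?g e) = e"
      using fg(2) that by (auto simp: bij_betw_def inv_into_into f_inv_into_f)
    have "image_mset ?f (ends H e) = image_mset (?f \<circ> f) (ends G (?g e))"
      using fg(3)[OF e(1)] e(2) by (simp add: image_mset.compositionality)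
    also have "\<dots> = image_mset id (ends G (?g e))"
      using assms(2) e(1) fg(1) unfolding wf_graph_def bij_betw_def
      by (intro image_mset_cong) (auto simp: inv_into_f_f subset_iff)
    finally show ?thesis by simp
  qed
  then have "iso_by ?f ?g H G"
    unfolding iso_by_def using bij_betw_inv_into[OF fg(1)] bij_betw_inv_into[OF fg(2)] by auto
  then show ?thesis unfolding graph_iso_def by blast
qed

lemma graph_iso_trans:
  assumes "graph_iso G H" "graph_iso H K"
  shows "graph_iso G K"
proof -
  obtain f g f' g' where "iso_by f g G H" "iso_by f' g' H K"
    using assms unfolding graph_iso_def by blast
  then have "iso_by (f' \<circ> f) (g' \<circ> g) G K"
    unfolding iso_by_def
    by (auto intro: bij_betw_trans simp: image_mset.compositionality bij_betw_apply)
  then show ?thesis unfolding graph_iso_def by blast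
qed

lemma graph_class_eq:
  assumes "graph_iso G H" "wf_graph G"
  shows "graph_class G = graph_class H"
proof -
  have "graph_iso H G" using graph_iso_sym[OF assms] .
  then have "graph_iso G K \<longleftrightarrow> graph_iso H K" for K :: "(nat, nat) graph"
    using graph_iso_trans[of G H K] graph_iso_trans[of H G K] assms(1) by iprover
  then show ?thesis unfolding graph_class_def by auto
qed

lemma wf_graph_iso:
  assumes "graph_iso G H" "wf_graph G"
  shows "wf_graph H"
proof -
  obtain f g where fg: "bij_betw f (verts G) (verts H)" "bij_betw g (edges G) (edges H)"
    "\<And>e. e \<in> edges G \<Longrightarrow> ends H (g e) = image_mset f (ends G e)"
    using assms(1) unfolding graph_iso_def iso_by_def by blast
  have "edges H = g ` edges G" "verts H = f ` verts G"
    using fg by (auto simp: bij_betw_def)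
  then show ?thesis using assms(2) fg(3) unfolding wf_graph_def by fastforce
qed

lemma ex_nat_iso:
  assumes "wf_graph G"
  shows "\<exists>G' :: (nat, nat) graph. graph_iso G G'"
proof -
  obtain f :: "_ \<Rightarrow> nat" where f: "inj_on f (verts G)"
    using assms finite_imp_inj_to_nat_seg[of "verts G"] by (auto simp: wf_graph_def)
  obtain g :: "_ \<Rightarrow> nat" where g: "inj_on g (edges G)"
    using assms finite_imp_inj_to_nat_seg[of "edges G"] by (auto simp: wf_graph_def)
  have "iso_by f g G \<lparr>verts = f ` verts G, edges = g ` edges G,
      ends = (\<lambda>e. image_mset f (ends G (inv_into (edges G) g e)))\<rparr>"
    using f g unfolding iso_by_def by (auto simp: bij_betw_def)
  then show ?thesis unfolding graph_iso_def by blast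
qed

lemma graph_class_in_graphs:
  assumes "wf_graph G"
  shows "graph_class G \<in> graphs"
proof -
  obtain G' :: "(nat, nat) graph" where "graph_iso G G'" using ex_nat_iso[OF assms] ..
  then show ?thesis
    using graph_class_eq wf_graph_iso assms unfolding graphs_def by blast
qed

lemma count_incident_edges:
  assumes "finite (edges G)"
  shows "count (incident_edges G v) e = (if e \<in> edges G then count (ends G e) v else 0)"
proof -
  have "count (incident_edges G v) e = (\<Sum>e'\<in>edges G. if e = e' then count (ends G e') v else 0)"
    unfolding incident_edges_def count_sum by (intro sum.cong) auto
  then show ?thesis using assms by (simp add: sum.delta')
qed

lemma colour_count_image: "colour_count \<phi> (image_mset g M) = colour_count (\<phi> \<circ> g) M"
  unfolding colour_count_def by (simp add: image_mset.compositionality comp_def)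

lemma colour_count_cong:
  assumes "\<And>e. e \<in># M \<Longrightarrow> \<phi> e = \<psi> e"
  shows "colour_count \<phi> M = colour_count \<psi> M"
  unfolding colour_count_def using assms by (metis (no_types, lifting) image_mset_cong)

lemma graph_partition_function_iso:
  assumes "graph_iso G H" "wf_graph G"
  shows "graph_partition_function n h H = graph_partition_function n h G"
proof -
  obtain f g where fg: "bij_betw f (verts G) (verts H)" "bij_betw g (edges G) (edges H)"
    "\<And>e. e \<in> edges G \<Longrightarrow> ends H (g e) = image_mset f (ends G e)"
    using assms(1) unfolding graph_iso_def iso_by_def by blast
  have injg: "inj_on g (edges G)" and img: "g ` edges G = edges H"
    and injf: "inj_on f (verts G)" and imf: "f ` verts G = verts H"
    using fg by (auto simp: bij_betw_def)
  have fin: "finite (edges G)" using assms(2) by (auto simp: wf_graph_def)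
  have cnt: "count (ends H (g e)) (f v) = count (ends G e) v"
    if "e \<in> edges G" "v \<in> verts G" for e v
  proof -
    have "count (image_mset f (ends G e)) (f v) = count (ends G e) v"
    proof -
      have "{x \<in> set_mset (ends G e). f x = f v} = (if v \<in># ends G e then {v} else {})"
        using injf that assms(2) unfolding wf_graph_def inj_on_def by (auto simp: subset_iff)
      then show ?thesis
        by (auto simp: count_image_mset vimage_def Int_def conj_commute not_in_iff split: if_splits)
    qed
    then show ?thesis using fg(3) that by simp
  qed
  have inc: "incident_edges H (f v) = image_mset g (incident_edges G v)" if "v \<in> verts G" for v
  proof -
    have "incident_edges H (f v) = (\<Sum>e\<in>edges G. replicate_mset (count (ends H (g e)) (f v)) (g e))"
      unfolding incident_edges_def img[symmetric] using injg by (simp add: sum.reindex)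
    also have "\<dots> = (\<Sum>e\<in>edges G. image_mset g (replicate_mset (count (ends G e) v) e))"
      using cnt that by (intro sum.cong) auto
    also have "\<dots> = image_mset g (incident_edges G v)"
      unfolding incident_edges_def by (induction rule: infinite_finite_induct) auto
    finally show ?thesis .
  qed
  have inc_sub: "set_mset (incident_edges G v) \<subseteq> edges G" for v
    using count_incident_edges[OF fin, of v] by (metis count_eq_zero_iff subsetI)
  let ?P = "\<lambda>\<phi>. restrict (\<phi> \<circ> g) (edges G)"
  let ?Q = "\<lambda>\<psi>. restrict (\<psi> \<circ> inv_into (edges G) g) (edges H)"
  have inv: "inv_into (edges G) g (g e) = e" if "e \<in> edges G" for e
    using injg that by simp
  have inv2: "inv_into (edges G) g e \<in> edges G" "g (inv_into (edges G) g e) = e"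
    if "e \<in> edges H" for e
    using img that by (auto simp: inv_into_into f_inv_into_f)
  show ?thesis
    unfolding graph_partition_function_def
  proof (rule sum.reindex_bij_witness[where i = ?Q and j = ?P])
    fix \<phi> assume \<phi>: "\<phi> \<in> edges H \<rightarrow>\<^sub>E {..<n}"
    show "?Q (?P \<phi>) = \<phi>"
      using \<phi> inv2 by (auto simp: fun_eq_iff restrict_def PiE_def extensional_def)
    show "?P \<phi> \<in> edges G \<rightarrow>\<^sub>E {..<n}" using \<phi> by (fastforce simp: img[symmetric])
    have "colour_count (?P \<phi>) (incident_edges G v) = colour_count \<phi> (incident_edges H (f v))"
      if "v \<in> verts G" for v
      unfolding inc[OF that] colour_count_image using inc_sub[of v]
      by (intro colour_count_cong) auto
    then show "(\<Prod>v\<in>verts G. h (colour_count (?P \<phi>) (incident_edges G v))) =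
        (\<Prod>v\<in>verts H. h (colour_count \<phi> (incident_edges H v)))"
      unfolding imf[symmetric] using injf by (simp add: prod.reindex)
  next
    fix \<psi> assume \<psi>: "\<psi> \<in> edges G \<rightarrow>\<^sub>E {..<n}"
    show "?P (?Q \<psi>) = \<psi>"
      using \<psi> inv img by (auto simp: fun_eq_iff restrict_def PiE_def extensional_def)
    show "?Q \<psi> \<in> edges H \<rightarrow>\<^sub>E {..<n}" using \<psi> inv2 by auto
  qed
qed

lemma partition_function_class:
  assumes "wf_graph G"
  shows "partition_function n h (graph_class G) = graph_partition_function n h G"
proof -
  obtain G' :: "(nat, nat) graph" where "graph_iso G G'" using ex_nat_iso[OF assms] ..
  then have "graph_partition_function n h ` graph_class G = {graph_partition_function n h G}"
    using graph_partition_function_iso[OF _ assms] unfolding graph_class_def by auto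
  then show ?thesis unfolding partition_function_def by simp
qed

lemma quotient_image:
  assumes inj: "inj_on \<gamma> D" and R: "R \<subseteq> D \<times> D" and S: "S = map_prod \<gamma> \<gamma> ` R"
  shows "bij_betw ((`) \<gamma>) (D // (R \<union> R\<inverse>)\<^sup>*) ((\<gamma> ` D) // (S \<union> S\<inverse>)\<^sup>*)"
proof -
  let ?R = "(R \<union> R\<inverse>)\<^sup>*" and ?S = "(S \<union> S\<inverse>)\<^sup>*"
  have cls: "?R `` {x} \<subseteq> D" if "x \<in> D" for x
  proof
    fix y assume "y \<in> ?R `` {x}"
    then have "(x, y) \<in> ?R" by simp
    then show "y \<in> D" using that R by induction auto
  qed
  have fwd: "(\<gamma> x, \<gamma> y) \<in> ?S" if "(x, y) \<in> ?R" for x y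
    using that
  proof induction
    case (step y z)
    then have "(\<gamma> y, \<gamma> z) \<in> S \<union> S\<inverse>" using S by (auto intro: rev_image_eqI)
    with step show ?case by (meson rtrancl.rtrancl_into_rtrancl)
  qed simp
  have bwd: "\<exists>y. (x, y) \<in> ?R \<and> z = \<gamma> y" if "(\<gamma> x, z) \<in> ?S" "x \<in> D" for x z
    using that(1)
  proof induction
    case (step z w)
    then obtain y where y: "(x, y) \<in> ?R" "z = \<gamma> y" by blast
    obtain a b where ab: "(a, b) \<in> R \<union> R\<inverse>" "z = \<gamma> a" "w = \<gamma> b"
      using step(2) S by auto
    have "a \<in> D" "y \<in> D" using ab(1) R cls[OF that(2)] y(1) by auto
    then have "a = y" using ab(2) y(2) inj by (auto dest: inj_onD)
    then have "(x, b) \<in> ?R" using ab(1) y(1) by (meson rtrancl.rtrancl_into_rtrancl)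
    then show ?case using ab(3) by blast
  qed auto
  have eq: "?S `` {\<gamma> x} = \<gamma> ` (?R `` {x})" if "x \<in> D" for x
    using fwd bwd[OF _ that] by blast
  have sub: "C \<subseteq> D" if "C \<in> D // ?R" for C
    using that cls unfolding quotient_def by blast
  show ?thesis
    unfolding bij_betw_def
  proof
    show "inj_on ((`) \<gamma>) (D // ?R)"
      using inj sub by (meson inj_on_image_eq_iff inj_onI)
    show "(`) \<gamma> ` (D // ?R) = (\<gamma> ` D) // ?S"
      unfolding quotient_def using eq by auto
  qed
qed

lemma glue_step_subset: "glue_step F H \<subseteq> (edges F <+> edges H) \<times> (edges F <+> edges H)"
  unfolding glue_step_def by auto

lemma filter_image_mset_inj:
  assumes "inj_on f V" "set_mset M \<subseteq> V" "set xs \<subseteq> V"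
  shows "filter_mset (\<lambda>v. v \<notin> set (map f xs)) (image_mset f M) =
         image_mset f (filter_mset (\<lambda>v. v \<notin> set xs) M)"
proof -
  have "filter_mset (\<lambda>v. f v \<notin> set (map f xs)) M = filter_mset (\<lambda>v. v \<notin> set xs) M"
    using assms by (intro filter_mset_cong) (auto simp: inj_on_def subset_iff)
  then show ?thesis by (simp add: filter_mset_image_mset)
qed

lemma inj_sum: "inj_on a A \<Longrightarrow> inj_on b B \<Longrightarrow> inj_on (map_sum a b) (A <+> B)"
  by (rule inj_onI) (auto elim!: PlusE dest: inj_onD)

lemma im_sum: "map_sum a b ` (A <+> B) = a ` A <+> b ` B"
  unfolding Plus_def image_Un image_image by simp

lemma glue_iso:
  assumes "fragment_iso F F'" "fragment_iso H H'" "wf_fragment k F" "wf_fragment k H"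
  shows "graph_iso (glue F H) (glue F' H')"
proof -
  obtain f g where fg: "bij_betw f (verts F) (verts F')" "bij_betw g (edges F) (edges F')"
    "\<And>e. e \<in> edges F \<Longrightarrow> ends F' (g e) = image_mset f (ends F e)" "opens F' = map f (opens F)"
    using assms(1) unfolding fragment_iso_def iso_by_def by blast
  obtain f' g' where fg': "bij_betw f' (verts H) (verts H')" "bij_betw g' (edges H) (edges H')"
    "\<And>e. e \<in> edges H \<Longrightarrow> ends H' (g' e) = image_mset f' (ends H e)" "opens H' = map f' (opens H)"
    using assms(2) unfolding fragment_iso_def iso_by_def by blast
  have F: "set (opens F) \<subseteq> verts F" "length (opens F) = k"
    "\<And>e. e \<in> edges F \<Longrightarrow> set_mset (ends F e) \<subseteq> verts F"
    using assms(3) unfolding wf_fragment_def wf_graph_def by auto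
  have H: "set (opens H) \<subseteq> verts H" "length (opens H) = k"
    "\<And>e. e \<in> edges H \<Longrightarrow> set_mset (ends H e) \<subseteq> verts H"
    using assms(4) unfolding wf_fragment_def wf_graph_def by auto
  have inj: "inj_on f (verts F)" "inj_on f' (verts H)" "inj_on g (edges F)" "inj_on g' (edges H)"
    and im: "f ` verts F = verts F'" "f' ` verts H = verts H'"
      "g ` edges F = edges F'" "g' ` edges H = edges H'"
    using fg(1,2) fg'(1,2) unfolding bij_betw_def by simp_all
  let ?f = "map_sum f f'" and ?g = "map_sum g g'"
  have at: "opens F' ! i \<in># ends F' (g e) \<longleftrightarrow> opens F ! i \<in># ends F e"
    if "e \<in> edges F" "i < k" for i e
  proof -
    have "opens F ! i \<in> verts F" using that F nth_mem by blast
    then have "f (opens F ! i) \<in> f ` set_mset (ends F e) \<longleftrightarrow> opens F ! i \<in> set_mset (ends F e)"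
      using F(3)[OF that(1)] by (intro inj_on_image_mem_iff[OF inj(1)])
    then show ?thesis using fg(3,4) F(2) that by simp
  qed
  have at': "opens H' ! i \<in># ends H' (g' e) \<longleftrightarrow> opens H ! i \<in># ends H e"
    if "e \<in> edges H" "i < k" for i e
  proof -
    have "opens H ! i \<in> verts H" using that H nth_mem by blast
    then have "f' (opens H ! i) \<in> f' ` set_mset (ends H e) \<longleftrightarrow> opens H ! i \<in> set_mset (ends H e)"
      using H(3)[OF that(1)] by (intro inj_on_image_mem_iff[OF inj(2)])
    then show ?thesis using fg'(3,4) H(2) that by simp
  qed
  have steps: "glue_step F' H' = map_prod ?g ?g ` glue_step F H"
  proof
    show "map_prod ?g ?g ` glue_step F H \<subseteq> glue_step F' H'"
    proof
      fix p assume "p \<in> map_prod ?g ?g ` glue_step F H"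
      then obtain e e' i where p: "p = (Inl (g e), Inr (g' e'))" "e \<in> edges F" "e' \<in> edges H"
        "i < k" "opens F ! i \<in># ends F e" "opens H ! i \<in># ends H e'"
        using F(2) unfolding glue_step_def by auto
      then have "g e \<in> edges F'" "g' e' \<in> edges H'"
        "opens F' ! i \<in># ends F' (g e)" "opens H' ! i \<in># ends H' (g' e')" "i < length (opens F')"
        using at at' im F(2) fg(4) by auto
      then show "p \<in> glue_step F' H'" unfolding glue_step_def p(1) by blast
    qed
    show "glue_step F' H' \<subseteq> map_prod ?g ?g ` glue_step F H"
    proof
      fix p assume "p \<in> glue_step F' H'"
      then obtain e e' i where p: "p = (Inl (g e), Inr (g' e'))" "e \<in> edges F" "e' \<in> edges H"
        "i < k" "opens F' ! i \<in># ends F' (g e)" "opens H' ! i \<in># ends H' (g' e')"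
        using F(2) unfolding glue_step_def fg(4) im[symmetric] by auto
      then have "opens F ! i \<in># ends F e" "opens H ! i \<in># ends H e'" using at at' by auto
      then have "(Inl e, Inr e') \<in> glue_step F H" using p(2-4) F(2) unfolding glue_step_def by blast
      then show "p \<in> map_prod ?g ?g ` glue_step F H" using p(1) by (auto intro: rev_image_eqI)
    qed
  qed
  have rem: "remaining_ends F' H' (?g x) = image_mset ?f (remaining_ends F H x)"
    if "x \<in> edges F <+> edges H" for x
  proof (cases x)
    case (Inl e)
    then have "e \<in> edges F" using that by auto
    then have "filter_mset (\<lambda>v. v \<notin> set (opens F')) (ends F' (g e)) =
        image_mset f (filter_mset (\<lambda>v. v \<notin> set (opens F)) (ends F e))"
      unfolding fg(3)[OF \<open>e \<in> edges F\<close>] fg(4) using inj F by (intro filter_image_mset_inj) auto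
    then show ?thesis
      by (simp add: Inl remaining_ends_def image_mset.compositionality comp_def)
  next
    case (Inr e)
    then have "e \<in> edges H" using that by auto
    then have "filter_mset (\<lambda>v. v \<notin> set (opens H')) (ends H' (g' e)) =
        image_mset f' (filter_mset (\<lambda>v. v \<notin> set (opens H)) (ends H e))"
      unfolding fg'(3)[OF \<open>e \<in> edges H\<close>] fg'(4) using inj H by (intro filter_image_mset_inj) auto
    then show ?thesis
      by (simp add: Inr remaining_ends_def image_mset.compositionality comp_def)
  qed
  have imD: "?g ` (edges F <+> edges H) = edges F' <+> edges H'" by (simp add: im_sum im)
  have edge_bij: "bij_betw ((`) ?g) (edges (glue F H)) (edges (glue F' H'))"
    using quotient_image[OF inj_sum[OF inj(3,4)] glue_step_subset steps]
    by (simp add: glue_def imD)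
  have "f ` (verts F - set (opens F)) = verts F' - set (opens F')"
    using inj_on_image_set_diff[OF inj(1) _ F(1)] fg(4) im by simp
  moreover have "f' ` (verts H - set (opens H)) = verts H' - set (opens H')"
    using inj_on_image_set_diff[OF inj(2) _ H(1)] fg'(4) im by simp
  ultimately have vert_bij: "bij_betw ?f (verts (glue F H)) (verts (glue F' H'))"
    using inj_sum[OF inj_on_subset[OF inj(1)] inj_on_subset[OF inj(2)]]
    by (simp add: glue_def bij_betw_def im_sum)
  have "ends (glue F' H') (?g ` C) = image_mset ?f (ends (glue F H) C)"
    if "C \<in> edges (glue F H)" for C
  proof -
    have sub: "C \<subseteq> edges F <+> edges H"
    proof
      fix y assume "y \<in> C"
      then obtain x where "x \<in> edges F <+> edges H" "(x, y) \<in> (glue_step F H \<union> (glue_step F H)\<inverse>)\<^sup>*"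
        using \<open>C \<in> edges (glue F H)\<close> unfolding glue_def quotient_def by auto
      from this(2,1) show "y \<in> edges F <+> edges H"
        using glue_step_subset[of F H] by induction auto
    qed
    then have "inj_on ?g C" using inj_sum[OF inj(3,4)] inj_on_subset by blast
    then have "ends (glue F' H') (?g ` C) = (\<Sum>x\<in>C. remaining_ends F' H' (?g x))"
      by (simp add: glue_def sum.reindex)
    also have "\<dots> = (\<Sum>x\<in>C. image_mset ?f (remaining_ends F H x))"
      using sub rem by (intro sum.cong) auto
    also have "\<dots> = image_mset ?f (\<Sum>x\<in>C. remaining_ends F H x)"
      by (induction C rule: infinite_finite_induct) auto
    finally show ?thesis by (simp add: glue_def)
  qed
  then have "iso_by ?f ((`) ?g) (glue F H) (glue F' H')"
    using edge_bij vert_bij unfolding iso_by_def by blast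
  then show ?thesis unfolding graph_iso_def by blast
qed

lemma connected_card_le:
  assumes "finite J" "finite C" "C = (R \<union> R\<inverse>)\<^sup>* `` {x}" "R = {(a i, b i) | i. i \<in> J}"
  shows "card C \<le> Suc (card {i \<in> J. a i \<in> C})"
proof -
  let ?J = "{i \<in> J. a i \<in> C}"
  have closed: "w \<in> C" if "u \<in> C" "(u, w) \<in> R \<union> R\<inverse>" for u w
    using that unfolding assms(3) by (metis Image_singleton_iff rtrancl.rtrancl_into_rtrancl)
  have "m < card C \<Longrightarrow> \<exists>S K. x \<in> S \<and> S \<subseteq> C \<and> card S = Suc m \<and> K \<subseteq> ?J \<and> card K = m \<and>
      (\<forall>i\<in>K. a i \<in> S \<and> b i \<in> S)" for m
  proof (induction m)
    case 0
    show ?case by (rule exI[of _ "{x}"], rule exI[of _ "{}"]) (simp add: assms(3))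
  next
    case (Suc m)
    then obtain S K where S: "x \<in> S" "S \<subseteq> C" "card S = Suc m" "K \<subseteq> ?J" "card K = m"
      "\<forall>i\<in>K. a i \<in> S \<and> b i \<in> S" by auto
    have "S \<noteq> C" using S(3) Suc.prems by auto
    then obtain y where y: "y \<in> C" "y \<notin> S" using S(2) by blast
    have "\<exists>u w. (u, w) \<in> R \<union> R\<inverse> \<and> u \<in> S \<and> w \<notin> S"
    proof (rule ccontr)
      assume no: "\<not> ?thesis"
      have "(x, y) \<in> (R \<union> R\<inverse>)\<^sup>*" using y(1) assms(3) by simp
      then have "y \<in> S" by induction (use S(1) no in blast)+
      then show False using y(2) by simp
    qed
    then obtain u w where uw: "(u, w) \<in> R \<union> R\<inverse>" "u \<in> S" "w \<notin> S" by blast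
    have "w \<in> C" using closed uw S(2) by blast
    obtain i where i: "i \<in> J" "u = a i \<and> w = b i \<or> u = b i \<and> w = a i"
      using uw(1) unfolding assms(4) by blast
    have iJ: "i \<in> ?J" using i uw(2) S(2) \<open>w \<in> C\<close> by auto
    have iK: "i \<notin> K" using i uw S(6) by blast
    have fin: "finite S" "finite K"
      using finite_subset[OF S(2) assms(2)] finite_subset[OF S(4)] assms(1) by simp_all
    have "card (insert w S) = Suc (Suc m)" "card (insert i K) = Suc m"
      using fin S uw(3) iK by simp_all
    moreover have "\<forall>j\<in>insert i K. a j \<in> insert w S \<and> b j \<in> insert w S"
      using S(6) i(2) uw(2) by blast
    moreover have "insert i K \<subseteq> ?J" "insert w S \<subseteq> C" "x \<in> insert w S"
      using iJ S \<open>w \<in> C\<close> by blast+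
    ultimately show ?case by blast
  qed
  note grow = this
  show ?thesis
  proof (cases "card C")
    case (Suc m)
    then obtain K where "K \<subseteq> ?J" "card K = m" using grow[of m] by auto
    then show ?thesis using Suc card_mono[of ?J K] assms(1) by simp
  qed simp
qed

lemma open_end_edge:
  assumes "wf_fragment k F"
  obtains a where "\<And>i. i < k \<Longrightarrow> a i \<in> edges F"
    "\<And>i e. i < k \<Longrightarrow> e \<in> edges F \<Longrightarrow> count (ends F e) (opens F ! i) = (if e = a i then 1 else 0)"
proof -
  have "\<exists>e. e \<in> edges F \<and>
      (\<forall>e'\<in>edges F. count (ends F e') (opens F ! i) = (if e' = e then 1 else 0))" if "i < k" for i
  proof -
    let ?v = "opens F ! i"
    have fin: "finite (edges F)" and "size (incident_edges F ?v) = 1"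
      using assms that unfolding wf_fragment_def wf_graph_def by auto
    then have "(\<Sum>e\<in>edges F. count (ends F e) ?v) = 1"
      unfolding incident_edges_def by (simp add: size_multiset_sum)
    then obtain e where "e \<in> edges F" "count (ends F e) ?v = 1"
      "\<forall>e'\<in>edges F. e \<noteq> e' \<longrightarrow> count (ends F e') ?v = 0"
      unfolding sum_eq_1_iff[OF fin] by blast
    then show ?thesis by (intro exI[of _ e]) auto
  qed
  then obtain a where "\<And>i. i < k \<Longrightarrow> a i \<in> edges F \<and>
      (\<forall>e'\<in>edges F. count (ends F e') (opens F ! i) = (if e' = a i then 1 else 0))"
    by metis
  then show ?thesis using that[of a] by blast
qed

lemma size_filter_opens:
  assumes "distinct xs"
  shows "size (filter_mset (\<lambda>v. v \<in> set xs) M) = (\<Sum>i<length xs. count M (xs ! i))"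
proof -
  have "size (filter_mset (\<lambda>v. v \<in> set xs) M) = (\<Sum>v\<in>set xs. count M v)"
  proof (induction M)
    case (add x M)
    have "(\<Sum>v\<in>set xs. count (add_mset x M) v) =
        (\<Sum>v\<in>set xs. count M v) + (\<Sum>v\<in>set xs. if v = x then 1 else 0)"
      unfolding sum.distrib[symmetric] by (intro sum.cong) auto
    then show ?case using add by (simp add: sum.delta)
  qed simp
  also have "\<dots> = (\<Sum>i<length xs. count M (xs ! i))"
    using sum.reindex_bij_betw[OF bij_betw_nth[OF assms refl refl], of "count M"] by simp
  finally show ?thesis .
qed

lemma edge_of_glue_subset:
  assumes "C \<in> edges (glue F H)"
  shows "C \<subseteq> edges F <+> edges H"
proof
  fix y assume "y \<in> C"
  then obtain x where "x \<in> edges F <+> edges H" "(x, y) \<in> (glue_step F H \<union> (glue_step F H)\<inverse>)\<^sup>*"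
    using assms unfolding glue_def quotient_def by auto
  from this(2,1) show "y \<in> edges F <+> edges H"
    using glue_step_subset[of F H] by induction auto
qed

lemma size_ends_glue:
  fixes F :: "('a, 'b) fragment" and H :: "('c, 'd) fragment"
  assumes "wf_fragment k F" "wf_fragment k H" "C \<in> edges (glue F H)"
  shows "size (ends (glue F H) C) \<in> {0, 2}"
proof -
  let ?R = "glue_step F H"
  let ?D = "edges F <+> edges H"
  obtain x where x: "x \<in> ?D" "C = (?R \<union> ?R\<inverse>)\<^sup>* `` {x}"
    using assms(3) unfolding glue_def quotient_def by auto
  have sub: "C \<subseteq> ?D" using edge_of_glue_subset[OF assms(3)] .
  have finD: "finite ?D" using assms(1,2) unfolding wf_fragment_def wf_graph_def by auto
  have finC: "finite C" using sub finD finite_subset by blast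
  have F: "distinct (opens F)" "length (opens F) = k"
    "\<And>e. e \<in> edges F \<Longrightarrow> size (ends F e) \<in> {0, 2}"
    using assms(1) unfolding wf_fragment_def wf_graph_def by blast+
  have H: "distinct (opens H)" "length (opens H) = k"
    "\<And>e. e \<in> edges H \<Longrightarrow> size (ends H e) \<in> {0, 2}"
    using assms(2) unfolding wf_fragment_def wf_graph_def by blast+
  obtain a where a: "\<And>i. i < k \<Longrightarrow> a i \<in> edges F"
    "\<And>i e. i < k \<Longrightarrow> e \<in> edges F \<Longrightarrow> count (ends F e) (opens F ! i) = (if e = a i then 1 else 0)"
    using open_end_edge[OF assms(1)] by blast
  obtain b where b: "\<And>i. i < k \<Longrightarrow> b i \<in> edges H"
    "\<And>i e. i < k \<Longrightarrow> e \<in> edges H \<Longrightarrow> count (ends H e) (opens H ! i) = (if e = b i then 1 else 0)"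
    using open_end_edge[OF assms(2)] by blast
  have atF: "opens F ! i \<in># ends F e \<longleftrightarrow> e = a i" if "i < k" "e \<in> edges F" for i e
    using a(2)[OF that] unfolding count_greater_zero_iff[symmetric] by simp
  have atH: "opens H ! i \<in># ends H e \<longleftrightarrow> e = b i" if "i < k" "e \<in> edges H" for i e
    using b(2)[OF that] unfolding count_greater_zero_iff[symmetric] by simp
  have R: "?R = {(Inl (a i), Inr (b i)) | i. i \<in> {..<k}}"
  proof (intro equalityI subsetI)
    fix p assume "p \<in> ?R"
    then obtain e e' i where "p = (Inl e, Inr e')" "e \<in> edges F" "e' \<in> edges H" "i < k"
      "opens F ! i \<in># ends F e" "opens H ! i \<in># ends H e'"
      unfolding glue_step_def F(2) by blast
    then have "p = (Inl (a i), Inr (b i))" "i < k" using atF[of i e] atH[of i e'] by simp_all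
    then show "p \<in> {(Inl (a i), Inr (b i)) | i. i \<in> {..<k}}" by blast
  next
    fix p :: "('b + 'd) \<times> ('b + 'd)" assume "p \<in> {(Inl (a i), Inr (b i)) | i. i \<in> {..<k}}"
    then obtain i where i: "p = (Inl (a i), Inr (b i))" "i < k" by blast
    have "opens F ! i \<in># ends F (a i)" "opens H ! i \<in># ends H (b i)"
      using atF[of i "a i"] atH[of i "b i"] a(1) b(1) i(2) by simp_all
    then show "p \<in> ?R" unfolding glue_step_def F(2) using i a(1) b(1) by blast
  qed
  define total where "total y = (case y of Inl e \<Rightarrow> size (ends F e) | Inr e \<Rightarrow> size (ends H e))" for y
  define opn where "opn y = (\<Sum>i<k. (if y = Inl (a i) then 1 else 0) + (if y = Inr (b i) then 1 else 0 :: nat))" for y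
  have split: "size (remaining_ends F H y) + opn y = total y" if "y \<in> ?D" for y
  proof (cases y)
    case (Inl e)
    then have e: "e \<in> edges F" using that by auto
    have "opn y = size (filter_mset (\<lambda>v. v \<in> set (opens F)) (ends F e))"
      unfolding size_filter_opens[OF F(1)] F(2) opn_def Inl using a(2) e by (intro sum.cong) auto
    moreover have "size (ends F e) = size (filter_mset (\<lambda>v. v \<in> set (opens F)) (ends F e)) +
        size (filter_mset (\<lambda>v. v \<notin> set (opens F)) (ends F e))"
      by (metis multiset_partition size_union)
    ultimately show ?thesis by (simp add: Inl remaining_ends_def total_def)
  next
    case (Inr e)
    then have e: "e \<in> edges H" using that by auto
    have "opn y = size (filter_mset (\<lambda>v. v \<in> set (opens H)) (ends H e))"
      unfolding size_filter_opens[OF H(1)] H(2) opn_def Inr using b(2) e by (intro sum.cong) auto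
    moreover have "size (ends H e) = size (filter_mset (\<lambda>v. v \<in> set (opens H)) (ends H e)) +
        size (filter_mset (\<lambda>v. v \<notin> set (opens H)) (ends H e))"
      by (metis multiset_partition size_union)
    ultimately show ?thesis by (simp add: Inr remaining_ends_def total_def)
  qed
  have size_eq: "size (ends (glue F H) C) = (\<Sum>y\<in>C. size (remaining_ends F H y))"
    by (simp add: glue_def size_multiset_sum)
  let ?J = "{i \<in> {..<k}. Inl (a i) \<in> C}"
  have closed: "w \<in> C" if "u \<in> C" "(u, w) \<in> ?R \<union> ?R\<inverse>" for u w
    using that unfolding x(2) by (metis Image_singleton_iff rtrancl.rtrancl_into_rtrancl)
  have ab: "Inl (a i) \<in> C \<longleftrightarrow> Inr (b i) \<in> C" if "i < k" for i
    using closed[of "Inl (a i)" "Inr (b i)"] closed[of "Inr (b i)" "Inl (a i)"] that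
    unfolding R by blast
  have "(\<Sum>y\<in>C. opn y) = (\<Sum>i<k. \<Sum>y\<in>C. (if y = Inl (a i) then 1 else 0) + (if y = Inr (b i) then 1 else 0))"
    unfolding opn_def by (rule sum.swap)
  also have "\<dots> = (\<Sum>i<k. if Inl (a i) \<in> C then 2 else 0)"
    using finC ab by (intro sum.cong) (auto simp: sum.distrib sum.delta)
  also have "\<dots> = (\<Sum>i\<in>?J. 2)"
    by (rule sum.inter_filter[symmetric]) simp
  finally have opn_sum: "(\<Sum>y\<in>C. opn y) = 2 * card ?J" by simp
  have eq: "size (ends (glue F H) C) + 2 * card ?J = (\<Sum>y\<in>C. total y)"
    unfolding size_eq opn_sum[symmetric] sum.distrib[symmetric] using sub split by (intro sum.cong) auto
  have tot: "total y \<in> {0, 2}" if "y \<in> C" for y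
    using sub that F(3) H(3) unfolding total_def by (cases y) auto
  show ?thesis
  proof (cases "\<forall>y\<in>C. total y = 2")
    case True
    then have "(\<Sum>y\<in>C. total y) = 2 * card C" by simp
    moreover have "card C \<le> Suc (card ?J)"
      by (rule connected_card_le[OF _ finC x(2) R]) simp
    ultimately have "size (ends (glue F H) C) = 0 \<or> size (ends (glue F H) C) = 2"
      using eq by arith
    then show ?thesis by blast
  next
    case False
    then obtain y where y: "y \<in> C" "total y = 0" using tot by blast
    then have "opn y = 0" using split[of y] sub by auto
    then have "y \<noteq> Inl (a i)" "y \<noteq> Inr (b i)" if "i < k" for i
      using that unfolding opn_def by (auto split: if_splits)
    then have iso: "(y, z) \<notin> ?R \<union> ?R\<inverse>" "(z, y) \<notin> ?R \<union> ?R\<inverse>" for z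
      unfolding R by blast+
    have "(x, y) \<in> (?R \<union> ?R\<inverse>)\<^sup>*" using y(1) x(2) by simp
    then have "x = y" using iso(2) by (cases rule: rtranclE) auto
    have "z = y" if "z \<in> C" for z
    proof -
      have "(y, z) \<in> (?R \<union> ?R\<inverse>)\<^sup>*" using that x(2) \<open>x = y\<close> by simp
      then show ?thesis using iso(1) by (cases rule: converse_rtranclE) auto
    qed
    then have "C = {y}" using y(1) by blast
    then show ?thesis using eq y(2) by simp
  qed
qed

lemma wf_glue:
  assumes "wf_fragment k F" "wf_fragment k H"
  shows "wf_graph (glue F H)"
proof -
  have fin: "finite (verts F)" "finite (verts H)" "finite (edges F)" "finite (edges H)"
    and sub: "\<And>e. e \<in> edges F \<Longrightarrow> set_mset (ends F e) \<subseteq> verts F"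
      "\<And>e. e \<in> edges H \<Longrightarrow> set_mset (ends H e) \<subseteq> verts H"
    using assms unfolding wf_fragment_def wf_graph_def by blast+
  have "finite (verts (glue F H))" using fin by (simp add: glue_def)
  moreover have "finite (edges (glue F H))" using fin by (simp add: glue_def quotient_def)
  moreover have "set_mset (ends (glue F H) C) \<subseteq> verts (glue F H)" if "C \<in> edges (glue F H)" for C
  proof -
    have C: "C \<subseteq> edges F <+> edges H" using edge_of_glue_subset[OF that] .
    then have "finite C" using fin finite_subset by (metis finite_Plus)
    then have "set_mset (ends (glue F H) C) = (\<Union>x\<in>C. set_mset (remaining_ends F H x))"
      by (simp add: glue_def set_mset_sum)
    also have "\<dots> \<subseteq> verts (glue F H)"
    proof (rule UN_least)
      fix x assume "x \<in> C"
      then show "set_mset (remaining_ends F H x) \<subseteq> verts (glue F H)"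
        using C sub unfolding glue_def remaining_ends_def by (cases x) fastforce+
    qed
    finally show ?thesis .
  qed
  ultimately show ?thesis using size_ends_glue[OF assms] unfolding wf_graph_def by blast
qed

lemma ex_nat_fragment_iso:
  assumes "wf_fragment k F"
  shows "\<exists>F' :: (nat, nat) fragment. fragment_iso F F'"
proof -
  have fin: "finite (verts F)" "finite (edges F)"
    using assms unfolding wf_fragment_def wf_graph_def by blast+
  obtain f :: "_ \<Rightarrow> nat" where f: "inj_on f (verts F)"
    using finite_imp_inj_to_nat_seg[OF fin(1)] by blast
  obtain g :: "_ \<Rightarrow> nat" where g: "inj_on g (edges F)"
    using finite_imp_inj_to_nat_seg[OF fin(2)] by blast
  let ?F' = "\<lparr>verts = f ` verts F, edges = g ` edges F,
      ends = (\<lambda>e. image_mset f (ends F (inv_into (edges F) g e))), opens = map f (opens F)\<rparr>"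
  have "iso_by f g F ?F'"
    using f g unfolding iso_by_def by (auto simp: bij_betw_def)
  then have "fragment_iso F ?F'" unfolding fragment_iso_def by (metis fragment.select_convs(1))
  then show ?thesis ..
qed

lemma glue_class_fragment_class:
  assumes "wf_fragment k F" "wf_fragment k H"
  shows "glue_class (fragment_class F) (fragment_class H) = graph_class (glue F H)"
proof -
  have "graph_class (glue F' H') = graph_class (glue F H)"
    if "F' \<in> fragment_class F" "H' \<in> fragment_class H" for F' H'
    using that unfolding fragment_class_def
    by (intro graph_class_eq[OF glue_iso[OF _ _ assms] wf_glue[OF assms], symmetric]) auto
  moreover have "fragment_class F \<noteq> {}" "fragment_class H \<noteq> {}"
    using ex_nat_fragment_iso assms unfolding fragment_class_def by blast+
  ultimately show ?thesis unfolding glue_class_def by simp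
qed

section \<open>Properties of the actions\<close>

lemma orthogonal_group_inverse:
  assumes "U \<in> orthogonal_group n"
  shows "inverts_mat (transpose_mat U) U" "inverts_mat U (transpose_mat U)"
  using assms mat_mult_left_right_inverse[of "transpose_mat U" n U]
  unfolding orthogonal_group_def inverts_mat_def by auto

lemma poly_eval_superset:
  assumes "finite A" "Poly_Mapping.keys q \<subseteq> A"
  shows "poly_eval q v = (\<Sum>\<alpha>\<in>A. Poly_Mapping.lookup q \<alpha> *
    (\<Prod>i\<in>Poly_Mapping.keys \<alpha>. (v $ i) ^ Poly_Mapping.lookup \<alpha> i))"
  unfolding poly_eval_def using assms
  by (intro sum.mono_neutral_left) (auto simp: Poly_Mapping.in_keys_iff)

lemma poly_eval_single:
  "poly_eval (Poly_Mapping.single \<alpha> c) v =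
     c * (\<Prod>i\<in>Poly_Mapping.keys \<alpha>. (v $ i) ^ Poly_Mapping.lookup \<alpha> i)"
  by (subst poly_eval_superset[of "{\<alpha>}"]) simp_all

lemma poly_eval_add: "poly_eval (p + q) v = poly_eval p v + poly_eval q v"
proof -
  let ?A = "Poly_Mapping.keys p \<union> Poly_Mapping.keys q"
  have "Poly_Mapping.keys (p + q) \<subseteq> ?A" by (rule Poly_Mapping.keys_add)
  then show ?thesis
    by (simp add: poly_eval_superset[of ?A] Poly_Mapping.lookup_add sum.distrib algebra_simps)
qed

lemma poly_eval_sum: "poly_eval (\<Sum>x\<in>A. p x) v = (\<Sum>x\<in>A. poly_eval (p x) v)"
  by (induction A rule: infinite_finite_induct) (simp_all add: poly_eval_add, simp_all add: poly_eval_def)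

lemma prod_keys_add:
  "(\<Prod>i\<in>Poly_Mapping.keys (\<alpha> + \<beta>). (v $ i :: real) ^ Poly_Mapping.lookup (\<alpha> + \<beta>) i) =
   (\<Prod>i\<in>Poly_Mapping.keys \<alpha>. (v $ i) ^ Poly_Mapping.lookup \<alpha> i) *
   (\<Prod>i\<in>Poly_Mapping.keys \<beta>. (v $ i) ^ Poly_Mapping.lookup \<beta> i)"
proof -
  let ?A = "Poly_Mapping.keys \<alpha> \<union> Poly_Mapping.keys \<beta>"
  have ext: "(\<Prod>i\<in>Poly_Mapping.keys \<gamma>. (v $ i) ^ Poly_Mapping.lookup \<gamma> i) =
      (\<Prod>i\<in>?A. (v $ i) ^ Poly_Mapping.lookup \<gamma> i)" if "Poly_Mapping.keys \<gamma> \<subseteq> ?A" for \<gamma>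
    using that by (intro prod.mono_neutral_left) (auto simp: Poly_Mapping.in_keys_iff)
  show ?thesis
    by (subst (1 2 3) ext)
      (simp_all add: Poly_Mapping.keys_add Poly_Mapping.lookup_add power_add prod.distrib)
qed

lemma sum_monomials:
  "(\<Sum>\<alpha>\<in>Poly_Mapping.keys p. Poly_Mapping.single \<alpha> (Poly_Mapping.lookup p \<alpha>)) = p"
  by (rule poly_mapping_eqI)
    (auto simp: Poly_Mapping.lookup_sum Poly_Mapping.lookup_single when_def Poly_Mapping.in_keys_iff)

lemma poly_eval_mult: "poly_eval (p * q) v = poly_eval p v * poly_eval q v"
proof -
  let ?m = "\<lambda>p \<alpha>. Poly_Mapping.single \<alpha> (Poly_Mapping.lookup p \<alpha>) :: mpoly"
  have "p * q = (\<Sum>\<alpha>\<in>Poly_Mapping.keys p. \<Sum>\<beta>\<in>Poly_Mapping.keys q. ?m p \<alpha> * ?m q \<beta>)"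
    unfolding sum_product[symmetric] sum_monomials ..
  then show ?thesis
    unfolding poly_eval_def[of p] poly_eval_def[of q] sum_product
    by (simp add: poly_eval_sum Poly_Mapping.mult_single poly_eval_single prod_keys_add mult_ac)
qed

lemma poly_eval_one: "poly_eval 1 v = 1"
  using poly_eval_single[of 0 1 v] by simp

lemma poly_eval_power: "poly_eval (p ^ m) v = poly_eval p v ^ m"
  by (induction m) (simp_all add: poly_eval_one poly_eval_mult)

lemma poly_eval_prod: "poly_eval (\<Prod>x\<in>A. p x) v = (\<Prod>x\<in>A. poly_eval (p x) v)"
  by (induction A rule: infinite_finite_induct) (simp_all add: poly_eval_one poly_eval_mult)

lemma poly_eval_linear_form:
  assumes "dim_vec v = dim_vec a"
  shows "poly_eval (linear_form a) v = a \<bullet> v"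
  using assms unfolding linear_form_def scalar_prod_def
  by (simp add: poly_eval_sum poly_eval_single lessThan_atLeast0)

lemma poly_eval_linear_subst:
  assumes "q \<in> polys n" "A \<in> carrier_mat n n" "v \<in> carrier_vec n"
  shows "poly_eval (linear_subst A q) v = poly_eval q (A *\<^sub>v v)"
proof -
  have "poly_eval (linear_form (row A i)) v = (A *\<^sub>v v) $ i"
    if "\<alpha> \<in> Poly_Mapping.keys q" "i \<in> Poly_Mapping.keys \<alpha>" for \<alpha> i
  proof -
    have "i < n" using assms(1) that unfolding polys_def by blast
    then show ?thesis using assms(2,3) by (simp add: poly_eval_linear_form)
  qed
  then show ?thesis
    unfolding linear_subst_def poly_eval_def[of q] poly_eval_sum poly_eval_mult poly_eval_single
      poly_eval_prod poly_eval_power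
    by (intro sum.cong arg_cong2[where f = "(*)"] prod.cong) simp_all
qed

lemma mem_multi_indices: "is \<in> multi_indices n k \<longleftrightarrow> length is = k \<and> (\<forall>l<k. is ! l < n)"
  unfolding multi_indices_def by (auto simp: set_conv_nth)

lemma tensor_act_pure_tensor:
  assumes "U \<in> carrier_mat n n" "set vs \<subseteq> carrier_vec n"
  shows "tensor_act n (length vs) U (pure_tensor n vs) = pure_tensor n (map ((*\<^sub>v) U) vs)"
proof
  fix "is"
  show "tensor_act n (length vs) U (pure_tensor n vs) is = pure_tensor n (map ((*\<^sub>v) U) vs) is"
  proof (cases "is \<in> multi_indices n (length vs)")
    case True
    let ?k = "length vs"
    let ?g = "\<lambda>l j. U $$ (is ! l, j) * vs ! l $ j"
    have len: "length is = ?k" and lt: "\<And>l. l < ?k \<Longrightarrow> is ! l < n"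
      using True unfolding multi_indices_def by (auto simp: subset_iff)
    have "tensor_act n ?k U (pure_tensor n vs) is =
        (\<Sum>js\<in>multi_indices n ?k. \<Prod>l<?k. ?g l (js ! l))"
      unfolding tensor_act_def pure_tensor_def using True by (simp add: prod.distrib)
    also have "\<dots> = (\<Sum>p\<in>{..<?k} \<rightarrow>\<^sub>E {..<n}. \<Prod>l<?k. ?g l (p l))"
      by (rule sum.reindex_bij_witness[where
            j = "\<lambda>js. restrict ((!) js) {..<?k}" and i = "\<lambda>p. map p [0..<?k]"])
        (auto simp: mem_multi_indices PiE_def extensional_def fun_eq_iff intro!: nth_equalityI)
    also have "\<dots> = (\<Prod>l<?k. \<Sum>j<n. ?g l j)"
      by (rule prod_sum_PiE[symmetric]) simp_all
    also have "\<dots> = (\<Prod>l<?k. (U *\<^sub>v (vs ! l)) $ (is ! l))"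
    proof (rule prod.cong)
      fix l assume "l \<in> {..<?k}"
      then have "vs ! l \<in> carrier_vec n" "is ! l < n" using assms(2) lt by (auto simp: subset_iff)
      then show "(\<Sum>j<n. ?g l j) = (U *\<^sub>v (vs ! l)) $ (is ! l)"
        using assms(1) by (simp add: scalar_prod_def lessThan_atLeast0)
    qed simp
    finally show ?thesis using True by (simp add: pure_tensor_def)
  qed (simp add: tensor_act_def pure_tensor_def)
qed

end

theory Submission
  imports "HOL-Probability.Infinite_Product_Measure" Defs
begin

text \<open>
  Cutting the edges of a fragment \<open>F\<close> at its open ends turns its partition function into a tensor
  \<open>t\<^sub>F\<close>: its entry at \<open>xs\<close> is the sum over the colourings that give the open ends the colours \<open>xs\<close>
  (\<open>fragment_tensor\<close>). Gluing is the inner product of tensors (\<open>partition_function_glue\<close>), so the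
  connection matrix is a Gram matrix and its rank is the dimension of the span of the \<open>t\<^sub>F\<close>
  (\<open>edge_connection_rank_eq\<close>). It remains to see that the \<open>t\<^sub>F\<close> span the invariants of the
  stabilizer of \<open>h\<close>.

  They are invariant because \<open>t\<^sub>F\<close> is obtained from the symmetric tensors of values of \<open>h\<close> by
  contracting indices along the edges: the former are fixed by the stabilizer, and the contractions
  commute with orthogonal matrices (\<open>diagram_tensor_invariant\<close>).

  For the converse, let \<open>T\<close> be invariant and orthogonal to all \<open>t\<^sub>F\<close>. Consider the functions
  \<open>g \<mapsto> (g T)\<^sub>w\<close> and the algebra generated by the entries of \<open>g g\<^sup>T\<close> and of the translates \<open>g H\<close> of the
  tensors \<open>H\<close> of values of \<open>h\<close>, all on the space of real matrices \<open>g\<close> of size \<open>n\<close>. Integrate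
  over \<open>g\<close> against a weight that depends only on the sum of the squares of the entries. Integration
  by parts shows that the moments of \<open>g\<close> are combinations of products of Kronecker deltas
  (\<open>moments_in_pairing_span\<close>), as for Gaussian matrices. Therefore the integral of an element
  of the algebra times \<open>(g T)\<^sub>w\<close> is a combination of inner products of \<open>T\<close> with tensors \<open>t\<^sub>F\<close>, and
  vanishes (\<open>orthogonal_model_polys\<close>).

  On the other hand, two invertible matrices on which the algebra agrees have the same \<open>g g\<^sup>T\<close>, so
  they differ by an orthogonal matrix, and this matrix fixes \<open>h\<close>. As \<open>T\<close> is invariant,
  \<open>det(g)\<^sup>2 (g T)\<^sub>w\<close> is constant on the fibres of the algebra
  (\<open>det_mult_invariant_constant_on_fibres\<close>), so by the Stone-Weierstrass theorem it is a uniform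
  limit of elements of the algebra on a compact set. Together, the integral of \<open>det(g)\<^sup>2 (g T)\<^sub>w\<^sup>2\<close>
  vanishes, hence so does \<open>T\<close>.
\<close>

section \<open>Sums over multi-indices\<close>

lemma multi_indices_0 [simp]: "multi_indices n 0 = {[]}"
  by (auto simp: multi_indices_def)

lemma finite_multi_indices [simp]: "finite (multi_indices n k)"
  unfolding multi_indices_def by (rule finite_lists_length_eq) simp

lemma sum_multi_indices_Suc:
  "(\<Sum>xs\<in>multi_indices n (Suc k). f xs) = (\<Sum>x<n. \<Sum>xs\<in>multi_indices n k. f (x # xs))"
proof -
  have "multi_indices n (Suc k) = (\<lambda>(x, xs). x # xs) ` ({..<n} \<times> multi_indices n k)"
    by (auto simp: multi_indices_def length_Suc_conv image_iff)
  moreover have "inj_on (\<lambda>(x, xs). x # xs) ({..<n} \<times> multi_indices n k)"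
    by (auto simp: inj_on_def)
  ultimately show ?thesis
    by (simp add: sum.reindex sum.cartesian_product case_prod_unfold)
qed

lemma sum_multi_indices_add:
  "(\<Sum>zs\<in>multi_indices n (m + k). f zs) =
   (\<Sum>xs\<in>multi_indices n m. \<Sum>ys\<in>multi_indices n k. f (xs @ ys))"
  by (induction m arbitrary: f) (simp_all add: sum_multi_indices_Suc)

lemma sum_multi_indices_eq:
  assumes "ys \<in> multi_indices n k"
  shows "(\<Sum>xs\<in>multi_indices n k. of_bool (ys = xs) * f xs) = (f ys :: real)"
proof -
  have "(\<Sum>xs\<in>multi_indices n k. of_bool (ys = xs) * f xs) =
      (\<Sum>xs\<in>multi_indices n k. if ys = xs then f xs else 0)"
    by (intro sum.cong) auto
  then show ?thesis using assms by simp
qed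


section \<open>Matrix powers acting on tensors\<close>

text \<open>Products of entries are taken along a list, so that they follow list recursion. For
  \<open>cs = zip xs ys\<close> this is the entry at \<open>xs\<close>, \<open>ys\<close> of the tensor power of the matrix \<open>g\<close>.\<close>

definition monom_at :: "('i \<Rightarrow> real) \<Rightarrow> 'i list \<Rightarrow> real" where
  "monom_at g cs = prod_list (map g cs)"

lemma monom_at_simps [simp]:
  "monom_at g [] = 1" "monom_at g (c # cs) = g c * monom_at g cs"
  "monom_at g (cs @ ds) = monom_at g cs * monom_at g ds"
  by (simp_all add: monom_at_def)

lemma prod_zip_monom_at:
  assumes "length xs = k" "length ys = k"
  shows "(\<Prod>l<k. g (xs ! l, ys ! l)) = monom_at g (zip xs ys)"
proof -
  have "monom_at g (zip xs ys) = (\<Prod>l<length (map g (zip xs ys)). map g (zip xs ys) ! l)"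
    unfolding monom_at_def prod.list_conv_set_nth by (simp add: lessThan_atLeast0)
  then show ?thesis using assms by simp
qed

text \<open>Matrices are functions of a pair of indices and may be singular here: the polynomial
  functions of the later sections live on the space of all matrices.\<close>

definition mat_act :: "nat \<Rightarrow> (nat \<times> nat \<Rightarrow> real) \<Rightarrow> (nat list \<Rightarrow> real) \<Rightarrow> nat list \<Rightarrow> real" where
  "mat_act n g T xs = (\<Sum>ys\<in>multi_indices n (length xs). monom_at g (zip xs ys) * T ys)"

lemma tensor_act_eq_mat_act:
  assumes "xs \<in> multi_indices n k"
  shows "tensor_act n k U T xs = mat_act n (\<lambda>p. U $$ p) T xs"
proof -
  have len: "length xs = k" using assms by (simp add: multi_indices_def)
  have "(\<Prod>l<k. U $$ (xs ! l, ys ! l)) = monom_at (\<lambda>p. U $$ p) (zip xs ys)"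
    if "ys \<in> multi_indices n k" for ys
    using that len by (intro prod_zip_monom_at) (simp_all add: multi_indices_def)
  then show ?thesis
    using assms len by (simp add: tensor_act_def mat_act_def)
qed

lemma mat_act_append:
  "mat_act n g (\<lambda>zs. S (take m zs) * T (drop m zs)) (xs @ ys) = mat_act n g S xs * mat_act n g T ys"
  if "length xs = m"
proof -
  have "length us = m" if "us \<in> multi_indices n m" for us
    using that by (simp add: multi_indices_def)
  then have "mat_act n g (\<lambda>zs. S (take m zs) * T (drop m zs)) (xs @ ys) =
      (\<Sum>us\<in>multi_indices n m. \<Sum>vs\<in>multi_indices n (length ys).
         (monom_at g (zip xs us) * S us) * (monom_at g (zip ys vs) * T vs))"
    using that by (simp add: mat_act_def sum_multi_indices_add mult_ac)
  then show ?thesis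
    using that by (simp add: mat_act_def sum_product)
qed

lemma mat_act_mult:
  assumes "A \<in> carrier_mat n n" "B \<in> carrier_mat n n" "xs \<in> multi_indices n k"
  shows "mat_act n (\<lambda>p. (A * B) $$ p) T xs = mat_act n (\<lambda>p. A $$ p) (mat_act n (\<lambda>p. B $$ p) T) xs"
proof -
  have *: "monom_at (\<lambda>p. (A * B) $$ p) (zip xs zs) = (\<Sum>ys\<in>multi_indices n k.
      monom_at (\<lambda>p. A $$ p) (zip xs ys) * monom_at (\<lambda>p. B $$ p) (zip ys zs))"
    if "xs \<in> multi_indices n k" "zs \<in> multi_indices n k" for xs zs
    using that
  proof (induction k arbitrary: xs zs)
    case (Suc k)
    obtain x xs' z zs' where eq: "xs = x # xs'" "zs = z # zs'"
      "xs' \<in> multi_indices n k" "zs' \<in> multi_indices n k" "x < n" "z < n"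
      using Suc.prems by (auto simp: multi_indices_def length_Suc_conv)
    have "(A * B) $$ (x, z) = (\<Sum>y<n. A $$ (x, y) * B $$ (y, z))"
      using assms(1,2) eq by (simp add: scalar_prod_def lessThan_atLeast0)
    then show ?case
      unfolding eq by (simp add: Suc.IH[OF eq(3,4)] sum_multi_indices_Suc sum_product mult_ac)
  qed simp
  have len: "length ys = k" if "ys \<in> multi_indices n k" for ys
    using that by (simp add: multi_indices_def)
  show ?thesis
    unfolding mat_act_def len[OF assms(3)]
    by (simp add: len *[OF assms(3)] sum_distrib_left sum_distrib_right mult.assoc cong: sum.cong)
      (rule sum.swap)
qed

lemma mat_act_one:
  assumes "xs \<in> multi_indices n k"
  shows "mat_act n (\<lambda>p. (1\<^sub>m n) $$ p) T xs = T xs"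
proof -
  have *: "monom_at (\<lambda>p. (1\<^sub>m n) $$ p) (zip xs ys) = of_bool (xs = ys)"
    if "xs \<in> multi_indices n k" "ys \<in> multi_indices n k" for xs ys
    using that
  proof (induction k arbitrary: xs ys)
    case (Suc k)
    obtain x xs' y ys' where eq: "xs = x # xs'" "ys = y # ys'"
      "xs' \<in> multi_indices n k" "ys' \<in> multi_indices n k" "x < n" "y < n"
      using Suc.prems by (auto simp: multi_indices_def length_Suc_conv)
    then show ?case using Suc.IH[OF eq(3,4)] by simp
  qed simp
  have "length xs = k" using assms by (simp add: multi_indices_def)
  then show ?thesis
    using assms by (simp add: mat_act_def * sum_multi_indices_eq cong: sum.cong)
qed

lemma mat_act_cong:
  assumes "\<And>ys. ys \<in> multi_indices n (length xs) \<Longrightarrow> S ys = T ys"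
  shows "mat_act n g S xs = mat_act n g T xs"
  using assms by (simp add: mat_act_def)

lemma mat_act_cong_mat:
  assumes "\<And>i j. i < n \<Longrightarrow> j < n \<Longrightarrow> g (i, j) = g' (i, j)" "xs \<in> multi_indices n k"
  shows "mat_act n g T xs = mat_act n g' T xs"
proof -
  have "monom_at g (zip xs ys) = monom_at g' (zip xs ys)" if "ys \<in> multi_indices n k" for ys
  proof -
    have "g p = g' p" if "p \<in> set (zip xs ys)" for p
    proof -
      have "fst p \<in> set xs" "snd p \<in> set ys"
        using that by (metis prod.collapse set_zip_leftD, metis prod.collapse set_zip_rightD)
      then have "fst p < n" "snd p < n"
        using \<open>ys \<in> multi_indices n k\<close> assms(2) unfolding multi_indices_def by auto
      then show ?thesis using assms(1)[of "fst p" "snd p"] by simp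
    qed
    then show ?thesis unfolding monom_at_def by (metis (no_types, lifting) map_cong)
  qed
  moreover have "length xs = k" using assms(2) by (simp add: multi_indices_def)
  ultimately show ?thesis by (simp add: mat_act_def)
qed


section \<open>The stabilizer of a vertex model\<close>

abbreviation list_count :: "nat list \<Rightarrow> (nat \<Rightarrow>\<^sub>0 nat)" where
  "list_count xs \<equiv> colour_count (\<lambda>i. i) (mset xs)"

lemma colour_count_add_mset [simp]:
  "colour_count \<phi> (add_mset x M) = Poly_Mapping.single (\<phi> x) 1 + colour_count \<phi> M"
  "colour_count \<phi> {#} = 0"
  by (simp_all add: colour_count_def)

lemma list_count_map: "list_count (map \<phi> xs) = colour_count \<phi> (mset xs)"
  by (induction xs) simp_all

lemma linear_extension_superset:
  assumes "finite A" "Poly_Mapping.keys q \<subseteq> A"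
  shows "linear_extension h q = (\<Sum>\<alpha>\<in>A. Poly_Mapping.lookup q \<alpha> * h \<alpha>)"
  unfolding linear_extension_def using assms
  by (intro sum.mono_neutral_left) (auto simp: Poly_Mapping.in_keys_iff)

lemma linear_extension_single: "linear_extension h (Poly_Mapping.single \<alpha> c) = c * h \<alpha>"
  by (subst linear_extension_superset[of "{\<alpha>}"]) simp_all

lemma linear_extension_add: "linear_extension h (p + q) = linear_extension h p + linear_extension h q"
proof -
  let ?A = "Poly_Mapping.keys p \<union> Poly_Mapping.keys q"
  have "Poly_Mapping.keys (p + q) \<subseteq> ?A" by (rule Poly_Mapping.keys_add)
  then show ?thesis
    by (simp add: linear_extension_superset[of ?A] Poly_Mapping.lookup_add sum.distrib algebra_simps)
qed

lemma linear_extension_sum: "linear_extension h (\<Sum>x\<in>A. p x) = (\<Sum>x\<in>A. linear_extension h (p x))"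
  by (induction A rule: infinite_finite_induct)
    (simp_all add: linear_extension_add, simp_all add: linear_extension_def)

lemma prod_linear_forms:
  assumes "U \<in> carrier_mat n n" "xs \<in> multi_indices n k"
  shows "prod_list (map (\<lambda>i. linear_form (row U i)) xs) =
    (\<Sum>ys\<in>multi_indices n k. Poly_Mapping.single (list_count ys) (monom_at (\<lambda>p. U $$ p) (zip xs ys)))"
  using assms(2)
proof (induction k arbitrary: xs)
  case (Suc k)
  obtain x xs' where eq: "xs = x # xs'" "xs' \<in> multi_indices n k" "x < n"
    using Suc.prems by (auto simp: multi_indices_def length_Suc_conv)
  have "linear_form (row U x) = (\<Sum>j<n. Poly_Mapping.single (Poly_Mapping.single j 1) (U $$ (x, j)))"
    using assms(1) eq by (simp add: linear_form_def)
  then show ?case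
    unfolding eq by (simp add: Suc.IH[OF eq(2)] sum_multi_indices_Suc sum_product
        Poly_Mapping.mult_single)
qed simp

text \<open>Expanding \<open>\<Prod>\<^sub>l (\<Sum>\<^sub>j U x\<^sub>l j)\<close> gives one monomial for each choice of the indices \<open>j\<close>, with the
  coefficient with which \<open>U\<close> acts on tensors.\<close>

lemma linear_extension_subst_monomial:
  assumes "U \<in> carrier_mat n n" "xs \<in> multi_indices n k"
  shows "linear_extension h (Poly_Mapping.single 0 c *
      (\<Prod>i\<in>Poly_Mapping.keys (list_count xs).
         linear_form (row U i) ^ Poly_Mapping.lookup (list_count xs) i)) =
    c * mat_act n (\<lambda>p. U $$ p) (\<lambda>ys. h (list_count ys)) xs"
proof -
  have keys: "Poly_Mapping.keys (list_count xs) = set_mset (mset xs)"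
    by (auto simp: Poly_Mapping.in_keys_iff lookup_colour_count)
  have "(\<Prod>i\<in>Poly_Mapping.keys (list_count xs).
         linear_form (row U i) ^ Poly_Mapping.lookup (list_count xs) i) =
      prod_mset (image_mset (\<lambda>i. linear_form (row U i)) (mset xs))"
    unfolding keys image_prod_mset_multiplicity by (simp add: lookup_colour_count)
  also have "\<dots> = prod_list (map (\<lambda>i. linear_form (row U i)) xs)"
    by (metis mset_map prod_mset_prod_list)
  finally show ?thesis
    using assms(2)
    by (simp add: prod_linear_forms[OF assms] mat_act_def multi_indices_def sum_distrib_left
        linear_extension_sum linear_extension_single Poly_Mapping.mult_single mult_ac)
qed

lemma list_count_surj:
  assumes "Poly_Mapping.keys \<alpha> \<subseteq> {..<n}"
  obtains xs where "xs \<in> multi_indices n (length xs)" "list_count xs = \<alpha>"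
proof -
  have "{i. 0 < Poly_Mapping.lookup \<alpha> i} = Poly_Mapping.keys \<alpha>"
    by (auto simp: Poly_Mapping.in_keys_iff)
  then have fin: "finite {i. 0 < Poly_Mapping.lookup \<alpha> i}" by simp
  obtain xs where xs: "mset xs = Abs_multiset (Poly_Mapping.lookup \<alpha>)"
    using ex_mset by blast
  have cnt: "count (mset xs) i = Poly_Mapping.lookup \<alpha> i" for i
    unfolding xs using fin by (simp add: Abs_multiset_inverse)
  have "list_count xs = \<alpha>"
    by (rule poly_mapping_eqI) (simp add: lookup_colour_count cnt)
  moreover have "set xs \<subseteq> {..<n}"
  proof
    fix i assume "i \<in> set xs"
    then have "i \<in> Poly_Mapping.keys \<alpha>"
      by (simp add: Poly_Mapping.in_keys_iff cnt[symmetric])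
    then show "i \<in> {..<n}" using assms by blast
  qed
  ultimately show ?thesis using that by (simp add: multi_indices_def)
qed

text \<open>The stabilizer is cut out by the tensors whose entries are the values of \<open>h\<close> on the
  monomials of a fixed degree, so it is visible to the tensors that a graph can produce.\<close>

lemma mem_stabilizer_iff:
  "U \<in> stabilizer n h \<longleftrightarrow> U \<in> orthogonal_group n \<and>
    (\<forall>k. \<forall>xs\<in>multi_indices n k.
       mat_act n (\<lambda>p. U $$ p) (\<lambda>ys. h (list_count ys)) xs = h (list_count xs))"
proof -
  have "(\<forall>q\<in>polys n. dual_act U (linear_extension h) q = linear_extension h q) \<longleftrightarrow>
      (\<forall>k. \<forall>xs\<in>multi_indices n k.
         mat_act n (\<lambda>p. U $$ p) (\<lambda>ys. h (list_count ys)) xs = h (list_count xs))"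
    if U: "U \<in> carrier_mat n n"
  proof (intro iffI allI ballI)
    fix k xs assume *: "\<forall>q\<in>polys n. dual_act U (linear_extension h) q = linear_extension h q"
      and xs: "xs \<in> multi_indices n k"
    have "Poly_Mapping.keys (list_count xs) \<subseteq> {..<n}"
      using xs by (auto simp: multi_indices_def Poly_Mapping.in_keys_iff lookup_colour_count)
    then have "Poly_Mapping.single (list_count xs) 1 \<in> polys n"
      by (simp add: polys_def)
    from *[rule_format, OF this] show
      "mat_act n (\<lambda>p. U $$ p) (\<lambda>ys. h (list_count ys)) xs = h (list_count xs)"
      using linear_extension_subst_monomial[OF U xs, of h 1]
      by (simp add: dual_act_def poly_act_def linear_subst_def linear_extension_single)
  next
    fix q assume *: "\<forall>k. \<forall>xs\<in>multi_indices n k.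
         mat_act n (\<lambda>p. U $$ p) (\<lambda>ys. h (list_count ys)) xs = h (list_count xs)"
      and q: "q \<in> polys n"
    have "linear_extension h (Poly_Mapping.single 0 c *
      (\<Prod>i\<in>Poly_Mapping.keys \<alpha>. linear_form (row U i) ^ Poly_Mapping.lookup \<alpha> i)) = c * h \<alpha>"
      if \<alpha>: "\<alpha> \<in> Poly_Mapping.keys q" for \<alpha> c
    proof -
      obtain xs where xs: "xs \<in> multi_indices n (length xs)" "list_count xs = \<alpha>"
        using q \<alpha> list_count_surj[of \<alpha> n] unfolding polys_def by blast
      show ?thesis
        using linear_extension_subst_monomial[OF U xs(1), of h c] * xs by simp
    qed
    then show "dual_act U (linear_extension h) q = linear_extension h q"
      unfolding dual_act_def poly_act_def linear_subst_def linear_extension_sum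
      by (simp add: linear_extension_def)
  qed
  then show ?thesis
    unfolding stabilizer_def orthogonal_group_def by blast
qed


section \<open>Pairings\<close>

text \<open>The positions of the word \<open>w\<close> are the ends of edges and its letters are the edges, so every
  edge has two ends; an edge that does not occur is a circle.\<close>

definition pairing :: "'e set \<Rightarrow> 'e list \<Rightarrow> bool" where
  "pairing E w \<longleftrightarrow> finite E \<and> set w \<subseteq> E \<and> (\<forall>e\<in>E. count_list w e \<in> {0, 2})"

definition pairing_tensor :: "nat \<Rightarrow> 'e set \<Rightarrow> 'e list \<Rightarrow> nat list \<Rightarrow> real" where
  "pairing_tensor n E w xs = (\<Sum>\<phi>\<in>E \<rightarrow>\<^sub>E {..<n}. of_bool (map \<phi> w = xs))"

lemma map_colouring_multi_indices:
  assumes "\<phi> \<in> E \<rightarrow>\<^sub>E {..<n}" "set w \<subseteq> E"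
  shows "map \<phi> w \<in> multi_indices n (length w)"
  using assms by (auto simp: multi_indices_def)

lemma sum_PiE_insert:
  assumes "e \<notin> E"
  shows "(\<Sum>\<phi>\<in>insert e E \<rightarrow>\<^sub>E B. f \<phi>) = (\<Sum>\<phi>\<in>E \<rightarrow>\<^sub>E B. \<Sum>c\<in>B. f (\<phi>(e := c)))"
proof -
  have "(\<Sum>\<phi>\<in>insert e E \<rightarrow>\<^sub>E B. f \<phi>) = (\<Sum>p\<in>B \<times> (E \<rightarrow>\<^sub>E B). f ((snd p)(e := fst p)))"
    unfolding PiE_insert_eq
    using inj_combinator[OF assms, of "\<lambda>_. B"]
    by (subst sum.reindex) (simp_all add: case_prod_unfold)
  also have "\<dots> = (\<Sum>c\<in>B. \<Sum>\<phi>\<in>E \<rightarrow>\<^sub>E B. f (\<phi>(e := c)))"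
    by (simp add: sum.cartesian_product case_prod_unfold)
  finally show ?thesis by (simp add: sum.swap[of _ B])
qed

text \<open>Once the positions are grouped by their letters, the colours of different edges vary independently.\<close>

lemma sum_monom_at_colourings:
  fixes n :: nat and f :: "nat \<times> nat \<Rightarrow> real"
  assumes "finite E" "set w \<subseteq> E" "length zs = length w"
  shows "(\<Sum>\<phi>\<in>E \<rightarrow>\<^sub>E {..<n}. monom_at f (zip zs (map \<phi> w))) =
    (\<Prod>e\<in>E. \<Sum>c<n. \<Prod>l | l < length w \<and> w ! l = e. f (zs ! l, c))"
proof -
  have "monom_at f (zip zs (map \<phi> w)) =
      (\<Prod>e\<in>E. \<Prod>l | l < length w \<and> w ! l = e. f (zs ! l, \<phi> e))" for \<phi>
  proof -
    have "monom_at f (zip zs (map \<phi> w)) = (\<Prod>l<length w. f (zs ! l, map \<phi> w ! l))"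
      using assms(3) by (intro prod_zip_monom_at[symmetric]) simp_all
    also have "\<dots> = (\<Prod>l<length w. f (zs ! l, \<phi> (w ! l)))" by simp
    also have "\<dots> = (\<Prod>e\<in>E. \<Prod>l | l \<in> {..<length w} \<and> w ! l = e. f (zs ! l, \<phi> (w ! l)))"
      using assms(1,2) by (intro prod.group[symmetric]) auto
    also have "\<dots> = (\<Prod>e\<in>E. \<Prod>l | l < length w \<and> w ! l = e. f (zs ! l, \<phi> e))"
      by (intro prod.cong) auto
    finally show ?thesis .
  qed
  then show ?thesis
    using assms(1) by (subst prod_sum_PiE) simp_all
qed

lemma of_bool_list_eq:
  "length xs = length ys \<Longrightarrow>
    of_bool (ys = xs) = monom_at (\<lambda>(x, y). of_bool (x = y)) (zip xs ys)"
  by (induction xs ys rule: list_induct2) auto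

text \<open>Each edge contributes the factor \<open>\<Sum>\<^sub>c U\<^sub>x\<^sub>c U\<^sub>y\<^sub>c\<close>,
  which for an orthogonal matrix does not depend on \<open>U\<close>. A letter that does not occur
  contributes \<open>n\<close>.\<close>

lemma pairing_tensor_invariant:
  assumes "U \<in> orthogonal_group n" "pairing E w" "zs \<in> multi_indices n (length w)"
  shows "mat_act n (\<lambda>p. U $$ p) (pairing_tensor n E w) zs = pairing_tensor n E w zs"
proof -
  have U: "U \<in> carrier_mat n n" "U * transpose_mat U = 1\<^sub>m n"
    using orthogonal_group_inverse(2)[OF assms(1)] assms(1)
    unfolding orthogonal_group_def inverts_mat_def by auto
  have row: "(\<Sum>c<n. U $$ (x, c) * U $$ (y, c)) = of_bool (x = y)" if "x < n" "y < n" for x y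
  proof -
    have "(\<Sum>c<n. U $$ (x, c) * U $$ (y, c)) = (U * transpose_mat U) $$ (x, y)"
      using that U(1) by (simp add: scalar_prod_def lessThan_atLeast0)
    then show ?thesis using that U(2) by simp
  qed
  have E: "finite E" "set w \<subseteq> E" "\<And>e. e \<in> E \<Longrightarrow> count_list w e \<in> {0, 2}"
    using assms(2) unfolding pairing_def by blast+
  have zs: "length zs = length w" "\<And>l. l < length w \<Longrightarrow> zs ! l < n"
    using assms(3) by (auto simp: mem_multi_indices)
  have "mat_act n (\<lambda>p. U $$ p) (pairing_tensor n E w) zs =
      (\<Sum>\<phi>\<in>E \<rightarrow>\<^sub>E {..<n}. \<Sum>ys\<in>multi_indices n (length w).
         of_bool (map \<phi> w = ys) * monom_at (\<lambda>p. U $$ p) (zip zs ys))"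
    unfolding mat_act_def pairing_tensor_def sum_distrib_left zs(1)
    by (subst sum.swap) (simp add: mult.commute)
  also have "\<dots> = (\<Sum>\<phi>\<in>E \<rightarrow>\<^sub>E {..<n}. monom_at (\<lambda>p. U $$ p) (zip zs (map \<phi> w)))"
    using map_colouring_multi_indices[OF _ E(2)] by (intro sum.cong sum_multi_indices_eq) auto
  also have "\<dots> = (\<Prod>e\<in>E. \<Sum>c<n. \<Prod>l | l < length w \<and> w ! l = e. U $$ (zs ! l, c))"
    by (rule sum_monom_at_colourings[OF E(1,2) zs(1)])
  also have "\<dots> = (\<Prod>e\<in>E. \<Sum>c<n. \<Prod>l | l < length w \<and> w ! l = e. (case (zs ! l, c) of (x, y) \<Rightarrow> of_bool (x = y)))"
  proof (rule prod.cong)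
    fix e assume "e \<in> E"
    let ?L = "{l. l < length w \<and> w ! l = e}"
    have "card ?L = count_list w e"
      by (simp add: count_list_eq_length_filter length_filter_conv_card eq_commute)
    then consider "card ?L = 0" | "card ?L = 2" using E(3)[OF \<open>e \<in> E\<close>] by auto
    then show "(\<Sum>c<n. \<Prod>l\<in>?L. U $$ (zs ! l, c)) = (\<Sum>c<n. \<Prod>l\<in>?L. (case (zs ! l, c) of (x, y) \<Rightarrow> of_bool (x = y)))"
    proof cases
      case 1
      have "finite ?L" by simp
      then have "?L = {}" using 1 by (simp only: card_0_eq)
      then show ?thesis by (simp only: prod.empty)
    next
      case 2
      then obtain l l' where L: "?L = {l, l'}" "l \<noteq> l'" by (auto simp: card_2_iff)
      then have lt: "l < length w" "l' < length w" by blast+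
      have "(\<Sum>c<n. of_bool (zs ! l = c) * of_bool (zs ! l' = c)) = (\<Sum>c<n. if zs ! l = c then of_bool (zs ! l' = c) else (0::real))"
        by (intro sum.cong) auto
      then have "(\<Sum>c<n. of_bool (zs ! l = c) * of_bool (zs ! l' = c)) = (of_bool (zs ! l = zs ! l') :: real)"
        using zs(2)[OF lt(1)] by simp
      then show ?thesis
        unfolding L(1) using L(2) row[OF zs(2)[OF lt(1)] zs(2)[OF lt(2)]] by simp
    qed
  qed simp
  also have "\<dots> = (\<Sum>\<phi>\<in>E \<rightarrow>\<^sub>E {..<n}. monom_at (\<lambda>(x, y). of_bool (x = y)) (zip zs (map \<phi> w)))"
    by (rule sum_monom_at_colourings[OF E(1,2) zs(1), symmetric])
  also have "\<dots> = pairing_tensor n E w zs"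
    unfolding pairing_tensor_def using zs(1) by (intro sum.cong) (simp_all add: of_bool_list_eq)
  finally show ?thesis .
qed

definition insert_at :: "nat \<Rightarrow> 'a \<Rightarrow> 'a list \<Rightarrow> 'a list" where
  "insert_at l x xs = take l xs @ x # drop l xs"

definition remove_at :: "nat \<Rightarrow> 'a list \<Rightarrow> 'a list" where
  "remove_at l xs = take l xs @ drop (Suc l) xs"

lemma insert_at_eq_iff:
  assumes "length ys = Suc (length zs)" "l \<le> length zs"
  shows "insert_at l c zs = ys \<longleftrightarrow> c = ys ! l \<and> zs = remove_at l ys"
proof -
  have "insert_at l c zs = ys \<longleftrightarrow> take l zs = take l ys \<and> c # drop l zs = drop l ys"
    using assms unfolding insert_at_def by (auto simp: append_eq_conv_conj)
  also have "drop l ys = ys ! l # drop (Suc l) ys"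
    using assms by (simp add: Cons_nth_drop_Suc)
  finally have "insert_at l c zs = ys \<longleftrightarrow>
      c = ys ! l \<and> take l zs = take l ys \<and> drop l zs = drop (Suc l) ys" by auto
  also have "take l zs = take l ys \<and> drop l zs = drop (Suc l) ys \<longleftrightarrow>
      take l zs @ drop l zs = take l ys @ drop (Suc l) ys"
    using assms by (intro append_eq_append_conv[symmetric]) simp
  finally show ?thesis by (simp add: remove_at_def)
qed

lemma pairing_insert:
  assumes "pairing E w" "e \<notin> E"
  shows "pairing (insert e E) (e # insert_at l e w)"
proof -
  have cnt: "count_list (insert_at l e w) f = count_list w f + (if f = e then 1 else 0)" for f
  proof -
    have "count_list w f = count_list (take l w) f + count_list (drop l w) f"
      by (metis append_take_drop_id count_list_append)
    then show ?thesis by (simp add: insert_at_def)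
  qed
  have "set (insert_at l e w) \<subseteq> insert e (set w)"
    using set_take_subset[of l w] set_drop_subset[of l w] unfolding insert_at_def by auto
  moreover have "count_list w e = 0"
    using assms by (auto simp: pairing_def count_list_0_iff)
  ultimately show ?thesis
    using assms unfolding pairing_def by (auto simp: cnt)
qed

text \<open>The new edge joins the first position to position \<open>l\<close> of the rest, so its two ends have to
  receive the same colour.\<close>

lemma pairing_tensor_insert:
  assumes "pairing E w" "e \<notin> E" "l \<le> length w" "length ys = Suc (length w)" "x < n"
  shows "pairing_tensor n (insert e E) (e # insert_at l e w) (x # ys) =
    of_bool (ys ! l = x) * pairing_tensor n E w (remove_at l ys)"
proof -
  have eq: "of_bool (map (\<phi>(e := c)) (e # insert_at l e w) = x # ys) =
      (if c = x then of_bool (ys ! l = x) * of_bool (map \<phi> w = remove_at l ys) else (0::real))" for \<phi> c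
  proof -
    have "e \<notin> set w" using assms(1,2) by (auto simp: pairing_def)
    then have "e \<notin> set (take l w)" "e \<notin> set (drop l w)" 
      using set_take_subset[of l w] set_drop_subset[of l w] by auto
    then have "map (\<phi>(e := c)) (insert_at l e w) = insert_at l c (map \<phi> w)"
      by (simp add: insert_at_def take_map drop_map)
    then show ?thesis
      using insert_at_eq_iff[of ys "map \<phi> w" l c] assms(3,4) by auto
  qed
  show ?thesis
    unfolding pairing_tensor_def sum_PiE_insert[OF assms(2)] eq
    using assms(5) by (simp add: sum_distrib_left)
qed

text \<open>Joining two flags of different edges merges the edges; joining the two flags of one edge
  leaves a circle.\<close>

lemma pairing_tensor_contract:
  fixes E :: "'e set"
  assumes "pairing E (a # b # w)"
  obtains E' :: "'e set" and w' where "pairing E' w'" "length w' = length w"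
    "\<And>n xs. (\<Sum>c<n. pairing_tensor n E (a # b # w) (c # c # xs)) = pairing_tensor n E' w' xs"
proof -
  have E: "finite E" "set w \<subseteq> E" "a \<in> E" "b \<in> E"
    "\<And>e. e \<in> E \<Longrightarrow> count_list (a # b # w) e \<in> {0, 2}"
    using assms unfolding pairing_def by auto
  have sum: "(\<Sum>c<n. pairing_tensor n E (a # b # w) (c # c # xs)) =
      (\<Sum>\<phi>\<in>E \<rightarrow>\<^sub>E {..<n}. of_bool (\<phi> a = \<phi> b \<and> map \<phi> w = xs))" for n xs
  proof -
    have "(\<Sum>c<n. of_bool (map \<phi> (a # b # w) = c # c # xs)) = (of_bool (\<phi> a = \<phi> b \<and> map \<phi> w = xs) :: real)"
      if "\<phi> \<in> E \<rightarrow>\<^sub>E {..<n}" for \<phi>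
    proof -
      have "\<phi> a < n" using that E(3) by auto
      moreover have "(\<Sum>c<n. of_bool (map \<phi> (a # b # w) = c # c # xs)) =
          (\<Sum>c<n. if \<phi> a = c then of_bool (\<phi> a = \<phi> b \<and> map \<phi> w = xs) else (0::real))"
        by (intro sum.cong) auto
      ultimately show ?thesis by simp
    qed
    then show ?thesis unfolding pairing_tensor_def by (subst sum.swap) simp
  qed
  show ?thesis
  proof (cases "a = b")
    case True
    have "count_list w e \<in> {0, 2}" if "e \<in> E" for e
      using E(5)[OF that] True by (auto split: if_splits)
    then have "pairing E w" using E by (simp add: pairing_def)
    moreover have "(\<Sum>c<n. pairing_tensor n E (a # b # w) (c # c # xs)) = pairing_tensor n E w xs" for n xs
      unfolding sum unfolding pairing_tensor_def using True by simp
    ultimately show ?thesis by (intro that[of E w]) simp_all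
  next
    case False
    let ?m = "\<lambda>e. if e = b then a else e"
    have cnt: "count_list (map ?m w) e = (if e = b then 0 else if e = a then count_list w a + count_list w b else count_list w e)" for e
      by (induction w) (use False in auto)
    have "count_list w a = 1" "count_list w b = 1"
      using E(5)[OF E(3)] E(5)[OF E(4)] False by auto
    moreover have "count_list w e \<in> {0, 2}" if "e \<in> E" "e \<noteq> a" "e \<noteq> b" for e
      using E(5)[OF that(1)] that(2,3) by simp
    ultimately have "pairing (E - {b}) (map ?m w)"
      unfolding pairing_def cnt using E(1-4) False by auto
    moreover have "(\<Sum>c<n. pairing_tensor n E (a # b # w) (c # c # xs)) = pairing_tensor n (E - {b}) (map ?m w) xs" for n xs
    proof -
      have eq: "insert b (E - {b}) = E" using E(4) by blast
      have "(\<Sum>\<phi>\<in>E \<rightarrow>\<^sub>E {..<n}. of_bool (\<phi> a = \<phi> b \<and> map \<phi> w = xs)) =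
          (\<Sum>\<phi>\<in>(E - {b}) \<rightarrow>\<^sub>E {..<n}. \<Sum>c<n. of_bool (\<phi> a = c \<and> map (\<phi>(b := c)) w = xs) :: real)"
        using sum_PiE_insert[of b "E - {b}" "\<lambda>\<phi>. of_bool (\<phi> a = \<phi> b \<and> map \<phi> w = xs) :: real" "{..<n}"] False
        unfolding eq by simp
      also have "\<dots> = (\<Sum>\<phi>\<in>(E - {b}) \<rightarrow>\<^sub>E {..<n}. of_bool (map \<phi> (map ?m w) = xs))"
      proof (rule sum.cong)
        fix \<phi> assume "\<phi> \<in> (E - {b}) \<rightarrow>\<^sub>E {..<n}"
        then have "\<phi> a < n" using E(3) False by auto
        moreover have "(\<Sum>c<n. of_bool (\<phi> a = c \<and> map (\<phi>(b := c)) w = xs)) =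
            (\<Sum>c<n. if \<phi> a = c then of_bool (map (\<phi>(b := \<phi> a)) w = xs) else 0 :: real)"
          by (intro sum.cong) auto
        moreover have "map (\<phi>(b := \<phi> a)) w = map \<phi> (map ?m w)" by simp
        ultimately show "(\<Sum>c<n. of_bool (\<phi> a = c \<and> map (\<phi>(b := c)) w = xs)) = (of_bool (map \<phi> (map ?m w) = xs) :: real)"
          by simp
      qed simp
      finally show ?thesis unfolding sum by (simp add: pairing_tensor_def)
    qed
    ultimately show ?thesis by (intro that[of "E - {b}" "map ?m w"]) simp_all
  qed
qed


section \<open>Diagrams\<close>

fun vertex_tensor :: "((nat \<Rightarrow>\<^sub>0 nat) \<Rightarrow> real) \<Rightarrow> nat list \<Rightarrow> nat list \<Rightarrow> real" where
  "vertex_tensor h [] xs = 1"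
| "vertex_tensor h (d # ds) xs = h (list_count (take d xs)) * vertex_tensor h ds (drop d xs)"

text \<open>A fragment seen from its edges: the word \<open>u\<close> lists the edges at the first vertex, then those
  at the second, and so on, with the degrees in \<open>ds\<close>; the word \<open>w\<close> lists the edges at the open
  ends. Isolating the edges in this way turns the tensor into a contraction of tensors of \<open>h\<close>
  with a pairing.\<close>

definition diagram_tensor ::
    "nat \<Rightarrow> ((nat \<Rightarrow>\<^sub>0 nat) \<Rightarrow> real) \<Rightarrow> 'e set \<Rightarrow> nat list \<Rightarrow> 'e list \<Rightarrow> 'e list \<Rightarrow> nat list \<Rightarrow> real" where
  "diagram_tensor n h E ds u w xs =
     (\<Sum>\<phi>\<in>E \<rightarrow>\<^sub>E {..<n}. of_bool (map \<phi> w = xs) * vertex_tensor h ds (map \<phi> u))"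

lemma diagram_tensor_contraction:
  assumes "set u \<subseteq> E"
  shows "diagram_tensor n h E ds u w xs =
    (\<Sum>ys\<in>multi_indices n (length u). vertex_tensor h ds ys * pairing_tensor n E (u @ w) (ys @ xs))"
proof -
  have "(\<Sum>ys\<in>multi_indices n (length u). vertex_tensor h ds ys * pairing_tensor n E (u @ w) (ys @ xs)) =
     (\<Sum>\<phi>\<in>E \<rightarrow>\<^sub>E {..<n}. \<Sum>ys\<in>multi_indices n (length u).
        of_bool (map \<phi> u = ys) * (of_bool (map \<phi> w = xs) * vertex_tensor h ds ys))"
    unfolding pairing_tensor_def sum_distrib_left
    by (subst sum.swap) (intro sum.cong; auto simp: multi_indices_def)
  also have "\<dots> = (\<Sum>\<phi>\<in>E \<rightarrow>\<^sub>E {..<n}. of_bool (map \<phi> w = xs) * vertex_tensor h ds (map \<phi> u))"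
    using map_colouring_multi_indices[OF _ assms] by (intro sum.cong sum_multi_indices_eq) auto
  finally show ?thesis by (simp add: diagram_tensor_def)
qed

lemma vertex_tensor_invariant:
  assumes "U \<in> stabilizer n h" "xs \<in> multi_indices n (sum_list ds)"
  shows "mat_act n (\<lambda>p. U $$ p) (vertex_tensor h ds) xs = vertex_tensor h ds xs"
  using assms(2)
proof (induction ds arbitrary: xs)
  case Nil
  then show ?case by (simp add: mat_act_def)
next
  case (Cons d ds)
  let ?a = "take d xs" and ?b = "drop d xs"
  have mem: "?a \<in> multi_indices n d" "?b \<in> multi_indices n (sum_list ds)"
    using Cons.prems set_take_subset[of d xs] set_drop_subset[of d xs]
    by (auto simp: multi_indices_def)
  have "mat_act n (\<lambda>p. U $$ p) (vertex_tensor h (d # ds)) xs =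
     mat_act n (\<lambda>p. U $$ p) (\<lambda>zs. h (list_count (take d zs)) * vertex_tensor h ds (drop d zs)) (?a @ ?b)"
    by (simp add: mat_act_def)
  also have "\<dots> = mat_act n (\<lambda>p. U $$ p) (\<lambda>zs. h (list_count zs)) ?a * mat_act n (\<lambda>p. U $$ p) (vertex_tensor h ds) ?b"
    using mem(1) by (intro mat_act_append) (simp add: multi_indices_def)
  also have "\<dots> = h (list_count ?a) * vertex_tensor h ds ?b"
    using assms(1) mem Cons.IH[OF mem(2)] unfolding mem_stabilizer_iff by simp
  finally show ?case unfolding vertex_tensor.simps(2)[of h d ds xs] .
qed

lemma monom_at_transpose:
  assumes "U \<in> carrier_mat n n" "xs \<in> multi_indices n k" "ys \<in> multi_indices n k"
  shows "monom_at (\<lambda>p. transpose_mat U $$ p) (zip xs ys) = monom_at (\<lambda>p. U $$ p) (zip ys xs)"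
  using assms(2,3)
proof (induction k arbitrary: xs ys)
  case (Suc k)
  obtain x xs' y ys' where eq: "xs = x # xs'" "ys = y # ys'"
    "xs' \<in> multi_indices n k" "ys' \<in> multi_indices n k" "x < n" "y < n"
    using Suc.prems by (auto simp: multi_indices_def length_Suc_conv)
  then show ?case using Suc.IH[OF eq(3,4)] assms(1) by simp
qed simp

text \<open>The pairing absorbs an orthogonal matrix acting on all of its positions. So \<open>U\<close> acting on the
  open positions can be traded for the transpose of \<open>U\<close> acting on the positions at the vertices,
  where an element of the stabilizer fixes the tensors of \<open>h\<close>.\<close>

lemma diagram_tensor_invariant:
  assumes "pairing E (u @ w)" "length u = sum_list ds"
  shows "diagram_tensor n h E ds u w \<in> tensor_invariants n (length w) (stabilizer n h)"
proof -
  let ?D = "diagram_tensor n h E ds u w" and ?P = "pairing_tensor n E (u @ w)"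
  let ?M = "multi_indices n (length u)" and ?K = "multi_indices n (length w)"
  have sub: "set u \<subseteq> E" "set w \<subseteq> E" using assms(1) by (auto simp: pairing_def)
  have "?D xs = 0" if "xs \<notin> ?K" for xs
    using that map_colouring_multi_indices[OF _ sub(2)] unfolding diagram_tensor_def
    by (intro sum.neutral) auto
  then have pow: "?D \<in> tensor_power n (length w)" by (simp add: tensor_power_def)
  have "tensor_act n (length w) U ?D xs = ?D xs" if "U \<in> stabilizer n h" for U xs
  proof (cases "xs \<in> ?K")
    case True
    let ?U = "\<lambda>p. U $$ p"
    have UO: "U \<in> orthogonal_group n" using that by (simp add: mem_stabilizer_iff)
    then have U: "U \<in> carrier_mat n n" "transpose_mat U * U = 1\<^sub>m n" "transpose_mat U \<in> carrier_mat n n"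
      by (simp_all add: orthogonal_group_def)
    have len: "length ys = length u" if "ys \<in> ?M" for ys using that by (simp add: multi_indices_def)
    have lenx: "length xs = length w" using True by (simp add: multi_indices_def)
    have P: "?P (zs @ xs) = (\<Sum>ys\<in>?M. \<Sum>js\<in>?K.
        monom_at ?U (zip zs ys) * monom_at ?U (zip xs js) * ?P (ys @ js))" if "zs \<in> ?M" for zs
    proof -
      have "zs @ xs \<in> multi_indices n (length (u @ w))"
        using that True by (auto simp: multi_indices_def)
      from pairing_tensor_invariant[OF UO assms(1) this, symmetric]
      show ?thesis using that lenx by (simp add: mat_act_def len sum_multi_indices_add cong: sum.cong)
    qed
    \<comment> \<open>The transpose is the inverse of \<open>U\<close>, so it fixes the tensor as well.\<close>
    have V: "(\<Sum>zs\<in>?M. vertex_tensor h ds zs * monom_at ?U (zip zs ys)) = vertex_tensor h ds ys"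
      if "ys \<in> ?M" for ys
    proof -
      have "(\<Sum>zs\<in>?M. vertex_tensor h ds zs * monom_at ?U (zip zs ys)) =
          mat_act n (\<lambda>p. transpose_mat U $$ p) (vertex_tensor h ds) ys"
        unfolding mat_act_def len[OF that]
        by (intro sum.cong refl) (simp add: monom_at_transpose[OF U(1) that])
      also have "\<dots> = mat_act n (\<lambda>p. transpose_mat U $$ p) (mat_act n ?U (vertex_tensor h ds)) ys"
        using vertex_tensor_invariant[OF \<open>U \<in> stabilizer n h\<close>] assms(2) len[OF that]
        by (intro mat_act_cong) simp
      also have "\<dots> = vertex_tensor h ds ys"
        using mat_act_mult[OF U(3,1) that] mat_act_one[OF that] U(2) by simp
      finally show ?thesis .
    qed
    have "?D xs = (\<Sum>zs\<in>?M. \<Sum>ys\<in>?M. \<Sum>js\<in>?K. vertex_tensor h ds zs *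
        (monom_at ?U (zip zs ys) * monom_at ?U (zip xs js) * ?P (ys @ js)))"
      unfolding diagram_tensor_contraction[OF sub(1)] by (simp add: P sum_distrib_left cong: sum.cong)
    also have "\<dots> = (\<Sum>js\<in>?K. \<Sum>ys\<in>?M. \<Sum>zs\<in>?M. vertex_tensor h ds zs *
        (monom_at ?U (zip zs ys) * monom_at ?U (zip xs js) * ?P (ys @ js)))"
      by (subst sum.swap, subst (2) sum.swap, subst sum.swap) (rule refl)
    also have "\<dots> = (\<Sum>js\<in>?K. monom_at ?U (zip xs js) * (\<Sum>ys\<in>?M. 
        (\<Sum>zs\<in>?M. vertex_tensor h ds zs * monom_at ?U (zip zs ys)) * ?P (ys @ js)))"
      by (simp add: sum_distrib_left sum_distrib_right mult_ac)
    also have "\<dots> = mat_act n ?U ?D xs"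
      unfolding mat_act_def lenx diagram_tensor_contraction[OF sub(1)] by (simp add: V cong: sum.cong)
    finally show ?thesis using tensor_act_eq_mat_act[OF True] by simp
  next
    case False
    then show ?thesis using pow by (simp add: tensor_act_def tensor_power_def)
  qed
  then show ?thesis using pow by (auto simp: tensor_invariants_def)
qed


section \<open>Fragments as diagrams\<close>

text \<open>An open end has degree one, so the set of its edges is a singleton.\<close>

definition open_edges :: "('v, 'e) fragment \<Rightarrow> 'e list" where
  "open_edges F = map (\<lambda>v. the_elem (set_mset (incident_edges F v))) (opens F)"

definition fragment_tensor ::
    "nat \<Rightarrow> ((nat \<Rightarrow>\<^sub>0 nat) \<Rightarrow> real) \<Rightarrow> ('v, 'e) fragment \<Rightarrow> nat list \<Rightarrow> real" where
  "fragment_tensor n h F xs = (\<Sum>\<phi>\<in>edges F \<rightarrow>\<^sub>E {..<n}. of_bool (map \<phi> (open_edges F) = xs) *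
     (\<Prod>v\<in>verts F - set (opens F). h (colour_count \<phi> (incident_edges F v))))"

lemma incident_edges_open_end:
  assumes "wf_fragment k F" "v \<in> set (opens F)"
  shows "incident_edges F v = {#the_elem (set_mset (incident_edges F v))#}"
proof -
  have "size (incident_edges F v) = 1" using assms by (simp add: wf_fragment_def)
  then obtain e where "incident_edges F v = {#e#}" using size_1_singleton_mset by blast
  then show ?thesis by simp
qed

lemma set_incident_edges:
  assumes "finite (edges F)"
  shows "set_mset (incident_edges F v) \<subseteq> edges F"
  using count_incident_edges[OF assms, of v] by (metis count_eq_zero_iff subsetI)

lemma set_open_edges:
  assumes "wf_fragment k F"
  shows "set (open_edges F) \<subseteq> edges F"
proof
  fix e assume "e \<in> set (open_edges F)"
  then obtain v where v: "v \<in> set (opens F)" "e = the_elem (set_mset (incident_edges F v))"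
    by (auto simp: open_edges_def)
  have "e \<in># incident_edges F v"
    unfolding v(2) by (subst incident_edges_open_end[OF assms v(1)]) simp
  then show "e \<in> edges F"
    using set_incident_edges[of F v] assms by (auto simp: wf_fragment_def wf_graph_def)
qed

lemma length_open_edges: "wf_fragment k F \<Longrightarrow> length (open_edges F) = k"
  by (simp add: open_edges_def wf_fragment_def)

lemma mset_open_edges:
  assumes "wf_fragment k F"
  shows "mset (open_edges F) = (\<Sum>v\<in>set (opens F). incident_edges F v)"
proof -
  have dist: "distinct (opens F)" using assms by (simp add: wf_fragment_def)
  have "mset (open_edges F) = sum_list (map (\<lambda>v. {#the_elem (set_mset (incident_edges F v))#}) vs)" if "vs = opens F" for vs
    unfolding open_edges_def that[symmetric] by (induction vs) auto
  also have "sum_list (map (\<lambda>v. {#the_elem (set_mset (incident_edges F v))#}) (opens F)) = sum_list (map (incident_edges F) (opens F))"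
    using incident_edges_open_end[OF assms] by (metis (no_types, lifting) map_eq_conv)
  finally show ?thesis
    using dist by (simp add: sum_list_distinct_conv_sum_set)
qed

lemma vertex_tensor_concat:
  "vertex_tensor h (map length Ls) (map \<phi> (concat Ls)) =
    prod_list (map (\<lambda>L. h (colour_count \<phi> (mset L))) Ls)"
  by (induction Ls) (simp_all add: take_map drop_map list_count_map[symmetric])

text \<open>Listing the edges at each vertex counts every edge once for each of its endpoints, and open
  ends count as endpoints; hence each edge occurs twice or, for a circle, not at all.\<close>

lemma fragment_tensor_eq_diagram_tensor:
  fixes F :: "('v, 'e) fragment"
  assumes F: "wf_fragment k F"
  obtains ds u where "pairing (edges F) (u @ open_edges F)" "length u = sum_list ds"
    "\<And>n h. fragment_tensor n h F = diagram_tensor n h (edges F) ds u (open_edges F)"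
proof -
  let ?V = "verts F - set (opens F)"
  have fin: "finite (edges F)" "finite (verts F)" and sub: "set (opens F) \<subseteq> verts F"
    using F by (auto simp: wf_fragment_def wf_graph_def)
  obtain vs where vs: "set vs = ?V" "distinct vs"
    using finite_distinct_list[of ?V] fin(2) by auto
  have "\<forall>v. \<exists>L. mset L = incident_edges F v" using ex_mset by blast
  then obtain L where L: "\<And>v. mset (L v) = incident_edges F v" unfolding choice_iff by blast
  let ?u = "concat (map L vs)" and ?ds = "map length (map L vs)"
  have "mset ?u = (\<Sum>v\<in>?V. incident_edges F v)"
  proof -
    have "mset ?u = sum_list (map (incident_edges F) vs)"
      by (simp add: mset_concat comp_def L)
    then show ?thesis using vs by (simp add: sum_list_distinct_conv_sum_set)
  qed
  then have mset: "mset (?u @ open_edges F) = (\<Sum>v\<in>verts F. incident_edges F v)"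
    using sum.subset_diff[OF sub fin(2), of "incident_edges F"] mset_open_edges[OF F] by simp
  have cnt: "count_list (?u @ open_edges F) e = size (ends F e)" if e: "e \<in> edges F" for e
  proof -
    have "count_list (?u @ open_edges F) e = (\<Sum>v\<in>verts F. count (ends F e) v)"
      unfolding count_mset[symmetric] mset count_sum using count_incident_edges[OF fin(1)] e by simp
    also have "\<dots> = size (ends F e)"
      unfolding size_multiset_overloaded_eq
      using fin(2) F e by (intro sum.mono_neutral_right) (auto simp: wf_fragment_def wf_graph_def not_in_iff)
    finally show ?thesis .
  qed
  have "set ?u \<subseteq> edges F"
    using set_incident_edges[OF fin(1)] L by (metis (no_types, lifting) UN_least set_concat set_map set_mset_mset image_iff)
  then have "pairing (edges F) (?u @ open_edges F)"
    unfolding pairing_def using fin(1) set_open_edges[OF F] cnt F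
    by (auto simp: wf_fragment_def wf_graph_def simp del: count_list_append)
  moreover have "length ?u = sum_list ?ds" by (simp add: length_concat)
  moreover have "fragment_tensor n h F = diagram_tensor n h (edges F) ?ds ?u (open_edges F)" for n h
  proof -
    have "vertex_tensor h ?ds (map \<phi> ?u) = (\<Prod>v\<in>?V. h (colour_count \<phi> (incident_edges F v)))" for \<phi>
      unfolding vertex_tensor_concat vs(1)[symmetric]
      using vs(2) by (simp add: comp_def L prod.distinct_set_conv_list)
    then show ?thesis by (simp add: fun_eq_iff fragment_tensor_def diagram_tensor_def)
  qed
  ultimately show ?thesis using that by blast
qed

lemma ex_blocks:
  assumes "length u = sum_list ds"
  obtains Ls where "u = concat Ls" "map length Ls = ds"
proof -
  have "\<exists>Ls. u = concat Ls \<and> map length Ls = ds"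
    using assms
  proof (induction ds arbitrary: u)
    case Nil
    then show ?case by (intro exI[of _ "[]"]) simp
  next
    case (Cons d ds)
    have "length (drop d u) = sum_list ds" using Cons.prems by simp
    then obtain Ls where "drop d u = concat Ls" "map length Ls = ds" using Cons.IH by blast
    moreover have "length (take d u) = d" using Cons.prems by simp
    moreover have "u = take d u @ drop d u" by simp
    ultimately show ?case by (intro exI[of _ "take d u # Ls"]) (metis concat.simps(2) list.simps(9))
  qed
  then show ?thesis using that by blast
qed

lemma sum_nth_lessThan: "(\<Sum>i<length Bs. f (Bs ! i)) = sum_list (map f Bs)"
  unfolding sum_list_sum_nth by (simp add: lessThan_atLeast0)

lemma count_list_concat: "count_list (concat Bs) e = sum_list (map (\<lambda>B. count_list B e) Bs)"
  by (induction Bs) simp_all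

text \<open>Every block of \<open>u\<close> becomes a vertex and every letter of \<open>w\<close> an open end of degree one.\<close>

lemma diagram_tensor_eq_fragment_tensor:
  fixes E :: "nat set"
  assumes "pairing E (u @ w)" "length u = sum_list ds"
  obtains F :: "(nat, nat) fragment" where "wf_fragment (length w) F"
    "\<And>n h. fragment_tensor n h F = diagram_tensor n h E ds u w"
proof -
  obtain Ls where Ls: "u = concat Ls" "map length Ls = ds" using ex_blocks[OF assms(2)] .
  define Bs where "Bs = Ls @ map (\<lambda>e. [e]) w"
  let ?r = "length Ls" and ?k = "length w"
  define F :: "(nat, nat) fragment" where "F = \<lparr>verts = {..<length Bs}, edges = E,
    ends = (\<lambda>e. \<Sum>v<length Bs. replicate_mset (count_list (Bs ! v) e) v), opens = [?r..<?r + ?k]\<rparr>"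
  have con: "concat Bs = u @ w" unfolding Bs_def Ls(1) by (induction w) simp_all
  have lenB: "length Bs = ?r + ?k" by (simp add: Bs_def)
  have E: "finite E" "set (u @ w) \<subseteq> E" "\<And>e. e \<in> E \<Longrightarrow> count_list (u @ w) e \<in> {0, 2}"
    using assms(1) by (auto simp: pairing_def)
  have setB: "set (Bs ! v) \<subseteq> E" if "v < length Bs" for v
    using E(2) nth_mem[OF that] unfolding con[symmetric] set_concat by blast
  have cnt: "count (ends F e) v = (if v < length Bs then count_list (Bs ! v) e else 0)" for e v
    by (simp add: F_def count_sum)
  have size: "size (ends F e) = count_list (u @ w) e" for e
    unfolding con[symmetric] count_list_concat sum_nth_lessThan[symmetric]
    by (simp add: F_def size_multiset_sum)
  have "set_mset (ends F e) \<subseteq> verts F" for e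
    using cnt[of e] by (auto simp: F_def set_mset_sum split: if_splits)
  then have wf: "wf_graph F" using E(1,3) size by (auto simp: wf_graph_def F_def simp del: count_list_append)
  have inc: "incident_edges F v = mset (Bs ! v)" if "v < length Bs" for v
  proof (rule multiset_eqI)
    fix e
    have "edges F = E" by (simp add: F_def)
    then show "count (incident_edges F v) e = count (mset (Bs ! v)) e"
      using setB[OF that] that E(1) by (auto simp: count_incident_edges cnt count_mset count_list_0_iff)
  qed
  have B1: "Bs ! (?r + i) = [w ! i]" if "i < ?k" for i
    using that by (simp add: Bs_def nth_append)
  have "size (incident_edges F v) = 1" if "v \<in> set (opens F)" for v
  proof -
    have "v = ?r + (v - ?r)" "v - ?r < ?k" "v < length Bs" using that lenB by (auto simp: F_def)
    then show ?thesis using inc[of v] B1[of "v - ?r"] by simp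
  qed
  then have wfF: "wf_fragment ?k F"
    using wf by (simp add: wf_fragment_def) (auto simp: F_def lenB)
  have opn: "open_edges F = w"
    by (rule nth_equalityI) (simp_all add: open_edges_def F_def[THEN arg_cong[where f = opens]] inc B1 lenB)
  have "fragment_tensor n h F = diagram_tensor n h E ds u w" for n h
  proof -
    have V: "verts F - set (opens F) = {..<?r}" by (auto simp: F_def lenB)
    have "(\<Prod>v<?r. h (colour_count \<phi> (incident_edges F v))) = vertex_tensor h ds (map \<phi> u)" for \<phi>
    proof -
      have "(\<Prod>v<?r. h (colour_count \<phi> (incident_edges F v))) = (\<Prod>v<?r. h (colour_count \<phi> (mset (Ls ! v))))"
        using inc lenB by (intro prod.cong) (auto simp: Bs_def nth_append)
      also have "\<dots> = vertex_tensor h ds (map \<phi> u)"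
        unfolding Ls(1) Ls(2)[symmetric] vertex_tensor_concat prod.list_conv_set_nth by (simp add: lessThan_atLeast0)
      finally show ?thesis .
    qed
    then show ?thesis
      by (simp add: fun_eq_iff fragment_tensor_def diagram_tensor_def V opn F_def[THEN arg_cong[where f = edges]])
  qed
  then show ?thesis using that wfF by blast
qed


section \<open>Gluing is the inner product of tensors\<close>

lemma mem_ends_open_end:
  assumes "wf_fragment k F" "i < k" "e \<in> edges F"
  shows "opens F ! i \<in># ends F e \<longleftrightarrow> e = open_edges F ! i"
proof -
  have fin: "finite (edges F)" and i: "i < length (opens F)"
    using assms by (auto simp: wf_fragment_def wf_graph_def)
  have "opens F ! i \<in># ends F e \<longleftrightarrow> e \<in># incident_edges F (opens F ! i)"
    using count_incident_edges[OF fin, of "opens F ! i" e] assms(3)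
    unfolding count_greater_zero_iff[symmetric] by simp
  also have "\<dots> \<longleftrightarrow> e = open_edges F ! i"
    using incident_edges_open_end[OF assms(1) nth_mem[OF i]] i
    by (metis (no_types, lifting) add_mset_remove_trivial_eq insert_noteq_member
        multi_member_this nth_map open_edges_def single_is_union union_single_eq_member
        empty_iff set_mset_empty insert_iff set_mset_add_mset_insert)
  finally show ?thesis .
qed

lemma glue_step_open_edges:
  assumes "wf_fragment k F" "wf_fragment k H"
  shows "glue_step F H = {(Inl (open_edges F ! i), Inr (open_edges H ! i)) | i. i < k}"
proof -
  have len: "length (opens F) = k" using assms by (simp add: wf_fragment_def)
  have "open_edges F ! i \<in> edges F" "open_edges H ! i \<in> edges H" if "i < k" for i
    using that set_open_edges length_open_edges assms by (metis nth_mem subsetD)+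
  then show ?thesis
    unfolding glue_step_def len
    using mem_ends_open_end[OF assms(1)] mem_ends_open_end[OF assms(2)] by blast
qed

lemma replicate_mset_sum: "replicate_mset (\<Sum>x\<in>A. f x) c = (\<Sum>x\<in>A. replicate_mset (f x) c)"
  by (rule multiset_eqI) (simp add: count_sum)

lemma image_mset_sum: "image_mset f (\<Sum>x\<in>A. M x) = (\<Sum>x\<in>A. image_mset f (M x))"
  by (induction A rule: infinite_finite_induct) simp_all

lemma count_image_mset_Inl: "count (image_mset Inl M) (Inl v) = count M v"
  by (induction M) simp_all

lemma count_image_mset_Inr: "count (image_mset Inr M) (Inr v) = count M v"
  by (induction M) simp_all

text \<open>An edge of the glued graph is a class of edges joined at open ends. A colouring of the classes
  is therefore a pair of colourings of the two fragments that agree at the open ends, and summing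
  over the common colours of the open ends gives the inner product.\<close>

lemma partition_function_glue:
  fixes F :: "('v, 'e) fragment" and H :: "('w, 'f) fragment"
  assumes "wf_fragment k F" "wf_fragment k H"
  shows "graph_partition_function n h (glue F H) =
    (\<Sum>xs\<in>multi_indices n k. fragment_tensor n h F xs * fragment_tensor n h H xs)"
proof -
  let ?R = "glue_step F H"
  define D where "D = edges F <+> edges H"
  define r where "r = (?R \<union> ?R\<inverse>)\<^sup>*"
  define cls where "cls x = r `` {x}" for x
  define VF where "VF = verts F - set (opens F)"
  define VH where "VH = verts H - set (opens H)"
  let ?G = "glue F H"
  let ?a = "open_edges F" and ?b = "open_edges H"
  have fin: "finite (edges F)" "finite (edges H)" "finite VF" "finite VH" "finite D"
    using assms by (auto simp: wf_fragment_def wf_graph_def VF_def VH_def D_def)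
  have R: "?R = {(Inl (?a ! i), Inr (?b ! i)) | i. i < k}" by (rule glue_step_open_edges[OF assms])
  have len: "length ?a = k" "length ?b = k" using length_open_edges assms by blast+
  have sets: "set ?a \<subseteq> edges F" "set ?b \<subseteq> edges H" using set_open_edges assms by blast+
  \<comment> \<open>The classes are the fibres of \<open>cls\<close>, so sums over classes of sums over members are sums over all edges.\<close>
  have symr: "(y, x) \<in> r" if "(x, y) \<in> r" for x y
    using that sym_rtrancl[OF sym_Un_converse[of ?R]] unfolding r_def by (rule symD[rotated])
  have cls_eq: "cls x = cls y \<longleftrightarrow> (x, y) \<in> r" for x y
    unfolding cls_def using symr by (auto simp: r_def intro: rtrancl_trans)
  have D_closed: "y \<in> D" if "(x, y) \<in> r" "x \<in> D" for x y
    using that(1) unfolding r_def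
  proof induction
    case (step y z)
    then show ?case using glue_step_subset[of F H] by (auto simp: D_def)
  qed (rule that(2))
  have edges: "edges ?G = cls ` D"
    unfolding glue_def quotient_def cls_def r_def D_def by auto
  have fibre: "{x \<in> D. cls x = C} = C" if C: "C \<in> cls ` D" for C
  proof -
    obtain x where x: "x \<in> D" "C = cls x" using C by blast
    have "{y \<in> D. cls y = cls x} = cls x"
      using D_closed[OF _ x(1)] symr by (auto simp: cls_eq) (auto simp: cls_def)
    then show ?thesis using x by simp
  qed
  have inc: "incident_edges ?G z = (\<Sum>x\<in>D. replicate_mset (count (remaining_ends F H x) z) (cls x))" for z
  proof -
    have "incident_edges ?G z = (\<Sum>C\<in>cls ` D. \<Sum>x\<in>C. replicate_mset (count (remaining_ends F H x) z) C)"
      unfolding incident_edges_def edges by (simp add: glue_def count_sum replicate_mset_sum)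
    also have "\<dots> = (\<Sum>C\<in>cls ` D. \<Sum>x | x \<in> D \<and> cls x = C. replicate_mset (count (remaining_ends F H x) z) (cls x))"
    proof (rule sum.cong)
      fix C assume "C \<in> cls ` D"
      from fibre[OF this] show "(\<Sum>x\<in>C. replicate_mset (count (remaining_ends F H x) z) C) =
          (\<Sum>x | x \<in> D \<and> cls x = C. replicate_mset (count (remaining_ends F H x) z) (cls x))"
        by (intro sum.cong) auto
    qed simp
    also have "\<dots> = (\<Sum>x\<in>D. replicate_mset (count (remaining_ends F H x) z) (cls x))"
      using fin(5) by (intro sum.group) auto
    finally show ?thesis .
  qed
  have incF: "incident_edges ?G (Inl v) = image_mset (\<lambda>e. cls (Inl e)) (incident_edges F v)" if "v \<in> VF" for v
  proof -
    have "count (remaining_ends F H (Inl e)) (Inl v) = count (ends F e) v" for e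
      using that by (simp add: remaining_ends_def VF_def count_image_mset_Inl)
    moreover have "count (remaining_ends F H (Inr e)) (Inl v) = 0" for e
      by (auto simp: remaining_ends_def count_eq_zero_iff)
    ultimately show ?thesis
      unfolding inc D_def using fin(1,2) by (simp add: sum.Plus incident_edges_def image_mset_sum)
  qed
  have incH: "incident_edges ?G (Inr v) = image_mset (\<lambda>e. cls (Inr e)) (incident_edges H v)" if "v \<in> VH" for v
  proof -
    have "count (remaining_ends F H (Inr e)) (Inr v) = count (ends H e) v" for e
      using that by (simp add: remaining_ends_def VH_def count_image_mset_Inr)
    moreover have "count (remaining_ends F H (Inl e)) (Inr v) = 0" for e
      by (auto simp: remaining_ends_def count_eq_zero_iff)
    ultimately show ?thesis
      unfolding inc D_def using fin(1,2) by (simp add: sum.Plus incident_edges_def image_mset_sum)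
  qed
  define PF where "PF \<phi> = (\<Prod>v\<in>VF. h (colour_count \<phi> (incident_edges F v)))" for \<phi>
  define PH where "PH \<psi> = (\<Prod>v\<in>VH. h (colour_count \<psi> (incident_edges H v)))" for \<psi>
  let ?\<Phi> = "edges F \<rightarrow>\<^sub>E {..<n}" and ?\<Psi> = "edges H \<rightarrow>\<^sub>E {..<n}"
  let ?S = "{p \<in> ?\<Phi> \<times> ?\<Psi>. map (fst p) ?a = map (snd p) ?b}"
  \<comment> \<open>\<open>J\<close> restricts a colouring of the classes to the two fragments; \<open>I\<close> evaluates a compatible pair at any member of a class.\<close>
  define J where "J \<theta> = (restrict (\<lambda>e. \<theta> (cls (Inl e))) (edges F), restrict (\<lambda>e. \<theta> (cls (Inr e))) (edges H))"
    for \<theta> :: "('e + 'f) set \<Rightarrow> nat"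
  define I where "I p = restrict (\<lambda>C. case_sum (fst p) (snd p) (SOME x. x \<in> C)) (cls ` D)"
    for p :: "('e \<Rightarrow> nat) \<times> ('f \<Rightarrow> nat)"
  have some: "(x, SOME y. y \<in> cls x) \<in> r" for x
  proof -
    have "x \<in> cls x" by (simp add: cls_def r_def)
    then have "(SOME y. y \<in> cls x) \<in> cls x" by (rule someI)
    then show ?thesis by (simp add: cls_def)
  qed
  have const: "case_sum (fst p) (snd p) x = case_sum (fst p) (snd p) y" if "p \<in> ?S" "(x, y) \<in> r" for p x y
    using that(2) unfolding r_def
  proof induction
    case (step y z)
    have "fst p (?a ! i) = snd p (?b ! i)" if "i < k" for i
      using \<open>p \<in> ?S\<close> that len by (auto simp: list_eq_iff_nth_eq)
    then have "case_sum (fst p) (snd p) y = case_sum (fst p) (snd p) z"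
      using step(2) unfolding R by auto
    then show ?case using step by simp
  qed simp
  have "graph_partition_function n h ?G = (\<Sum>\<theta>\<in>cls ` D \<rightarrow>\<^sub>E {..<n}. PF (fst (J \<theta>)) * PH (snd (J \<theta>)))"
  proof -
    have V: "verts ?G = VF <+> VH" by (simp add: glue_def VF_def VH_def)
    have 1: "colour_count \<theta> (incident_edges ?G (Inl v)) = colour_count (fst (J \<theta>)) (incident_edges F v)"
      if "v \<in> VF" for v \<theta>
      unfolding incF[OF that] colour_count_image using set_incident_edges[OF fin(1), of v]
      by (intro colour_count_cong) (auto simp: J_def)
    have 2: "colour_count \<theta> (incident_edges ?G (Inr v)) = colour_count (snd (J \<theta>)) (incident_edges H v)"
      if "v \<in> VH" for v \<theta>
      unfolding incH[OF that] colour_count_image using set_incident_edges[OF fin(2), of v]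
      by (intro colour_count_cong) (auto simp: J_def)
    show ?thesis
      unfolding graph_partition_function_def edges V PF_def PH_def
      using fin(3,4) by (simp add: prod.Plus 1 2)
  qed
  also have "\<dots> = (\<Sum>p\<in>?S. PF (fst p) * PH (snd p))"
  proof (rule sum.reindex_bij_witness[where i = I and j = J])
    fix \<theta> assume \<theta>: "\<theta> \<in> cls ` D \<rightarrow>\<^sub>E {..<n}"
    show "I (J \<theta>) = \<theta>"
    proof
      fix C show "I (J \<theta>) C = \<theta> C"
      proof (cases "C \<in> cls ` D")
        case True
        then obtain x where x: "x \<in> D" "C = cls x" by blast
        let ?y = "SOME y. y \<in> cls x"
        have y: "cls ?y = cls x" "?y \<in> D" using some[of x] cls_eq[of x ?y] D_closed[OF some x(1)] by auto
        then show ?thesis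
          using True x(2) by (cases ?y) (auto simp: I_def J_def D_def)
      next
        case False
        then show ?thesis using \<theta> by (auto simp: I_def PiE_def extensional_def)
      qed
    qed
    have "map (fst (J \<theta>)) ?a = map (snd (J \<theta>)) ?b"
    proof (rule nth_equalityI)
      fix i assume "i < length (map (fst (J \<theta>)) ?a)"
      then have i: "i < k" using len by simp
      then have "(Inl (?a ! i), Inr (?b ! i)) \<in> r" unfolding r_def R by blast
      moreover have "?a ! i \<in> edges F" "?b ! i \<in> edges H" using i len sets by (metis nth_mem subsetD)+
      ultimately show "map (fst (J \<theta>)) ?a ! i = map (snd (J \<theta>)) ?b ! i"
        using i len by (simp add: J_def cls_eq[symmetric])
    qed (simp add: len)
    then show "J \<theta> \<in> ?S" using \<theta> by (auto simp: J_def D_def)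
    show "PF (fst (J \<theta>)) * PH (snd (J \<theta>)) = PF (fst (J \<theta>)) * PH (snd (J \<theta>))" ..
  next
    fix p assume p: "p \<in> ?S"
    have val: "case_sum (fst p) (snd p) (SOME y. y \<in> cls x) = case_sum (fst p) (snd p) x" for x
      using const[OF p some] by simp
    have "fst (J (I p)) = fst p"
      using p by (auto simp: J_def I_def val D_def fun_eq_iff PiE_def extensional_def)
    moreover have "snd (J (I p)) = snd p"
      using p by (auto simp: J_def I_def val D_def fun_eq_iff PiE_def extensional_def)
    ultimately show "J (I p) = p" by (simp add: prod_eq_iff)
    have "case_sum (fst p) (snd p) x < n" if "x \<in> D" for x
      using p that by (auto simp: D_def)
    then show "I p \<in> cls ` D \<rightarrow>\<^sub>E {..<n}"
      unfolding I_def restrict_PiE_iff by (auto simp: val)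
  qed
  also have "\<dots> = (\<Sum>p\<in>?\<Phi> \<times> ?\<Psi>. of_bool (map (fst p) ?a = map (snd p) ?b) * (PF (fst p) * PH (snd p)))"
    using fin(1,2) by (intro sum.mono_neutral_cong_left) (auto intro: finite_PiE)
  also have "\<dots> = (\<Sum>\<phi>\<in>?\<Phi>. \<Sum>\<psi>\<in>?\<Psi>. of_bool (map \<phi> ?a = map \<psi> ?b) * (PF \<phi> * PH \<psi>))"
    by (simp add: sum.cartesian_product case_prod_unfold)
  also have "\<dots> = (\<Sum>\<phi>\<in>?\<Phi>. \<Sum>\<psi>\<in>?\<Psi>. \<Sum>xs\<in>multi_indices n k. of_bool (map \<phi> ?a = xs) *
      (of_bool (map \<psi> ?b = xs) * (PF \<phi> * PH \<psi>)))"
  proof (intro sum.cong refl)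
    fix \<phi> \<psi> assume "\<phi> \<in> ?\<Phi>"
    then have mem: "map \<phi> ?a \<in> multi_indices n k" using map_colouring_multi_indices[OF _ sets(1)] len by metis
    have c: "(map \<phi> ?a = map \<psi> ?b) = (map \<psi> ?b = map \<phi> ?a)" by (rule eq_commute)
    show "of_bool (map \<phi> ?a = map \<psi> ?b) * (PF \<phi> * PH \<psi>) = (\<Sum>xs\<in>multi_indices n k.
        of_bool (map \<phi> ?a = xs) * (of_bool (map \<psi> ?b = xs) * (PF \<phi> * PH \<psi>)))"
      unfolding c by (rule sum_multi_indices_eq[OF mem, symmetric])
  qed
  also have "\<dots> = (\<Sum>\<phi>\<in>?\<Phi>. \<Sum>xs\<in>multi_indices n k. \<Sum>\<psi>\<in>?\<Psi>. of_bool (map \<phi> ?a = xs) *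
      (of_bool (map \<psi> ?b = xs) * (PF \<phi> * PH \<psi>)))"
    by (intro sum.cong refl sum.swap)
  also have "\<dots> = (\<Sum>xs\<in>multi_indices n k. \<Sum>\<phi>\<in>?\<Phi>. \<Sum>\<psi>\<in>?\<Psi>. of_bool (map \<phi> ?a = xs) *
      (of_bool (map \<psi> ?b = xs) * (PF \<phi> * PH \<psi>)))"
    by (rule sum.swap)
  also have "\<dots> = (\<Sum>xs\<in>multi_indices n k. fragment_tensor n h F xs * fragment_tensor n h H xs)"
    unfolding fragment_tensor_def PF_def PH_def VF_def VH_def sum_product by (simp add: mult_ac)
  finally show ?thesis .
qed


section \<open>Rank and dimension\<close>

global_interpretation fun_pair: vector_space_pair
    "fun_scale :: real \<Rightarrow> ('a \<Rightarrow> real) \<Rightarrow> 'a \<Rightarrow> real" "fun_scale :: real \<Rightarrow> ('b \<Rightarrow> real) \<Rightarrow> 'b \<Rightarrow> real"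
  by unfold_locales

definition tensor_inner :: "nat \<Rightarrow> nat \<Rightarrow> (nat list \<Rightarrow> real) \<Rightarrow> (nat list \<Rightarrow> real) \<Rightarrow> real" where
  "tensor_inner n k S T = (\<Sum>xs\<in>multi_indices n k. S xs * T xs)"

lemma tensor_inner_simps [simp]:
  "tensor_inner n k (S + S') T = tensor_inner n k S T + tensor_inner n k S' T"
  "tensor_inner n k (S - S') T = tensor_inner n k S T - tensor_inner n k S' T"
  "tensor_inner n k (fun_scale c S) T = c * tensor_inner n k S T"
  "tensor_inner n k 0 T = 0" "tensor_inner n k S 0 = 0"
  by (simp_all add: tensor_inner_def sum.distrib sum_subtractf sum_distrib_left fun_scale_def algebra_simps)

lemma tensor_inner_commute: "tensor_inner n k S T = tensor_inner n k T S"
  by (simp add: tensor_inner_def mult.commute)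

lemma tensor_inner_self_eq_0:
  assumes "T \<in> tensor_power n k" "tensor_inner n k T T = 0"
  shows "T = 0"
proof
  fix xs
  have "T ys * T ys = 0" if "ys \<in> multi_indices n k" for ys
    using assms(2) that unfolding tensor_inner_def by (subst (asm) sum_nonneg_eq_0_iff) auto
  then show "T xs = 0 xs" using assms(1) by (cases "xs \<in> multi_indices n k") (auto simp: tensor_power_def)
qed

lemma subspace_tensor_inner: "fun_space.subspace {S. tensor_inner n k S T = 0}"
  by (simp add: fun_space.subspace_def)

lemma subspace_tensor_power: "fun_space.subspace (tensor_power n k)"
  by (auto simp: fun_space.subspace_def tensor_power_def fun_scale_def)

lemma sum_apply: "(\<Sum>x\<in>A. f x) y = (\<Sum>x\<in>A. f x y)"
  by (induction A rule: infinite_finite_induct) simp_all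

lemma tensor_power_finite_span:
  obtains B where "finite B" "tensor_power n k \<subseteq> fun_space.span B"
proof -
  let ?e = "\<lambda>ys xs. of_bool (ys = xs) :: real"
  have "T \<in> fun_space.span (?e ` multi_indices n k)" if T: "T \<in> tensor_power n k" for T
  proof -
    have "T = (\<Sum>ys\<in>multi_indices n k. fun_scale (T ys) (?e ys))"
    proof
      fix xs
      have "(\<Sum>ys\<in>multi_indices n k. fun_scale (T ys) (?e ys)) xs = (\<Sum>ys\<in>multi_indices n k. if ys = xs then T xs else 0)"
        unfolding sum_apply by (intro sum.cong) (auto simp: fun_scale_def)
      then show "T xs = (\<Sum>ys\<in>multi_indices n k. fun_scale (T ys) (?e ys)) xs"
        using T by (simp add: tensor_power_def)
    qed
    also have "\<dots> \<in> fun_space.span (?e ` multi_indices n k)"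
      by (intro fun_space.span_sum fun_space.span_scale fun_space.span_base) simp
    finally show ?thesis .
  qed
  then show ?thesis by (intro that[of "?e ` multi_indices n k"]) auto
qed

lemma fun_dim_linear_image:
  fixes L :: "('a \<Rightarrow> real) \<Rightarrow> 'b \<Rightarrow> real"
  assumes "Vector_Spaces.linear fun_scale fun_scale L" "fun_space.subspace S" "inj_on L S"
    "finite B" "S \<subseteq> fun_space.span B"
  shows "fun_dim (L ` S) = fun_dim S"
proof -
  obtain C where C: "C \<subseteq> S" "fun_space.independent C" "S \<subseteq> fun_space.span C" "card C = fun_space.dim S"
    using fun_space.basis_exists by blast
  have sp: "fun_space.span C = S"
    using C assms(2) by (intro fun_space.span_subspace) auto
  have "fun_space.independent (L ` C)"
    using fun_pair.linear_independent_injective_image[OF assms(1) C(2)] assms(3) sp by simp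
  moreover have "L ` S \<subseteq> fun_space.span (L ` C)"
    using fun_pair.linear_span_image[OF assms(1), of C] sp by simp
  moreover have "card (L ` C) = card C"
    using inj_on_subset[OF assms(3) C(1)] by (rule card_image)
  ultimately have "fun_space.dim (L ` S) = fun_space.dim S"
    using C(1,4) by (intro fun_space.dim_unique[of "L ` C"]) auto
  moreover have "L ` S \<subseteq> fun_space.span (L ` B)"
    using fun_pair.linear_span_image[OF assms(1), of B] assms(5) by auto
  then have "\<exists>B'. finite B' \<and> L ` S \<subseteq> fun_space.span B'" using assms(4) by blast
  moreover have "\<exists>B'. finite B' \<and> S \<subseteq> fun_space.span B'" using assms(4,5) by blast
  ultimately show ?thesis by (simp add: fun_dim_def)
qed

text \<open>The rows of the Gram matrix of a family \<open>t\<close> are the images of the \<open>t i\<close> under a linear map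
  that is injective on their span, because the inner product is definite there.\<close>

lemma matrix_rank_gram:
  assumes "\<And>i. i \<in> I \<Longrightarrow> t i \<in> tensor_power n k"
    "\<And>i j. i \<in> I \<Longrightarrow> j \<in> I \<Longrightarrow> M i j = tensor_inner n k (t i) (t j)"
  shows "matrix_rank I I M = fun_dim (fun_space.span (t ` I))"
proof -
  define L where "L T = (\<lambda>j. if j \<in> I then tensor_inner n k T (t j) else 0)" for T
  let ?S = "fun_space.span (t ` I)"
  have lin: "Vector_Spaces.linear fun_scale fun_scale L"
    unfolding Vector_Spaces.linear_iff
    by (intro conjI allI fun_space.vector_space_axioms)
      (simp_all add: L_def fun_eq_iff, simp_all add: fun_scale_def)
  have pow: "?S \<subseteq> tensor_power n k"
    using assms(1) by (intro fun_space.span_minimal subspace_tensor_power) auto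
  have "inj_on L ?S"
  proof (rule inj_onI)
    fix S T assume ST: "S \<in> ?S" "T \<in> ?S" "L S = L T"
    then have D: "S - T \<in> ?S" by (simp add: fun_space.span_diff)
    have "tensor_inner n k (t j) (S - T) = 0" if "j \<in> I" for j
      using fun_cong[OF ST(3), of j] that by (simp add: L_def tensor_inner_commute[of n k "t j"])
    then have "?S \<subseteq> {R. tensor_inner n k R (S - T) = 0}"
      by (intro fun_space.span_minimal subspace_tensor_inner) auto
    then have "S - T = 0" using D pow by (intro tensor_inner_self_eq_0) auto
    then show "S = T" by simp
  qed
  moreover obtain B where "finite B" "tensor_power n k \<subseteq> fun_space.span B"
    by (rule tensor_power_finite_span)
  ultimately have "fun_dim (L ` ?S) = fun_dim ?S"
    using pow by (intro fun_dim_linear_image[OF lin fun_space.subspace_span]) auto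
  moreover have "(\<lambda>i j. if j \<in> I then M i j else 0) ` I = L ` t ` I"
    unfolding image_image using assms(2) by (intro image_cong) (auto simp: L_def)
  ultimately show ?thesis
    unfolding matrix_rank_def using fun_pair.linear_span_image[OF lin, of "t ` I"] by simp
qed

text \<open>One Gram-Schmidt step per element of \<open>B\<close>.\<close>

lemma orthogonal_projection:
  assumes "finite B" "B \<subseteq> tensor_power n k"
  shows "\<exists>P\<in>fun_space.span B. \<forall>b\<in>B. tensor_inner n k (T - P) b = 0"
  using assms
proof (induction B arbitrary: T rule: finite_induct)
  case empty
  then show ?case by (intro bexI[of _ 0]) (simp_all add: fun_space.span_zero)
next
  case (insert b B)
  \<comment> \<open>Project \<open>T\<close> and \<open>b\<close> to the span of \<open>B\<close>; \<open>d\<close> is the component of \<open>b\<close> orthogonal to it, and it is zero if \<open>b\<close> lies in the span.\<close>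
  obtain P where P: "P \<in> fun_space.span B" "\<And>c. c \<in> B \<Longrightarrow> tensor_inner n k (T - P) c = 0"
    using insert.IH[of T] insert.prems by blast
  obtain Q where Q: "Q \<in> fun_space.span B" "\<And>c. c \<in> B \<Longrightarrow> tensor_inner n k (b - Q) c = 0"
    using insert.IH[of b] insert.prems by blast
  define d where "d = b - Q"
  have orth: "tensor_inner n k R Q = 0" if "\<And>c. c \<in> B \<Longrightarrow> tensor_inner n k R c = 0" for R
  proof -
    have "fun_space.span B \<subseteq> {S. tensor_inner n k S R = 0}"
      using that by (intro fun_space.span_minimal subspace_tensor_inner) (auto simp: tensor_inner_commute)
    then show ?thesis using Q(1) by (auto simp: tensor_inner_commute)
  qed
  have span: "fun_space.span B \<subseteq> fun_space.span (insert b B)" by (rule fun_space.span_mono) auto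
  have d: "d \<in> fun_space.span (insert b B)"
    unfolding d_def using Q(1) span by (intro fun_space.span_diff) (auto intro: fun_space.span_base)
  have "d \<in> tensor_power n k"
    using d insert.prems fun_space.span_minimal[OF _ subspace_tensor_power] by blast
  then have zero: "tensor_inner n k d d = 0 \<Longrightarrow> d = 0" by (rule tensor_inner_self_eq_0)
  have b: "tensor_inner n k R b = tensor_inner n k R d" if "\<And>c. c \<in> B \<Longrightarrow> tensor_inner n k R c = 0" for R
  proof -
    have "tensor_inner n k R d = tensor_inner n k R b - tensor_inner n k R Q"
      unfolding d_def by (simp add: tensor_inner_commute[of n k R])
    then show ?thesis using orth[OF that] by simp
  qed
  let ?a = "tensor_inner n k (T - P) d / tensor_inner n k d d"
  let ?P = "P + fun_scale ?a d"
  have "?P \<in> fun_space.span (insert b B)"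
    using P(1) span d by (intro fun_space.span_add fun_space.span_scale) auto
  moreover have *: "tensor_inner n k (T - ?P) c = 0" if "c \<in> B" for c
    using P(2)[OF that] Q(2)[OF that] by (simp add: d_def)
  moreover have "tensor_inner n k (T - ?P) b = 0"
    using b[OF *] zero by (cases "d = 0") auto
  ultimately show ?case by blast
qed

lemma subspace_invariants: "fun_space.subspace (tensor_invariants n k H)"
proof -
  have "tensor_act n k U 0 = 0" "tensor_act n k U (S + T) = tensor_act n k U S + tensor_act n k U T"
    "tensor_act n k U (fun_scale c T) = fun_scale c (tensor_act n k U T)" for U S T c
    by (auto simp: tensor_act_def fun_scale_def fun_eq_iff sum.distrib sum_distrib_left algebra_simps)
  then show ?thesis
    using subspace_tensor_power[of n k] unfolding fun_space.subspace_def tensor_invariants_def by simp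
qed

text \<open>The difference of \<open>T\<close> and its projection to the span of \<open>A\<close> lies in \<open>W\<close> and is orthogonal to \<open>A\<close>.\<close>

lemma span_eq_by_orthogonality:
  assumes "A \<subseteq> W" "W \<subseteq> tensor_power n k" "fun_space.subspace W"
    "\<And>T. T \<in> W \<Longrightarrow> \<forall>a\<in>A. tensor_inner n k T a = 0 \<Longrightarrow> T = 0"
  shows "fun_space.span A = W"
proof
  show sub: "fun_space.span A \<subseteq> W" using assms(1,3) by (rule fun_space.span_minimal)
  obtain B where B: "B \<subseteq> A" "fun_space.independent B" "A \<subseteq> fun_space.span B"
    using fun_space.maximal_independent_subset by blast
  obtain C where C: "finite C" "tensor_power n k \<subseteq> fun_space.span C"
    by (rule tensor_power_finite_span)
  have "finite B"
    using fun_space.independent_span_bound[OF C(1) B(2)] B(1) assms(1,2) C(2) by blast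
  show "W \<subseteq> fun_space.span A"
  proof
    fix T assume T: "T \<in> W"
    obtain P where P: "P \<in> fun_space.span B" "\<And>b. b \<in> B \<Longrightarrow> tensor_inner n k (T - P) b = 0"
      using orthogonal_projection[OF \<open>finite B\<close>, of n k T] B(1) assms(1,2) by blast
    have PA: "P \<in> fun_space.span A" using P(1) fun_space.span_mono[OF B(1)] by blast
    have "fun_space.span B \<subseteq> {S. tensor_inner n k S (T - P) = 0}"
      using P(2) by (intro fun_space.span_minimal subspace_tensor_inner) (auto simp: tensor_inner_commute)
    then have "\<forall>a\<in>A. tensor_inner n k (T - P) a = 0" using B(3) by (auto simp: tensor_inner_commute)
    moreover have "T - P \<in> W" using T PA sub assms(3) by (auto intro: fun_space.subspace_diff)
    ultimately have "T - P = 0" using assms(4) by blast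
    then show "T \<in> fun_space.span A" using PA by simp
  qed
qed

lemma fragment_tensor_invariant:
  assumes "wf_fragment k F"
  shows "fragment_tensor n h F \<in> tensor_invariants n k (stabilizer n h)"
proof -
  obtain ds u where "pairing (edges F) (u @ open_edges F)" "length u = sum_list ds"
    "fragment_tensor n h F = diagram_tensor n h (edges F) ds u (open_edges F)"
    using fragment_tensor_eq_diagram_tensor[OF assms] by metis
  then show ?thesis using diagram_tensor_invariant length_open_edges[OF assms] by metis
qed

text \<open>The matrix is indexed by classes, the tensors belong to representatives. Two representatives of
  a class have the same inner products with all fragment tensors, so the difference of their
  tensors is orthogonal to itself and vanishes.\<close>

lemma edge_connection_rank_eq:
  "edge_connection_rank (partition_function n h) k =
    fun_dim (fun_space.span (fragment_tensor n h ` {F :: (nat, nat) fragment. wf_fragment k F}))"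
proof -
  let ?W = "{F :: (nat, nat) fragment. wf_fragment k F}"
  let ?t = "fragment_tensor n h"
  define rep where "rep C = (SOME F :: (nat, nat) fragment. wf_fragment k F \<and> C = fragment_class F)" for C
  have rep: "wf_fragment k (rep C)" "C = fragment_class (rep C)" if "C \<in> fragments k" for C
  proof -
    have "\<exists>F :: (nat, nat) fragment. wf_fragment k F \<and> C = fragment_class F"
      using that by (auto simp: fragments_def)
    from someI_ex[OF this] show "wf_fragment k (rep C)" "C = fragment_class (rep C)" by (auto simp: rep_def)
  qed
  have pow: "?t F \<in> tensor_power n k" if "wf_fragment k F" for F :: "(nat, nat) fragment"
    using fragment_tensor_invariant[OF that] by (auto simp: tensor_invariants_def)
  have M: "edge_connection_matrix (partition_function n h) (fragment_class F) (fragment_class H) =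
      tensor_inner n k (?t F) (?t H)" if "wf_fragment k F" "wf_fragment k H" for F H :: "(nat, nat) fragment"
    unfolding edge_connection_matrix_def glue_class_fragment_class[OF that]
      partition_function_class[OF wf_glue[OF that]] partition_function_glue[OF that] tensor_inner_def ..
  have same: "?t F = ?t F'" if "wf_fragment k F" "wf_fragment k F'" "fragment_class F = fragment_class F'"
    for F F' :: "(nat, nat) fragment"
  proof -
    have "tensor_inner n k (?t F) (?t H) = tensor_inner n k (?t F') (?t H)" if "wf_fragment k H" for H :: "(nat, nat) fragment"
      using M[OF \<open>wf_fragment k F\<close> that] M[OF \<open>wf_fragment k F'\<close> that] \<open>fragment_class F = fragment_class F'\<close> by simp
    from this[OF that(1)] this[OF that(2)] have "tensor_inner n k (?t F - ?t F') (?t F - ?t F') = 0"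
      by (simp add: tensor_inner_commute[of n k _ "?t F - ?t F'"])
    then have "?t F - ?t F' = 0"
      using pow that by (intro tensor_inner_self_eq_0 fun_space.subspace_diff subspace_tensor_power) auto
    then show ?thesis by simp
  qed
  have "(\<lambda>C. ?t (rep C)) ` fragments k = ?t ` ?W"
  proof
    show "(\<lambda>C. ?t (rep C)) ` fragments k \<subseteq> ?t ` ?W" using rep(1) by auto
    show "?t ` ?W \<subseteq> (\<lambda>C. ?t (rep C)) ` fragments k"
    proof
      fix T assume "T \<in> ?t ` ?W"
      then obtain F :: "(nat, nat) fragment" where F: "wf_fragment k F" "T = ?t F" by blast
      then have C: "fragment_class F \<in> fragments k" by (auto simp: fragments_def)
      then have "T = ?t (rep (fragment_class F))" using same[OF F(1) rep(1)[OF C] rep(2)[OF C]] F(2) by simp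
      then show "T \<in> (\<lambda>C. ?t (rep C)) ` fragments k" using C by blast
    qed
  qed
  moreover have "matrix_rank (fragments k) (fragments k) (edge_connection_matrix (partition_function n h)) =
      fun_dim (fun_space.span ((\<lambda>C. ?t (rep C)) ` fragments k))"
    using rep pow M by (intro matrix_rank_gram) (auto, metis)
  ultimately show ?thesis by (simp add: edge_connection_rank_def)
qed


section \<open>Polynomial functions on a box\<close>

text \<open>Polynomial functions of the coordinates in \<open>I\<close>: they are continuous, and measurable and bounded
  on the box.\<close>

inductive poly_fun :: "'i set \<Rightarrow> (('i \<Rightarrow> real) \<Rightarrow> real) \<Rightarrow> bool" for I where
  const: "poly_fun I (\<lambda>_. c)"
| coord: "i \<in> I \<Longrightarrow> poly_fun I (\<lambda>x. x i)"
| add: "poly_fun I f \<Longrightarrow> poly_fun I g \<Longrightarrow> poly_fun I (\<lambda>x. f x + g x)"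
| mult: "poly_fun I f \<Longrightarrow> poly_fun I g \<Longrightarrow> poly_fun I (\<lambda>x. f x * g x)"

lemma poly_fun_sum:
  assumes "\<And>a. a \<in> A \<Longrightarrow> poly_fun I (f a)"
  shows "poly_fun I (\<lambda>x. \<Sum>a\<in>A. f a x)"
  using assms by (induction A rule: infinite_finite_induct) (auto intro: poly_fun.intros)

lemma poly_fun_prod:
  assumes "\<And>a. a \<in> A \<Longrightarrow> poly_fun I (f a)"
  shows "poly_fun I (\<lambda>x. \<Prod>a\<in>A. f a x)"
  using assms by (induction A rule: infinite_finite_induct) (auto intro: poly_fun.intros)

lemma poly_fun_prod_list:
  assumes "\<And>a. a \<in> set as \<Longrightarrow> poly_fun I (f a)"
  shows "poly_fun I (\<lambda>x. prod_list (map (\<lambda>a. f a x) as))"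
  using assms by (induction as) (auto intro: poly_fun.intros)

lemma poly_fun_monom_at:
  assumes "set cs \<subseteq> I"
  shows "poly_fun I (\<lambda>x. monom_at x cs)"
  unfolding monom_at_def using assms
  by (intro poly_fun_prod_list) (auto intro: poly_fun.coord)

lemma poly_fun_power: "poly_fun I f \<Longrightarrow> poly_fun I (\<lambda>x. f x ^ m)"
  by (induction m) (auto intro: poly_fun.intros)

lemma continuous_on_poly_fun: "poly_fun I f \<Longrightarrow> continuous_on S f"
proof (induction rule: poly_fun.induct)
  case (coord i)
  then show ?case
    using continuous_on_subset[OF continuous_on_product_coordinates[of i]] by blast
qed (auto intro: continuous_intros)

text \<open>The side length one makes this a probability measure.\<close>

definition box_measure :: "'i set \<Rightarrow> ('i \<Rightarrow> real) measure" where
  "box_measure I = Pi\<^sub>M I (\<lambda>_. restrict_space lborel {-1/2..1/2})"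

text \<open>The weights are radial, and up to a factor \<open>-2 (q + 1) x\<^sub>c\<close> the partial derivative of the weight
  of exponent \<open>q + 1\<close> is the weight of exponent \<open>q\<close>. The ball where they are positive lies in the box,
  on which Fubini's theorem applies.\<close>

definition ball_weight :: "'i set \<Rightarrow> nat \<Rightarrow> ('i \<Rightarrow> real) \<Rightarrow> real" where
  "ball_weight I q x = max 0 (1/4 - (\<Sum>i\<in>I. (x i)\<^sup>2)) ^ q"

definition ball_integral :: "'i set \<Rightarrow> nat \<Rightarrow> (('i \<Rightarrow> real) \<Rightarrow> real) \<Rightarrow> real" where
  "ball_integral I q f = (\<integral>x. ball_weight I q x * f x \<partial>box_measure I)"

abbreviation interval_measure_half :: "real measure" where
  "interval_measure_half \<equiv> restrict_space lborel {-1/2..1/2}"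

lemma prob_space_half: "prob_space interval_measure_half"
  by (rule prob_space_restrict_space) simp_all

lemma product_sigma_finite_half: "product_sigma_finite (\<lambda>_. interval_measure_half)"
proof -
  interpret prob_space interval_measure_half by (rule prob_space_half)
  show ?thesis unfolding product_sigma_finite_def using sigma_finite_measure_axioms by blast
qed

lemma prob_space_box: "prob_space (box_measure I)"
  unfolding box_measure_def by (rule prob_space_PiM) (rule prob_space_half)

lemma space_box: "space (box_measure I) = (\<Pi>\<^sub>E i\<in>I. {-1/2..1/2})"
  by (simp add: box_measure_def space_PiM space_restrict_space)

lemma measurable_coord_box:
  assumes "i \<in> I"
  shows "(\<lambda>x. x i) \<in> borel_measurable (box_measure I)"
proof -
  have "(\<lambda>x. x i) \<in> box_measure I \<rightarrow>\<^sub>M interval_measure_half"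
    unfolding box_measure_def using assms by (rule measurable_component_singleton)
  moreover have "(\<lambda>x. x) \<in> borel_measurable interval_measure_half"
    by (intro measurable_restrict_space1) simp
  ultimately show ?thesis by (rule measurable_compose)
qed

lemma measurable_poly_fun: "poly_fun I f \<Longrightarrow> f \<in> borel_measurable (box_measure I)"
  by (induction rule: poly_fun.induct) (auto intro: measurable_coord_box)

lemma bounded_poly_fun: "poly_fun I f \<Longrightarrow> \<exists>B. \<forall>x\<in>space (box_measure I). \<bar>f x\<bar> \<le> B"
proof (induction rule: poly_fun.induct)
  case (coord i)
  then show ?case by (intro exI[of _ "1/2"]) (auto simp: space_box PiE_def Pi_def abs_le_iff)
next
  case (add f g)
  then obtain B C where "\<forall>x\<in>space (box_measure I). \<bar>f x\<bar> \<le> B" "\<forall>x\<in>space (box_measure I). \<bar>g x\<bar> \<le> C" by blast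
  then show ?case by (intro exI[of _ "B + C"]) (auto intro: order_trans[OF abs_triangle_ineq] add_mono)
next
  case (mult f g)
  then obtain B C where B: "\<forall>x\<in>space (box_measure I). \<bar>f x\<bar> \<le> B" "\<forall>x\<in>space (box_measure I). \<bar>g x\<bar> \<le> C" by blast
  then have "\<bar>f x * g x\<bar> \<le> B * C" if "x \<in> space (box_measure I)" for x
    using that unfolding abs_mult by (intro mult_mono) (auto intro: order_trans[OF abs_ge_zero])
  then show ?case by blast
qed auto

lemma ball_weight_bounds:
  assumes "finite I"
  shows "0 \<le> ball_weight I q x" "ball_weight I q x \<le> 1"
proof -
  have "max 0 (1/4 - (\<Sum>i\<in>I. (x i)\<^sup>2)) \<le> 1" using sum_nonneg[of I "\<lambda>i. (x i)\<^sup>2"] by simp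
  then show "ball_weight I q x \<le> 1" unfolding ball_weight_def by (intro power_le_one) auto
qed (simp add: ball_weight_def)

lemma measurable_ball_weight: "ball_weight I q \<in> borel_measurable (box_measure I)"
proof -
  have "(\<lambda>x. \<Sum>i\<in>I. (x i)\<^sup>2) \<in> borel_measurable (box_measure I)"
    by (intro measurable_poly_fun poly_fun_sum poly_fun_power poly_fun.coord)
  then show ?thesis unfolding ball_weight_def[abs_def] by measurable
qed

lemma integrable_poly_fun:
  assumes "finite I" "poly_fun I f"
  shows "integrable (box_measure I) (\<lambda>x. ball_weight I q x * f x)"
proof -
  interpret prob_space "box_measure I" by (rule prob_space_box)
  obtain B where B: "\<forall>x\<in>space (box_measure I). \<bar>f x\<bar> \<le> B" using bounded_poly_fun[OF assms(2)] by blast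
  have "\<bar>ball_weight I q x * f x\<bar> \<le> B" if "x \<in> space (box_measure I)" for x
  proof -
    have "\<bar>ball_weight I q x\<bar> * \<bar>f x\<bar> \<le> 1 * B"
      using B that ball_weight_bounds[OF assms(1), of q x] by (intro mult_mono) auto
    then show ?thesis by (simp add: abs_mult)
  qed
  then show ?thesis
    by (intro integrable_const_bound[where B = B] borel_measurable_times measurable_ball_weight
        measurable_poly_fun[OF assms(2)]) auto
qed

lemma ball_integral_add:
  assumes "finite I" "poly_fun I f" "poly_fun I g"
  shows "ball_integral I q (\<lambda>x. f x + g x) = ball_integral I q f + ball_integral I q g"
  unfolding ball_integral_def distrib_left
  using integrable_poly_fun[OF assms(1)] assms(2,3) by simp

lemma ball_integral_cmult:
  "ball_integral I q (\<lambda>x. c * f x) = c * ball_integral I q f"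
proof -
  have "(\<lambda>x. ball_weight I q x * (c * f x)) = (\<lambda>x. c * (ball_weight I q x * f x))" by (simp add: mult_ac)
  then show ?thesis unfolding ball_integral_def by simp
qed

lemma ball_integral_sum:
  assumes "finite I" "\<And>a. a \<in> A \<Longrightarrow> poly_fun I (f a)"
  shows "ball_integral I q (\<lambda>x. \<Sum>a\<in>A. f a x) = (\<Sum>a\<in>A. ball_integral I q (f a))"
  using assms(2)
proof (induction A rule: infinite_finite_induct)
  case (insert a A)
  then show ?case using ball_integral_add[OF assms(1), of "f a" "\<lambda>x. \<Sum>a\<in>A. f a x"]
    by (simp add: poly_fun_sum)
qed (simp_all add: ball_integral_def)

lemma ball_integral_bound:
  assumes "finite I" "poly_fun I f" "\<And>x. x \<in> space (box_measure I) \<Longrightarrow> \<bar>f x\<bar> \<le> e"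
  shows "\<bar>ball_integral I q f\<bar> \<le> e"
proof -
  interpret prob_space "box_measure I" by (rule prob_space_box)
  have "\<bar>ball_weight I q x * f x\<bar> \<le> e" if "x \<in> space (box_measure I)" for x
  proof -
    have "\<bar>ball_weight I q x\<bar> * \<bar>f x\<bar> \<le> 1 * e"
      using assms(3)[OF that] ball_weight_bounds[OF assms(1), of q x] by (intro mult_mono) auto
    then show ?thesis by (simp add: abs_mult)
  qed
  then have bd: "- e \<le> ball_weight I q x * f x" "ball_weight I q x * f x \<le> e" if "x \<in> space (box_measure I)" for x
    using that by (auto simp: abs_le_iff) (smt (verit, best))
  have "ball_integral I q f \<le> e" "- e \<le> ball_integral I q f"
    unfolding ball_integral_def using integrable_poly_fun[OF assms(1,2)] bd
    by (auto intro!: integral_le_const integral_ge_const)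
  then show ?thesis by (simp add: abs_le_iff)
qed

text \<open>The weight is positive on the open ball, so the functional is definite on nonnegative
  polynomials: a positive value at \<open>x\<close> persists on a small box around \<open>x\<close>.\<close>

lemma ball_integral_definite:
  assumes "finite I" "poly_fun I f" "\<And>y. y \<in> space (box_measure I) \<Longrightarrow> 0 \<le> f y"
    "ball_integral I q f = 0" "x \<in> space (box_measure I)" "\<And>i. i \<in> I \<Longrightarrow> \<bar>x i\<bar> < 1/2" "(\<Sum>i\<in>I. (x i)\<^sup>2) < 1/4"
  shows "f x = 0"
proof (rule ccontr)
  assume "f x \<noteq> 0"
  interpret P: prob_space "box_measure I" by (rule prob_space_box)
  have sq: "continuous_on UNIV (\<lambda>y. 1/4 - (\<Sum>i\<in>I. (y i)\<^sup>2) :: real)"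
    by (intro continuous_on_diff continuous_on_const continuous_on_poly_fun[of I] poly_fun_sum poly_fun_power poly_fun.coord)
  have "open {y. f y \<noteq> 0}"
    by (rule open_Collect_neq[OF continuous_on_poly_fun[OF assms(2)] continuous_on_const])
  moreover have "open {y. (0::real) < 1/4 - (\<Sum>i\<in>I. (y i)\<^sup>2)}"
    by (rule open_Collect_less[OF continuous_on_const sq])
  ultimately have "open ({y. f y \<noteq> 0} \<inter> {y. (0::real) < 1/4 - (\<Sum>i\<in>I. (y i)\<^sup>2)})" (is "open ?U") by (rule open_Int)
  moreover have "x \<in> ?U" using \<open>f x \<noteq> 0\<close> assms(7) by simp
  ultimately obtain X where X: "x \<in> (\<Pi>\<^sub>E i\<in>UNIV. X i)" "\<And>i. open (X i)" "(\<Pi>\<^sub>E i\<in>UNIV. X i) \<subseteq> ?U"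
    using product_topology_open_contains_basis[of "\<lambda>_. euclidean" UNIV ?U x]
    by (auto simp: open_fun_def)
  define Y where "Y = (\<Pi>\<^sub>E i\<in>I. X i \<inter> {-1/2..1/2})"
  have YU: "y \<in> ?U" if "y \<in> Y" for y
  proof -
    \<comment> \<open>Outside \<open>I\<close> all points of the product space agree.\<close>
    have "y i \<in> X i" for i
    proof (cases "i \<in> I")
      case False
      then have "y i = x i" using that assms(5) by (auto simp: Y_def space_box PiE_def extensional_def)
      then show ?thesis using X(1) by auto
    qed (use that in \<open>auto simp: Y_def\<close>)
    then have "y \<in> (\<Pi>\<^sub>E i\<in>UNIV. X i)" by (auto simp: PiE_UNIV_domain)
    then show ?thesis using X(3) by blast
  qed
  have sets: "X i \<inter> {-1/2..1/2} \<in> sets interval_measure_half" for i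
    using X(2) by (auto simp: sets_restrict_space)
  have "emeasure (box_measure I) Y = (\<Prod>i\<in>I. emeasure interval_measure_half (X i \<inter> {-1/2..1/2}))"
    unfolding box_measure_def Y_def
    by (rule product_sigma_finite.emeasure_PiM[OF product_sigma_finite_half assms(1)]) (rule sets)
  moreover have "emeasure interval_measure_half (X i \<inter> {-1/2..1/2}) \<noteq> 0" if i: "i \<in> I" for i
  proof -
    have "open (X i \<inter> {-1/2<..<1/2})" using X(2) by auto
    moreover have "x i \<in> X i \<inter> {-1/2<..<1/2}" using X(1) assms(6)[OF i] by (auto simp: abs_less_iff)
    ultimately obtain e where e: "e > 0" "cball (x i) e \<subseteq> X i \<inter> {-1/2<..<1/2}"
      unfolding open_contains_cball by blast
    have "0 < emeasure lborel {x i - e..x i + e}" using e(1) by simp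
    also have "\<dots> \<le> emeasure lborel (X i \<inter> {-1/2<..<1/2})"
      using X(2) e(2) unfolding cball_eq_atLeastAtMost by (intro emeasure_mono) auto
    also have "emeasure lborel (X i \<inter> {-1/2<..<1/2}) \<le> emeasure lborel (X i \<inter> {-1/2..1/2})"
      using X(2) by (intro emeasure_mono) auto
    also have "\<dots> = emeasure interval_measure_half (X i \<inter> {-1/2..1/2})"
      by (subst emeasure_restrict_space) auto
    finally show ?thesis by simp
  qed
  ultimately have pos: "emeasure (box_measure I) Y \<noteq> 0" using assms(1) by simp
  have "AE y in box_measure I. ball_weight I q y * f y = 0"
    using assms(3,4) ball_weight_bounds[OF assms(1)] unfolding ball_integral_def
    by (subst (asm) integral_nonneg_eq_0_iff_AE[OF integrable_poly_fun[OF assms(1,2)]]) auto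
  moreover have "ball_weight I q y * f y \<noteq> 0" if "y \<in> Y" for y
    using YU[OF that] by (auto simp: ball_weight_def)
  ultimately have "AE y in box_measure I. y \<notin> Y" by (rule_tac eventually_mono) blast+
  moreover have "Y \<in> sets (box_measure I)"
    unfolding Y_def box_measure_def using sets assms(1) by (intro sets_PiM_I_finite) auto
  ultimately have "emeasure (box_measure I) Y = 0" by (simp add: AE_iff_null_sets null_setsD1)
  then show False using pos by simp
qed


section \<open>Integration by parts\<close>

lemma deriv_clipped_power:
  assumes "q \<ge> 1"
  shows "((\<lambda>t::real. max 0 t ^ Suc q) has_real_derivative real (Suc q) * max 0 t ^ q) (at t)"
proof -
  consider "t > 0" | "t < 0" | "t = 0" by linarith
  then show ?thesis
  proof cases
    case 1
    have "((\<lambda>t::real. t ^ Suc q) has_real_derivative real (Suc q) * t ^ q) (at t)"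
      by (auto intro!: derivative_eq_intros simp del: power_Suc)
    then have "((\<lambda>t::real. max 0 t ^ Suc q) has_real_derivative real (Suc q) * t ^ q) (at t)"
      by (rule has_field_derivative_transform_within_open[of _ _ _ "{0<..}"]) (use 1 in auto)
    then show ?thesis using 1 by simp
  next
    case 2
    have "((\<lambda>t::real. 0) has_real_derivative 0) (at t)" by simp
    then have "((\<lambda>t::real. max 0 t ^ Suc q) has_real_derivative 0) (at t)"
      by (rule has_field_derivative_transform_within_open[of _ _ _ "{..<0}"]) (use 2 in auto)
    moreover have "real (Suc q) * max 0 t ^ q = 0" using 2 assms by (simp add: max_def)
    ultimately show ?thesis by (simp only:)
  next
    case 3
    have "((\<lambda>h::real. max 0 h ^ q) \<longlongrightarrow> max 0 0 ^ q) (at 0)"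
      by (intro tendsto_intros)
    moreover have "\<forall>\<^sub>F h in at 0. max 0 h ^ q = (max 0 (0 + h) ^ Suc q - max 0 0 ^ Suc q) / (h::real)"
      unfolding eventually_at_filter
    proof (intro always_eventually allI impI)
      fix h :: real assume "h \<noteq> 0"
      then show "max 0 h ^ q = (max 0 (0 + h) ^ Suc q - max 0 0 ^ Suc q) / h"
        using assms by (cases "h > 0") auto
    qed
    ultimately have "((\<lambda>h::real. (max 0 (0 + h) ^ Suc q - max 0 0 ^ Suc q) / h) \<longlongrightarrow> max 0 0 ^ q) (at 0)"
      by (rule Lim_transform_eventually)
    then have "((\<lambda>t::real. max 0 t ^ Suc q) has_real_derivative max 0 0 ^ q) (at 0)"
      unfolding DERIV_def .
    moreover have "max 0 0 ^ q = real (Suc q) * max 0 t ^ q" using 3 assms by (simp add: zero_power)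
    ultimately have "((\<lambda>t::real. max 0 t ^ Suc q) has_real_derivative real (Suc q) * max 0 t ^ q) (at 0)"
      by (rule DERIV_cong)
    then show ?thesis unfolding 3 .
  qed
qed

lemma deriv_monom_at:
  "((\<lambda>y. monom_at (x(c := y)) cs) has_real_derivative
     (\<Sum>l<length cs. of_bool (cs ! l = c) * monom_at (x(c := y)) (remove_at l cs))) (at y)"
proof (induction cs)
  case (Cons d cs)
  have "((\<lambda>y. (x(c := y)) d) has_real_derivative of_bool (d = c)) (at y)" by auto
  from DERIV_mult[OF this Cons]
  show ?case
    unfolding monom_at_simps
  proof (rule DERIV_cong)
    have eq: "(\<Sum>l<length (d # cs). of_bool ((d # cs) ! l = c) * monom_at z (remove_at l (d # cs))) =
        of_bool (d = c) * monom_at z cs + (\<Sum>l<length cs. of_bool (cs ! l = c) * (z d * monom_at z (remove_at l cs)))" for z :: "'a \<Rightarrow> real"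
      unfolding list.size add_0_right add_Suc_right sum.lessThan_Suc_shift by (simp add: remove_at_def)
    show "of_bool (d = c) * monom_at (x(c := y)) cs + (\<Sum>l<length cs. of_bool (cs ! l = c) * monom_at (x(c := y)) (remove_at l cs)) * (x(c := y)) d =
        (\<Sum>l<length (d # cs). of_bool ((d # cs) ! l = c) * monom_at (x(c := y)) (remove_at l (d # cs)))"
      unfolding eq sum_distrib_right by (simp only: mult_ac)
  qed
qed simp

lemma poly_fun_derivative:
  assumes "set cs \<subseteq> I"
  shows "poly_fun I (\<lambda>x. monom_at x (remove_at l cs))"
proof -
  have "set (remove_at l cs) \<subseteq> I"
    using assms set_take_subset[of l cs] set_drop_subset[of "Suc l" cs] unfolding remove_at_def by auto
  then show ?thesis by (rule poly_fun_monom_at)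
qed

text \<open>The integrand is the derivative in direction \<open>c\<close> of the product of a monomial with the weight
  of exponent \<open>q + 1\<close>, and this weight vanishes on the boundary of the box.\<close>

lemma integral_divergence:
  assumes "finite I" "c \<in> I" "set cs \<subseteq> I" "q \<ge> 1"
  shows "(\<integral>x. ball_weight I (Suc q) x *
            (\<Sum>l<length cs. of_bool (cs ! l = c) * monom_at x (remove_at l cs)) -
          ball_weight I q x * (2 * real (Suc q) * monom_at x (c # cs)) \<partial>box_measure I) = 0"
    (is "(\<integral>x. ?D x \<partial>_) = 0")
proof -
  define J where "J = I - {c}"
  have J: "finite J" "c \<notin> J" "I = insert c J" using assms(1,2) by (auto simp: J_def)
  let ?d = "\<lambda>x. \<Sum>l<length cs. of_bool (cs ! l = c) * monom_at x (remove_at l cs)"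
  have int: "integrable (box_measure I) ?D"
    using assms(2,3)
    by (intro Bochner_Integration.integrable_diff integrable_poly_fun[OF assms(1)] poly_fun_sum
        poly_fun.mult poly_fun.const poly_fun_derivative poly_fun_monom_at) auto
  have "(\<integral>y. ?D (x(c := y)) \<partial>interval_measure_half) = 0" for x
  proof -
    define A where "A = 1/4 - (\<Sum>i\<in>J. (x i)\<^sup>2)"
    have A: "A \<le> 1/4" using sum_nonneg[of J "\<lambda>i. (x i)\<^sup>2"] by (simp add: A_def)
    have w: "ball_weight I r (x(c := y)) = max 0 (A - y\<^sup>2) ^ r" for r y
    proof -
      have "(\<Sum>i\<in>I. ((x(c := y)) i)\<^sup>2) = y\<^sup>2 + (\<Sum>i\<in>J. ((x(c := y)) i)\<^sup>2)"
        unfolding J(3) using J(1,2) by simp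
      also have "(\<Sum>i\<in>J. ((x(c := y)) i)\<^sup>2) = (\<Sum>i\<in>J. (x i)\<^sup>2)"
        using J(2) by (intro sum.cong) auto
      finally show ?thesis by (simp add: ball_weight_def A_def algebra_simps)
    qed
    let ?F = "\<lambda>y. max 0 (A - y\<^sup>2) ^ Suc q * monom_at (x(c := y)) cs"
    have D: "(?F has_real_derivative ?D (x(c := y))) (at y)" for y
    proof -
      have "((\<lambda>y. A - y\<^sup>2) has_real_derivative - 2 * y) (at y)"
        by (auto intro!: derivative_eq_intros)
      from DERIV_chain2[OF deriv_clipped_power[OF assms(4)] this]
      have "((\<lambda>y. max 0 (A - y\<^sup>2) ^ Suc q) has_real_derivative real (Suc q) * max 0 (A - y\<^sup>2) ^ q * (- 2 * y)) (at y)" .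
      from DERIV_mult[OF this deriv_monom_at[of x c cs y]]
      show ?thesis by (rule DERIV_cong) (simp add: w algebra_simps del: power_Suc)
    qed
    have cont: "isCont (\<lambda>y. ?D (x(c := y))) y" for y
    proof -
      have "isCont (\<lambda>y. monom_at (x(c := y)) es) y" for es
        using deriv_monom_at[of x c es y] by (rule DERIV_isCont)
      then show ?thesis unfolding w by (intro continuous_intros) simp_all
    qed
    have "(\<integral>y. ?D (x(c := y)) \<partial>interval_measure_half) = (\<integral>y. ?D (x(c := y)) * indicator {-1/2..1/2} y \<partial>lborel)"
      by (subst integral_restrict_space) (simp_all add: mult.commute)
    also have "\<dots> = ?F (1/2) - ?F (-1/2)"
      by (rule integral_FTC_Icc_real[OF _ D cont]) simp
    also have "\<dots> = 0"
    proof -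
      have "max 0 (A - (1/2)\<^sup>2) = 0" "max 0 (A - (-1/2)\<^sup>2) = 0" using A by (simp_all add: power2_eq_square)
      then show ?thesis by (simp only: power_0_Suc mult_zero_left)
    qed
    finally show ?thesis .
  qed
  note inner = this
  define D where "D = ?D"
  have zero: "(\<integral>y. D (x(c := y)) \<partial>interval_measure_half) = 0" for x
    unfolding D_def by (rule inner)
  have "integrable (Pi\<^sub>M (insert c J) (\<lambda>_. interval_measure_half)) D"
    using int unfolding box_measure_def J(3)[symmetric] D_def .
  from product_sigma_finite.product_integral_insert[OF product_sigma_finite_half J(1,2) this]
  have "(\<integral>x. D x \<partial>box_measure I) = 0"
    unfolding zero box_measure_def J(3)[symmetric] by simp
  then show ?thesis unfolding D_def .
qed

text \<open>The analogue of Wick's recursion for Gaussian moments. The exponent of the weight changes, but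
  only pairings of \<open>c\<close> with the other factors occur.\<close>

lemma ball_integral_by_parts:
  assumes "finite I" "c \<in> I" "set cs \<subseteq> I" "q \<ge> 1"
  shows "ball_integral I q (\<lambda>x. monom_at x (c # cs)) = 1 / (2 * real (Suc q)) *
    (\<Sum>l<length cs. of_bool (cs ! l = c) * ball_integral I (Suc q) (\<lambda>x. monom_at x (remove_at l cs)))"
proof -
  let ?d = "\<lambda>x. \<Sum>l<length cs. of_bool (cs ! l = c) * monom_at x (remove_at l cs)"
  have pf: "poly_fun I (\<lambda>x. of_bool (cs ! l = c) * monom_at x (remove_at l cs))" for l
    by (rule poly_fun.mult[OF poly_fun.const poly_fun_derivative[OF assms(3)]])
  then have d: "poly_fun I ?d" by (rule poly_fun_sum)
  have m: "poly_fun I (\<lambda>x. 2 * real (Suc q) * monom_at x (c # cs))"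
    by (rule poly_fun.mult[OF poly_fun.const poly_fun_monom_at]) (use assms(2,3) in simp)
  have "ball_integral I (Suc q) ?d - ball_integral I q (\<lambda>x. 2 * real (Suc q) * monom_at x (c # cs)) = 0"
    unfolding ball_integral_def
    using integral_divergence[OF assms] integrable_poly_fun[OF assms(1) d, of "Suc q"]
      integrable_poly_fun[OF assms(1) m, of q]
    by (subst Bochner_Integration.integral_diff[symmetric]) simp_all
  then have "2 * real (Suc q) * ball_integral I q (\<lambda>x. monom_at x (c # cs)) = ball_integral I (Suc q) ?d"
    by (simp only: ball_integral_cmult)
  also have "\<dots> = (\<Sum>l<length cs. ball_integral I (Suc q) (\<lambda>x. of_bool (cs ! l = c) * monom_at x (remove_at l cs)))"
    by (rule ball_integral_sum[OF assms(1) pf])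
  also have "\<dots> = (\<Sum>l<length cs. of_bool (cs ! l = c) * ball_integral I (Suc q) (\<lambda>x. monom_at x (remove_at l cs)))"
    by (intro sum.cong refl ball_integral_cmult)
  finally have eq: "2 * real (Suc q) * ball_integral I q (\<lambda>x. monom_at x (c # cs)) =
    (\<Sum>l<length cs. of_bool (cs ! l = c) * ball_integral I (Suc q) (\<lambda>x. monom_at x (remove_at l cs)))" .
  have "E = 1 / r * (r * E)" if "r \<noteq> 0" for E r :: real using that by simp
  from this[of "2 * real (Suc q)"] show ?thesis unfolding eq[symmetric] by simp
qed


section \<open>Moments are combinations of pairings\<close>

text \<open>Edges are natural numbers so that a fresh one is always at hand.\<close>

definition pairing_span :: "nat \<Rightarrow> nat \<Rightarrow> (nat list \<Rightarrow> real) set" where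
  "pairing_span n N = fun_space.span {pairing_tensor n E w | (E :: nat set) w. pairing E w \<and> length w = N}"

lemma pairing_tensor_in_span:
  fixes E :: "nat set"
  assumes "pairing E w" "length w = N"
  shows "pairing_tensor n E w \<in> pairing_span n N"
  unfolding pairing_span_def using assms by (intro fun_space.span_base) blast

lemma subspace_pairing_span: "fun_space.subspace (pairing_span n N)"
  unfolding pairing_span_def by (rule fun_space.subspace_span)

lemma linear_maps_span:
  assumes "f \<in> fun_space.span B" "\<And>b. b \<in> B \<Longrightarrow> L b \<in> V" "fun_space.subspace V"
    "\<And>f g. L (f + g) = L f + L g" "\<And>c f. L (fun_scale c f) = fun_scale c (L f)"
  shows "L f \<in> V"
proof -
  have "L 0 = fun_scale 0 (L 0)" using assms(5)[of 0 0] by simp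
  then have "L 0 = 0" by simp
  then have "fun_space.subspace {f. L f \<in> V}"
    using assms(3-5) by (simp add: fun_space.subspace_def)
  then have "fun_space.span B \<subseteq> {f. L f \<in> V}"
    using assms(2) by (intro fun_space.span_minimal) auto
  then show ?thesis using assms(1) by blast
qed

lemma pairing_tensor_outside:
  assumes "pairing E w" "xs \<notin> multi_indices n (length w)"
  shows "pairing_tensor n E w xs = 0"
  using assms map_colouring_multi_indices[of _ E n w] unfolding pairing_tensor_def pairing_def
  by (intro sum.neutral) auto

lemma remove_at_multi_indices:
  assumes "js \<in> multi_indices n (Suc N)" "l \<le> N"
  shows "remove_at l js \<in> multi_indices n N"
  using assms set_take_subset[of l js] set_drop_subset[of "Suc l" js]
  by (auto simp: multi_indices_def remove_at_def)

lemma insert_pairing_span: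
  assumes "R \<in> pairing_span n N" "l \<le> N"
  shows "(\<lambda>js. if js \<in> multi_indices n (Suc (Suc N))
      then of_bool (tl js ! l = hd js) * R (remove_at l (tl js)) else 0) \<in> pairing_span n (Suc (Suc N))"
    (is "?L R \<in> _")
proof (rule linear_maps_span[where L = ?L, OF assms(1)[unfolded pairing_span_def] _ subspace_pairing_span])
  fix R assume "R \<in> {pairing_tensor n E w | (E :: nat set) w. pairing E w \<and> length w = N}"
  then obtain E :: "nat set" and w where R: "R = pairing_tensor n E w" "pairing E w" "length w = N" by blast
  obtain e where e: "e \<notin> E" using R(2) ex_new_if_finite[OF infinite_UNIV_nat, of E] by (auto simp: pairing_def)
  let ?w = "e # insert_at l e w"
  have p: "pairing (insert e E) ?w" by (rule pairing_insert[OF R(2) e])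
  have len: "length ?w = Suc (Suc N)" using R(3) by (simp add: insert_at_def)
  have "?L R = pairing_tensor n (insert e E) ?w"
  proof
    fix js
    show "?L R js = pairing_tensor n (insert e E) ?w js"
    proof (cases "js \<in> multi_indices n (Suc (Suc N))")
      case True
      then obtain j js' where js: "js = j # js'" "length js' = Suc N" "j < n"
        by (auto simp: multi_indices_def length_Suc_conv)
      show ?thesis
        using True pairing_tensor_insert[OF R(2) e, of l js' j n] js assms(2) R(3) by (simp add: R(1))
    next
      case False
      then show ?thesis using pairing_tensor_outside[OF p] len by simp
    qed
  qed
  then show "?L R \<in> pairing_span n (Suc (Suc N))"
    using pairing_tensor_in_span[OF p len] by simp
qed (auto simp: fun_eq_iff fun_scale_def algebra_simps)

lemma contract_pairing_span:
  assumes "R \<in> pairing_span n (Suc (Suc N))"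
  shows "(\<lambda>js. if js \<in> multi_indices n N then \<Sum>c<n. R (c # c # js) else 0) \<in> pairing_span n N"
    (is "?L R \<in> _")
proof (rule linear_maps_span[where L = ?L, OF assms(1)[unfolded pairing_span_def] _ subspace_pairing_span])
  fix R assume "R \<in> {pairing_tensor n E w | (E :: nat set) w. pairing E w \<and> length w = Suc (Suc N)}"
  then obtain E :: "nat set" and w where R: "R = pairing_tensor n E w" "pairing E w" "length w = Suc (Suc N)" by blast
  then obtain a b w' where w: "w = a # b # w'" "length w' = N"
    by (auto simp: length_Suc_conv)
  obtain E' :: "nat set" and v where v: "pairing E' v" "length v = N"
    "\<And>n xs. (\<Sum>c<n. pairing_tensor n E (a # b # w') (c # c # xs)) = pairing_tensor n E' v xs"
    using pairing_tensor_contract[OF R(2)[unfolded w(1)]] w(2) by metis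
  have "?L R = pairing_tensor n E' v"
    using v(3)[of n] pairing_tensor_outside[OF v(1)] v(2) by (auto simp: fun_eq_iff R(1) w(1))
  then show "?L R \<in> pairing_span n N" using pairing_tensor_in_span[OF v(1,2)] by simp
qed (auto simp: fun_eq_iff fun_scale_def sum.distrib sum_distrib_left)

lemma remove_at_zip:
  assumes "length xs = length ys"
  shows "remove_at l (zip xs ys) = zip (remove_at l xs) (remove_at l ys)"
  using assms by (simp add: remove_at_def take_zip drop_zip)

abbreviation entries :: "nat \<Rightarrow> (nat \<times> nat) set" where
  "entries n \<equiv> {..<n} \<times> {..<n}"

lemma set_zip_multi_indices:
  assumes "xs \<in> multi_indices n N" "ys \<in> multi_indices n N"
  shows "set (zip xs ys) \<subseteq> entries n"
  using assms by (auto simp: multi_indices_def dest: set_zip_leftD set_zip_rightD)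

text \<open>By the recursion, the first position is paired with one of the others, and the induction
  hypothesis, for the next exponent, provides the pairing of the rest.\<close>

lemma moments_in_pairing_span:
  assumes "q \<ge> 1" "is \<in> multi_indices n N"
  shows "(\<lambda>js. if js \<in> multi_indices n N then ball_integral (entries n) q (\<lambda>g. monom_at g (zip is js)) else 0)
    \<in> pairing_span n N"
  using assms
proof (induction N arbitrary: "is" q rule: less_induct)
  case (less N)
  show ?case
  proof (cases N)
    case 0
    have "pairing ({} :: nat set) []" by (simp add: pairing_def)
    then have "fun_scale (ball_integral (entries n) q (\<lambda>g. 1)) (pairing_tensor n ({} :: nat set) []) \<in> pairing_span n 0"
      by (intro fun_space.subspace_scale[OF subspace_pairing_span] pairing_tensor_in_span) simp_all
    moreover have "fun_scale (ball_integral (entries n) q (\<lambda>g. 1)) (pairing_tensor n ({} :: nat set) []) =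
      (\<lambda>js. if js \<in> multi_indices n N then ball_integral (entries n) q (\<lambda>g. monom_at g (zip is js)) else 0)"
      by (auto simp: fun_eq_iff fun_scale_def pairing_tensor_def 0)
    ultimately show ?thesis by (simp add: 0)
  next
    case (Suc M)
    then obtain i is' where i: "is = i # is'" "is' \<in> multi_indices n M" "i < n"
      using less.prems(2) by (auto simp: multi_indices_def length_Suc_conv)
    have leni: "length is' = M" using i(2) by (simp add: multi_indices_def)
    let ?E = "\<lambda>q is js. ball_integral (entries n) q (\<lambda>g. monom_at g (zip is js))"
    define R where "R l = (\<lambda>js. if js \<in> multi_indices n N
        then of_bool (tl js ! l = hd js) * ?E (Suc q) (remove_at l is') (remove_at l (tl js)) else 0)" for l
    have "R l \<in> pairing_span n N" if l: "l < M" for l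
    proof -
      obtain K where K: "M = Suc K" using l by (cases M) auto
      have "remove_at l is' \<in> multi_indices n K"
        using i(2) l unfolding K by (intro remove_at_multi_indices) auto
      from less.IH[OF _ _ this, of "Suc q"] have "(\<lambda>js. if js \<in> multi_indices n K
          then ?E (Suc q) (remove_at l is') js else 0) \<in> pairing_span n K" by (simp add: Suc K)
      from insert_pairing_span[OF this, of l] l
      have "(\<lambda>js. if js \<in> multi_indices n (Suc (Suc K)) then of_bool (tl js ! l = hd js) *
          (if remove_at l (tl js) \<in> multi_indices n K then ?E (Suc q) (remove_at l is') (remove_at l (tl js)) else 0) else 0)
          \<in> pairing_span n (Suc (Suc K))" by (simp add: K)
      moreover have "remove_at l (tl js) \<in> multi_indices n K" if "js \<in> multi_indices n (Suc (Suc K))" for js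
        using that l K by (intro remove_at_multi_indices) (auto simp: multi_indices_def length_Suc_conv)
      ultimately show ?thesis unfolding R_def Suc K by (simp cong: if_cong)
    qed
    then have "(\<Sum>l<M. fun_scale (1 / (2 * real (Suc q)) * of_bool (is' ! l = i)) (R l)) \<in> pairing_span n N"
      by (intro fun_space.subspace_sum[OF subspace_pairing_span] fun_space.subspace_scale[OF subspace_pairing_span]) auto
    moreover have "(\<Sum>l<M. fun_scale (1 / (2 * real (Suc q)) * of_bool (is' ! l = i)) (R l)) =
      (\<lambda>js. if js \<in> multi_indices n N then ?E q is js else 0)"
    proof
      fix js
      show "(\<Sum>l<M. fun_scale (1 / (2 * real (Suc q)) * of_bool (is' ! l = i)) (R l)) js =
          (if js \<in> multi_indices n N then ?E q is js else 0)"
      proof (cases "js \<in> multi_indices n N")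
        case True
        then obtain j js' where j: "js = j # js'" "js' \<in> multi_indices n M" "j < n"
          using Suc by (auto simp: multi_indices_def length_Suc_conv)
        have lenj: "length js' = M" using j(2) by (simp add: multi_indices_def)
        have "?E q is js = 1 / (2 * real (Suc q)) * (\<Sum>l<length (zip is' js').
            of_bool (zip is' js' ! l = (i, j)) * ball_integral (entries n) (Suc q) (\<lambda>g. monom_at g (remove_at l (zip is' js'))))"
          unfolding i(1) j(1) zip_Cons_Cons
          using i(3) j(3) set_zip_multi_indices[OF i(2) j(2)] less.prems(1)
          by (intro ball_integral_by_parts) auto
        also have "\<dots> = (\<Sum>l<M. 1 / (2 * real (Suc q)) * of_bool (is' ! l = i) *
            (of_bool (js' ! l = j) * ?E (Suc q) (remove_at l is') (remove_at l js')))"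
          unfolding sum_distrib_left
          by (intro sum.cong) (auto simp: leni lenj remove_at_zip)
        also have "\<dots> = (\<Sum>l<M. fun_scale (1 / (2 * real (Suc q)) * of_bool (is' ! l = i)) (R l)) js"
          using True by (simp only: sum_apply fun_scale_def R_def j(1) list.sel if_True)
        finally show ?thesis using True by simp
      qed (simp add: sum_apply fun_scale_def R_def)
    qed
    ultimately show ?thesis by simp
  qed
qed

text \<open>Products of entries of \<open>g g\<^sup>T\<close>. They record the invariant form, which distinguishes the
  orthogonal matrices among all matrices.\<close>

definition gram_monom :: "nat \<Rightarrow> (nat \<times> nat) list \<Rightarrow> (nat \<times> nat \<Rightarrow> real) \<Rightarrow> real" where
  "gram_monom n ps g = prod_list (map (\<lambda>p. \<Sum>c<n. g (fst p, c) * g (snd p, c)) ps)"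

lemma gram_monom_simps [simp]:
  "gram_monom n [] g = 1"
  "gram_monom n (p # ps) g = (\<Sum>c<n. g (fst p, c) * g (snd p, c)) * gram_monom n ps g"
  "gram_monom n (ps @ qs) g = gram_monom n ps g * gram_monom n qs g"
  by (simp_all add: gram_monom_def)

lemma poly_fun_gram_monom:
  assumes "set ps \<subseteq> entries n"
  shows "poly_fun (entries n) (gram_monom n ps)"
  unfolding gram_monom_def[abs_def] using assms
  by (intro poly_fun_prod_list poly_fun_sum poly_fun.mult poly_fun.coord) auto

text \<open>An entry of \<open>g g\<^sup>T\<close> is a sum over one index occurring twice, so it contracts two positions of a
  pairing.\<close>

lemma gram_moments_in_pairing_span:
  assumes "q \<ge> 1" "set ps \<subseteq> entries n" "is \<in> multi_indices n N"
  shows "(\<lambda>js. if js \<in> multi_indices n N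
      then ball_integral (entries n) q (\<lambda>g. gram_monom n ps g * monom_at g (zip is js)) else 0) \<in> pairing_span n N"
  using assms(2,3)
proof (induction ps arbitrary: "is" N)
  case Nil
  then show ?case unfolding gram_monom_simps(1) mult_1 by (intro moments_in_pairing_span[OF assms(1)])
next
  case (Cons p ps)
  let ?E = "\<lambda>is js. ball_integral (entries n) q (\<lambda>g. gram_monom n ps g * monom_at g (zip is js))"
  let ?is = "fst p # snd p # is"
  have is2: "?is \<in> multi_indices n (Suc (Suc N))" using Cons.prems by (auto simp: multi_indices_def)
  have eq: "ball_integral (entries n) q (\<lambda>g. gram_monom n (p # ps) g * monom_at g (zip is js)) =
      (\<Sum>c<n. ?E ?is (c # c # js))" if js: "js \<in> multi_indices n N" for js
  proof -
    have "poly_fun (entries n) (\<lambda>g. gram_monom n ps g * monom_at g (zip ?is (c # c # js)))" if "c < n" for c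
    proof -
      have "c # c # js \<in> multi_indices n (Suc (Suc N))" using js that by (auto simp: multi_indices_def)
      from set_zip_multi_indices[OF is2 this] show ?thesis
        using Cons.prems(1) by (intro poly_fun.mult poly_fun_gram_monom poly_fun_monom_at) auto
    qed
    then have "(\<Sum>c<n. ?E ?is (c # c # js)) =
        ball_integral (entries n) q (\<lambda>g. \<Sum>c<n. gram_monom n ps g * monom_at g (zip ?is (c # c # js)))"
      by (intro ball_integral_sum[symmetric]) auto
    moreover have "gram_monom n (p # ps) g * monom_at g (zip is js) =
        (\<Sum>c<n. gram_monom n ps g * monom_at g (zip ?is (c # c # js)))" for g
      unfolding gram_monom_simps(2) sum_distrib_right by (intro sum.cong) (simp_all add: mult_ac)
    ultimately show ?thesis by simp
  qed
  have "(\<lambda>js. if js \<in> multi_indices n (Suc (Suc N)) then ?E ?is js else 0) \<in> pairing_span n (Suc (Suc N))"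
    using Cons.prems(1) by (intro Cons.IH is2) auto
  from contract_pairing_span[OF this]
  have "(\<lambda>js. if js \<in> multi_indices n N then \<Sum>c<n. if c # c # js \<in> multi_indices n (Suc (Suc N))
      then ?E ?is (c # c # js) else 0 else 0) \<in> pairing_span n N" .
  moreover have "(\<lambda>js. if js \<in> multi_indices n N then \<Sum>c<n. if c # c # js \<in> multi_indices n (Suc (Suc N))
      then ?E ?is (c # c # js) else 0 else 0) = (\<lambda>js. if js \<in> multi_indices n N
      then ball_integral (entries n) q (\<lambda>g. gram_monom n (p # ps) g * monom_at g (zip is js)) else 0)"
  proof
    fix js
    show "(if js \<in> multi_indices n N then \<Sum>c<n. if c # c # js \<in> multi_indices n (Suc (Suc N))
      then ?E ?is (c # c # js) else 0 else 0) = (if js \<in> multi_indices n N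
      then ball_integral (entries n) q (\<lambda>g. gram_monom n (p # ps) g * monom_at g (zip is js)) else 0)"
    proof (cases "js \<in> multi_indices n N")
      case True
      then have mem: "c # c # js \<in> multi_indices n (Suc (Suc N))" if "c < n" for c
        using that by (auto simp: multi_indices_def)
      have "(\<Sum>c<n. if c # c # js \<in> multi_indices n (Suc (Suc N)) then ?E ?is (c # c # js) else 0) =
          (\<Sum>c<n. ?E ?is (c # c # js))"
        by (rule sum.cong[OF refl], rule if_P) (rule mem, simp)
      then show ?thesis unfolding if_P[OF True] eq[OF True] .
    qed simp
  qed
  ultimately show ?case by simp
qed


section \<open>Polynomials in the translates of the model\<close>

text \<open>Entries of the translates by \<open>g\<close> of the tensors that are built from \<open>h\<close> and the invariant form
  by tensor products. Such functions are closed under multiplication.\<close>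

definition model_monom ::
    "nat \<Rightarrow> ((nat \<Rightarrow>\<^sub>0 nat) \<Rightarrow> real) \<Rightarrow> (nat \<times> nat) list \<times> nat list \<times> nat list \<Rightarrow> (nat \<times> nat \<Rightarrow> real) \<Rightarrow> real" where
  "model_monom n h t g = (case t of (ps, ds, v) \<Rightarrow> gram_monom n ps g * mat_act n g (vertex_tensor h ds) v)"

definition model_index :: "nat \<Rightarrow> ((nat \<times> nat) list \<times> nat list \<times> nat list) set" where
  "model_index n = {(ps, ds, v). set ps \<subseteq> entries n \<and> v \<in> multi_indices n (sum_list ds)}"

definition model_polys :: "nat \<Rightarrow> ((nat \<Rightarrow>\<^sub>0 nat) \<Rightarrow> real) \<Rightarrow> ((nat \<times> nat \<Rightarrow> real) \<Rightarrow> real) set" where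
  "model_polys n h = fun_space.span (model_monom n h ` model_index n)"

lemma poly_fun_mat_act:
  assumes "v \<in> multi_indices n k"
  shows "poly_fun (entries n) (\<lambda>g. mat_act n g T v)"
proof -
  have len: "length v = k" using assms by (simp add: multi_indices_def)
  show ?thesis
    unfolding mat_act_def len using set_zip_multi_indices[OF assms]
    by (intro poly_fun_sum poly_fun.mult poly_fun.const poly_fun_monom_at) auto
qed

lemma poly_fun_model_polys:
  assumes "f \<in> model_polys n h"
  shows "poly_fun (entries n) f"
proof -
  have "fun_space.subspace {f. poly_fun (entries n) f}"
    unfolding fun_space.subspace_def fun_scale_def plus_fun_def zero_fun_def
    by (auto intro: poly_fun.intros)
  moreover have "poly_fun (entries n) (model_monom n h t)" if "t \<in> model_index n" for t
    using that unfolding model_index_def model_monom_def[abs_def]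
    by (auto intro!: poly_fun.mult poly_fun_gram_monom poly_fun_mat_act)
  ultimately have "model_polys n h \<subseteq> {f. poly_fun (entries n) f}"
    unfolding model_polys_def by (intro fun_space.span_minimal) auto
  then show ?thesis using assms by blast
qed

lemma vertex_tensor_append:
  "vertex_tensor h (ds @ es) xs = vertex_tensor h ds (take (sum_list ds) xs) * vertex_tensor h es (drop (sum_list ds) xs)"
  by (induction ds arbitrary: xs) (simp_all add: take_drop drop_drop add.commute min_def mult.assoc)

lemma model_monom_mult:
  assumes "s \<in> model_index n" "t \<in> model_index n"
  shows "\<exists>r\<in>model_index n. \<forall>g. model_monom n h s g * model_monom n h t g = model_monom n h r g"
proof -
  obtain ps ds v where s: "s = (ps, ds, v)" "set ps \<subseteq> entries n" "v \<in> multi_indices n (sum_list ds)"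
    using assms(1) by (auto simp: model_index_def)
  obtain qs es w where t: "t = (qs, es, w)" "set qs \<subseteq> entries n" "w \<in> multi_indices n (sum_list es)"
    using assms(2) by (auto simp: model_index_def)
  have len: "length v = sum_list ds" using s(3) by (simp add: multi_indices_def)
  have "mat_act n g (vertex_tensor h (ds @ es)) (v @ w) =
      mat_act n g (vertex_tensor h ds) v * mat_act n g (vertex_tensor h es) w" for g
    unfolding mat_act_append[OF len, symmetric] by (intro mat_act_cong) (rule vertex_tensor_append)
  then have "model_monom n h s g * model_monom n h t g = model_monom n h (ps @ qs, ds @ es, v @ w) g" for g
    by (simp add: model_monom_def s(1) t(1) mult_ac)
  moreover have "(ps @ qs, ds @ es, v @ w) \<in> model_index n"
    using s(2,3) t(2,3) by (auto simp: model_index_def multi_indices_def)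
  ultimately show ?thesis by blast
qed

lemma model_polys_mult:
  assumes "f \<in> model_polys n h" "g \<in> model_polys n h"
  shows "(\<lambda>x. f x * g x) \<in> model_polys n h"
proof -
  let ?B = "model_monom n h ` model_index n"
  have sub: "fun_space.subspace (model_polys n h)" by (simp add: model_polys_def)
  have base: "(\<lambda>x. b x * c x) \<in> model_polys n h" if bc: "b \<in> ?B" "c \<in> ?B" for b c
  proof -
    obtain s t where "s \<in> model_index n" "t \<in> model_index n" "b = model_monom n h s" "c = model_monom n h t"
      using bc by blast
    then obtain r where "r \<in> model_index n" "(\<lambda>x. b x * c x) = model_monom n h r"
      using model_monom_mult[of s n t h] by auto
    then show ?thesis unfolding model_polys_def by (intro fun_space.span_base) blast
  qed
  have left: "(\<lambda>x. b x * g x) \<in> model_polys n h" if "b \<in> ?B" for b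
    using assms(2)[unfolded model_polys_def] base[OF that] sub
    by (rule linear_maps_span[where L = "\<lambda>g x. b x * g x"]) (auto simp: fun_eq_iff fun_scale_def algebra_simps)
  show ?thesis
    using assms(1)[unfolded model_polys_def] left sub
    by (rule linear_maps_span[where L = "\<lambda>f x. f x * g x"]) (auto simp: fun_eq_iff fun_scale_def algebra_simps)
qed

lemma model_polys_const: "(\<lambda>x. c) \<in> model_polys n h"
proof -
  have "([], [], []) \<in> model_index n" by (simp add: model_index_def)
  then have "fun_scale c (model_monom n h ([], [], [])) \<in> model_polys n h"
    unfolding model_polys_def by (intro fun_space.span_scale fun_space.span_base) blast
  moreover have "fun_scale c (model_monom n h ([], [], [])) = (\<lambda>x. c)"
    by (simp add: fun_eq_iff fun_scale_def model_monom_def mat_act_def)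
  ultimately show ?thesis by simp
qed

lemma model_polys_add:
  assumes "f \<in> model_polys n h" "g \<in> model_polys n h"
  shows "(\<lambda>x. f x + g x) \<in> model_polys n h"
  using fun_space.span_add[OF assms[unfolded model_polys_def]] unfolding model_polys_def plus_fun_def .

text \<open>The integral contracts the translate of a tensor of the model with \<open>T\<close> along pairings. Each
  such contraction is the inner product of \<open>T\<close> with a diagram.\<close>

lemma orthogonal_model_polys:
  assumes T: "\<And>(E :: nat set) ds u w. pairing E (u @ w) \<Longrightarrow> length u = sum_list ds \<Longrightarrow> length w = k \<Longrightarrow>
      tensor_inner n k T (diagram_tensor n h E ds u w) = 0"
    and f: "f \<in> model_polys n h" and w: "w \<in> multi_indices n k" and q: "q \<ge> 1"
  shows "ball_integral (entries n) q (\<lambda>g. f g * mat_act n g T w) = 0"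
proof -
  let ?I = "entries n"
  have fin: "finite ?I" by simp
  have lenw: "length w = k" using w by (simp add: multi_indices_def)
  have gen: "ball_integral ?I q (\<lambda>g. model_monom n h t g * mat_act n g T w) = 0" if t: "t \<in> model_index n" for t
  proof -
    obtain ps ds v where t: "t = (ps, ds, v)" "set ps \<subseteq> ?I" "v \<in> multi_indices n (sum_list ds)"
      using t by (auto simp: model_index_def)
    let ?m = "sum_list ds"
    have lenv: "length v = ?m" using t(3) by (simp add: multi_indices_def)
    define R where "R js = (if js \<in> multi_indices n (?m + k)
        then ball_integral ?I q (\<lambda>g. gram_monom n ps g * monom_at g (zip (v @ w) js)) else 0)" for js
    define L where "L R = (\<lambda>_::unit. \<Sum>xs\<in>multi_indices n ?m. \<Sum>ys\<in>multi_indices n k.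
        vertex_tensor h ds xs * T ys * R (xs @ ys))" for R :: "nat list \<Rightarrow> real"
    have vw: "v @ w \<in> multi_indices n (?m + k)" using t(3) w by (auto simp: multi_indices_def)
    have R: "R \<in> pairing_span n (?m + k)"
      using gram_moments_in_pairing_span[OF q t(2) vw] unfolding R_def[abs_def] .
    \<comment> \<open>Functions on the unit type stand for scalars, so that the linear functional \<open>L\<close> is a map between function spaces.\<close>
    have "L R \<in> {0}"
    proof (rule linear_maps_span[where L = L, OF R[unfolded pairing_span_def]])
      fix P assume "P \<in> {pairing_tensor n E w | (E :: nat set) w. pairing E w \<and> length w = ?m + k}"
      then obtain E :: "nat set" and z where P: "P = pairing_tensor n E z" "pairing E z" "length z = ?m + k" by blast
      let ?u = "take ?m z" and ?w = "drop ?m z"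
      have z: "pairing E (?u @ ?w)" "length ?u = ?m" "length ?w = k" "set ?u \<subseteq> E"
        using P set_take_subset[of ?m z] by (auto simp: pairing_def)
      have "L P = (\<lambda>_. \<Sum>ys\<in>multi_indices n k. T ys * diagram_tensor n h E ds ?u ?w ys)"
        unfolding L_def diagram_tensor_contraction[OF z(4)] z(2) P(1) append_take_drop_id
        by (subst sum.swap) (simp add: sum_distrib_left mult_ac)
      then show "L P \<in> {0}" using T[OF z(1,2,3)] by (simp add: tensor_inner_def fun_eq_iff)
    qed (auto simp: L_def fun_space.subspace_def fun_eq_iff fun_scale_def sum.distrib sum_distrib_left algebra_simps)
    then have L0: "L R () = 0" by simp
    have mem: "xs @ ys \<in> multi_indices n (?m + k)" if "xs \<in> multi_indices n ?m" "ys \<in> multi_indices n k" for xs ys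
      using that by (auto simp: multi_indices_def)
    have pf: "poly_fun ?I (\<lambda>g. vertex_tensor h ds xs * T ys * (gram_monom n ps g * monom_at g (zip (v @ w) (xs @ ys))))"
      if "xs \<in> multi_indices n ?m" "ys \<in> multi_indices n k" for xs ys
      by (rule poly_fun.mult[OF poly_fun.const poly_fun.mult[OF poly_fun_gram_monom[OF t(2)]
            poly_fun_monom_at[OF set_zip_multi_indices[OF vw mem[OF that]]]]])
    have "(\<lambda>g. model_monom n h t g * mat_act n g T w) = (\<lambda>g. \<Sum>xs\<in>multi_indices n ?m. \<Sum>ys\<in>multi_indices n k.
        vertex_tensor h ds xs * T ys * (gram_monom n ps g * monom_at g (zip (v @ w) (xs @ ys))))"
    proof
      fix g
      have zip: "monom_at g (zip (v @ w) (xs @ ys)) = monom_at g (zip v xs) * monom_at g (zip w ys)"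
        if "xs \<in> multi_indices n ?m" for xs ys
        using that lenv by (simp add: multi_indices_def)
      have "model_monom n h t g * mat_act n g T w = gram_monom n ps g * (\<Sum>xs\<in>multi_indices n ?m. \<Sum>ys\<in>multi_indices n k.
          (monom_at g (zip v xs) * vertex_tensor h ds xs) * (monom_at g (zip w ys) * T ys))"
        unfolding model_monom_def t(1) prod.case mat_act_def lenv lenw mult.assoc[of "gram_monom n ps g"] sum_product ..
      also have "\<dots> = (\<Sum>xs\<in>multi_indices n ?m. \<Sum>ys\<in>multi_indices n k.
        vertex_tensor h ds xs * T ys * (gram_monom n ps g * monom_at g (zip (v @ w) (xs @ ys))))"
        unfolding sum_distrib_left
        by (intro sum.cong refl) (simp add: zip mult_ac)
      finally show "model_monom n h t g * mat_act n g T w = (\<Sum>xs\<in>multi_indices n ?m. \<Sum>ys\<in>multi_indices n k.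
        vertex_tensor h ds xs * T ys * (gram_monom n ps g * monom_at g (zip (v @ w) (xs @ ys))))" .
    qed
    then have "ball_integral ?I q (\<lambda>g. model_monom n h t g * mat_act n g T w) =
      ball_integral ?I q (\<lambda>g. \<Sum>xs\<in>multi_indices n ?m. \<Sum>ys\<in>multi_indices n k.
        vertex_tensor h ds xs * T ys * (gram_monom n ps g * monom_at g (zip (v @ w) (xs @ ys))))" by simp
    also have "\<dots> = (\<Sum>xs\<in>multi_indices n ?m. ball_integral ?I q (\<lambda>g. \<Sum>ys\<in>multi_indices n k.
        vertex_tensor h ds xs * T ys * (gram_monom n ps g * monom_at g (zip (v @ w) (xs @ ys)))))"
      by (rule ball_integral_sum[OF fin poly_fun_sum[OF pf]])
    also have "\<dots> = (\<Sum>xs\<in>multi_indices n ?m. \<Sum>ys\<in>multi_indices n k. ball_integral ?I q (\<lambda>g.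
        vertex_tensor h ds xs * T ys * (gram_monom n ps g * monom_at g (zip (v @ w) (xs @ ys)))))"
      by (intro sum.cong refl ball_integral_sum[OF fin pf])
    also have "\<dots> = (\<Sum>xs\<in>multi_indices n ?m. \<Sum>ys\<in>multi_indices n k. vertex_tensor h ds xs * T ys * R (xs @ ys))"
      by (intro sum.cong refl) (simp only: ball_integral_cmult R_def mem if_True)
    also have "\<dots> = 0" using L0 by (simp add: L_def)
    finally show ?thesis .
  qed
  have uw: "poly_fun ?I (\<lambda>g. mat_act n g T w)" by (rule poly_fun_mat_act[OF w])
  let ?Z = "{f. poly_fun ?I f \<and> ball_integral ?I q (\<lambda>g. f g * mat_act n g T w) = 0}"
  have "fun_space.subspace ?Z"
  proof (unfold fun_space.subspace_def, intro conjI ballI allI)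
    show "0 \<in> ?Z" by (simp add: zero_fun_def poly_fun.const ball_integral_def)
  next
    fix f f' assume "f \<in> ?Z" "f' \<in> ?Z"
    then show "f + f' \<in> ?Z"
      using ball_integral_add[OF fin poly_fun.mult[OF _ uw] poly_fun.mult[OF _ uw], of f f' q]
      by (simp add: plus_fun_def poly_fun.add distrib_right)
  next
    fix c f assume "f \<in> ?Z"
    then show "fun_scale c f \<in> ?Z"
      using ball_integral_cmult[of ?I q c "\<lambda>g. f g * mat_act n g T w"]
      by (simp add: fun_scale_def poly_fun.mult poly_fun.const mult.assoc)
  qed
  moreover have "model_monom n h ` model_index n \<subseteq> ?Z"
  proof
    fix b assume "b \<in> model_monom n h ` model_index n"
    moreover from this have "b \<in> model_polys n h" unfolding model_polys_def by (rule fun_space.span_base)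
    ultimately show "b \<in> ?Z" using gen poly_fun_model_polys by auto
  qed
  ultimately have "model_polys n h \<subseteq> ?Z" unfolding model_polys_def by (rule fun_space.span_minimal[rotated])
  then show ?thesis using f by blast
qed


section \<open>Density on the fibres\<close>

text \<open>The embedding by the countably many functions \<open>f j\<close> makes the Stone-Weierstrass theorem
  applicable although the algebra does not separate the points of \<open>K\<close>.\<close>

lemma Stone_Weierstrass_fibres:
  fixes K :: "'a::t2_space set" and f :: "'j::countable \<Rightarrow> 'a \<Rightarrow> real"
  assumes K: "compact K" and cont: "\<And>r. r \<in> R \<Longrightarrow> continuous_on K r"
    and const: "\<And>c. (\<lambda>x. c) \<in> R"
    and add: "\<And>r s. r \<in> R \<Longrightarrow> s \<in> R \<Longrightarrow> (\<lambda>x. r x + s x) \<in> R"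
    and mult: "\<And>r s. r \<in> R \<Longrightarrow> s \<in> R \<Longrightarrow> (\<lambda>x. r x * s x) \<in> R"
    and f: "\<And>j. f j \<in> R"
    and u: "continuous_on K u" "\<And>x y. x \<in> K \<Longrightarrow> y \<in> K \<Longrightarrow> (\<And>j. f j x = f j y) \<Longrightarrow> u x = u y"
    and e: "0 < e"
  shows "\<exists>r\<in>R. \<forall>x\<in>K. \<bar>u x - r x\<bar> < e"
proof -
  \<comment> \<open>On the compact image of \<open>\<Phi>\<close> points are separated by the coordinates, and \<open>u\<close> factors through it as \<open>v\<close>.\<close>
  define \<Phi> where "\<Phi> x j = f j x" for x j
  let ?S = "\<Phi> ` K"
  have \<Phi>: "continuous_on K \<Phi>"
    using cont[OF f] by (intro continuous_on_coordinatewise_then_product) (simp add: \<Phi>_def)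
  then have S: "compact ?S" using K by (rule compact_continuous_image)
  define v where "v s = u (SOME x. x \<in> K \<and> \<Phi> x = s)" for s
  have v: "v (\<Phi> x) = u x" if "x \<in> K" for x
  proof -
    let ?y = "SOME y. y \<in> K \<and> \<Phi> y = \<Phi> x"
    have "?y \<in> K \<and> \<Phi> ?y = \<Phi> x" by (rule someI[of _ x]) (simp add: that)
    then have "u ?y = u x" using that by (intro u(2)) (auto simp: \<Phi>_def fun_eq_iff)
    then show ?thesis by (simp add: v_def)
  qed
  have vS: "continuous_on ?S v"
    unfolding continuous_on_closed_vimage[OF compact_imp_closed[OF S]]
  proof (intro allI impI)
    \<comment> \<open>\<open>v\<close> is continuous because \<open>\<Phi>\<close> maps compact sets to closed sets.\<close>
    fix B :: "real set" assume "closed B"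
    then have "closed (u -` B \<inter> K)"
      using u(1) unfolding continuous_on_closed_vimage[OF compact_imp_closed[OF K]] by blast
    then have "compact (K \<inter> (u -` B \<inter> K))" using K by (rule compact_Int_closed[rotated])
    then have "compact (\<Phi> ` (K \<inter> (u -` B \<inter> K)))"
      by (intro compact_continuous_image continuous_on_subset[OF \<Phi>]) auto
    moreover have "\<Phi> ` (K \<inter> (u -` B \<inter> K)) = v -` B \<inter> ?S" using v by auto
    ultimately show "closed (v -` B \<inter> ?S)" using compact_imp_closed by metis
  qed
  let ?P = "\<lambda>\<phi>. continuous_on ?S \<phi> \<and> (\<exists>r\<in>R. \<forall>x\<in>K. \<phi> (\<Phi> x) = r x)"
  have "\<exists>\<phi>. ?P \<phi> \<and> (\<forall>s\<in>?S. \<bar>v s - \<phi> s\<bar> < e)"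
  proof (rule Stone_Weierstrass_HOL[OF S])
    show "?P (\<lambda>s. c)" for c using const by (intro conjI continuous_intros) auto
  next
    show "continuous_on ?S \<phi>" if "?P \<phi>" for \<phi> using that by blast
  next
    fix \<phi> \<psi> assume *: "?P \<phi> \<and> ?P \<psi>"
    then obtain r s where "r \<in> R" "\<forall>x\<in>K. \<phi> (\<Phi> x) = r x" "s \<in> R" "\<forall>x\<in>K. \<psi> (\<Phi> x) = s x" by blast
    then have "\<exists>r\<in>R. \<forall>x\<in>K. \<phi> (\<Phi> x) + \<psi> (\<Phi> x) = r x" "\<exists>r\<in>R. \<forall>x\<in>K. \<phi> (\<Phi> x) * \<psi> (\<Phi> x) = r x"
      using add[of r s] mult[of r s] by force+
    then show "?P (\<lambda>x. \<phi> x + \<psi> x)" "?P (\<lambda>x. \<phi> x * \<psi> x)"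
      using * by (auto intro!: continuous_intros)
  next
    fix s t assume "s \<in> ?S \<and> t \<in> ?S \<and> s \<noteq> t"
    then obtain j where "s j \<noteq> t j" by (auto simp: fun_eq_iff)
    moreover have "continuous_on ?S (\<lambda>s. s j)"
      using continuous_on_subset[OF continuous_on_product_coordinates[of j]] by blast
    then have "?P (\<lambda>s. s j)" using f[of j] by (auto simp: \<Phi>_def)
    ultimately show "\<exists>\<phi>. ?P \<phi> \<and> \<phi> s \<noteq> \<phi> t" by blast
  qed (use vS e in auto)
  then obtain \<phi> r where "r \<in> R" "\<forall>x\<in>K. \<phi> (\<Phi> x) = r x" "\<forall>s\<in>?S. \<bar>v s - \<phi> s\<bar> < e" by blast
  then have "\<forall>x\<in>K. \<bar>u x - r x\<bar> < e" using v by force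
  then show ?thesis using \<open>r \<in> R\<close> by blast
qed

definition entry_mat :: "nat \<Rightarrow> (nat \<times> nat \<Rightarrow> real) \<Rightarrow> real mat" where
  "entry_mat n g = Matrix.mat n n g"

lemma entry_mat_carrier [simp]: "entry_mat n g \<in> carrier_mat n n"
  by (simp add: entry_mat_def)

lemma mat_act_entry_mat:
  assumes "xs \<in> multi_indices n k"
  shows "mat_act n (\<lambda>p. entry_mat n g $$ p) T xs = mat_act n g T xs"
  by (rule mat_act_cong_mat[OF _ assms]) (simp add: entry_mat_def)

abbreviation det_at :: "nat \<Rightarrow> (nat \<times> nat \<Rightarrow> real) \<Rightarrow> real" where
  "det_at n g \<equiv> Determinant.det (entry_mat n g)"

lemma poly_fun_det: "poly_fun (entries n) (\<lambda>g. det_at n g)"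
proof -
  have "det_at n g = (\<Sum>p\<in>{p. p permutes {0..<n}}. signof p * (\<Prod>i=0..<n. g (i, p i)))" for g
  proof -
    have "(\<Prod>i=0..<n. entry_mat n g $$ (i, p i)) = (\<Prod>i=0..<n. g (i, p i))" if "p permutes {0..<n}" for p
    proof (rule prod.cong)
      fix i assume "i \<in> {0..<n}"
      moreover from this have "p i \<in> {0..<n}" using permutes_in_image[OF that] by blast
      ultimately show "entry_mat n g $$ (i, p i) = g (i, p i)" by (simp add: entry_mat_def)
    qed simp
    then show ?thesis by (simp add: det_def'[OF entry_mat_carrier])
  qed
  moreover have "poly_fun (entries n) (\<lambda>g. \<Sum>p\<in>{p. p permutes {0..<n}}. signof p * (\<Prod>i=0..<n. g (i, p i)))"
  proof (intro poly_fun_sum poly_fun.mult[OF poly_fun.const] poly_fun_prod poly_fun.coord)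
    fix p i assume "p \<in> {p. p permutes {0..<n}}" "i \<in> {0..<n}"
    then have "p i \<in> {0..<n}" using permutes_in_image[of p "{0..<n}" i] by simp
    then show "(i, p i) \<in> entries n" using \<open>i \<in> {0..<n}\<close> by simp
  qed
  ultimately show ?thesis by simp
qed

text \<open>Points of a fibre have the same Gram matrix, so if they are invertible, they differ by an
  orthogonal matrix. It fixes all tensors of \<open>h\<close>, hence lies in the stabilizer. The factor
  \<open>det\<^sup>2\<close> takes care of the singular points.\<close>

lemma det_mult_invariant_constant_on_fibres:
  assumes T: "T \<in> tensor_invariants n k (stabilizer n h)" and w: "w \<in> multi_indices n k"
    and eq: "\<And>t. t \<in> model_index n \<Longrightarrow> model_monom n h t g = model_monom n h t g'"
  shows "(det_at n g)\<^sup>2 * mat_act n g T w = (det_at n g')\<^sup>2 * mat_act n g' T w"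
proof -
  let ?A = "entry_mat n g" and ?A' = "entry_mat n g'"
  have gram: "(\<Sum>c<n. g (p, c) * g (q, c)) = (\<Sum>c<n. g' (p, c) * g' (q, c))" if "p < n" "q < n" for p q
    using eq[of "([(p, q)], [], [])"] that by (simp add: model_index_def model_monom_def mat_act_def)
  have AA: "?A * transpose_mat ?A = ?A' * transpose_mat ?A'"
    by (rule eq_matI) (auto simp: entry_mat_def scalar_prod_def gram[unfolded lessThan_atLeast0])
  have sq: "(Determinant.det B)\<^sup>2 = Determinant.det (B * transpose_mat B)" if "B \<in> carrier_mat n n" for B :: "real mat"
    using that by (simp add: det_mult[of _ n] Determinant.det_transpose[OF that] power2_eq_square)
  have det: "(det_at n g)\<^sup>2 = (det_at n g')\<^sup>2"
    unfolding sq[OF entry_mat_carrier] AA ..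
  show ?thesis
  proof (cases "det_at n g = 0")
    case True
    then show ?thesis using det by simp
  next
    case False
    obtain B where B: "B \<in> carrier_mat n n" "B * ?A = 1\<^sub>m n" "?A * B = 1\<^sub>m n"
      using det_non_zero_imp_unit[OF entry_mat_carrier False, unfolded Units_def, of "()"]
      by (auto simp: ring_mat_def)
    define U where "U = B * ?A'"
    have U: "U \<in> carrier_mat n n" using B(1) by (simp add: U_def)
    have AU: "?A * U = ?A'"
      unfolding U_def assoc_mult_mat[OF entry_mat_carrier B(1) entry_mat_carrier, symmetric] B(3)
      by (rule left_mult_one_mat[OF entry_mat_carrier])
    have conj: "(B * X) * transpose_mat (B * X) = B * (X * transpose_mat X) * transpose_mat B"
      if X: "X \<in> carrier_mat n n" for X
    proof -
      have t: "transpose_mat X \<in> carrier_mat n n" "transpose_mat B \<in> carrier_mat n n"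
        using X B(1) by simp_all
      have "(B * X) * transpose_mat (B * X) = (B * X) * (transpose_mat X * transpose_mat B)"
        unfolding transpose_mult[OF B(1) X] ..
      also have "\<dots> = B * (X * (transpose_mat X * transpose_mat B))"
        by (rule assoc_mult_mat[OF B(1) X mult_carrier_mat[OF t]])
      also have "X * (transpose_mat X * transpose_mat B) = X * transpose_mat X * transpose_mat B"
        by (rule assoc_mult_mat[OF X t, symmetric])
      also have "B * (X * transpose_mat X * transpose_mat B) = B * (X * transpose_mat X) * transpose_mat B"
        by (rule assoc_mult_mat[OF B(1) mult_carrier_mat[OF X t(1)] t(2), symmetric])
      finally show ?thesis .
    qed
    have "U * transpose_mat U = B * (?A' * transpose_mat ?A') * transpose_mat B"
      unfolding U_def by (rule conj[OF entry_mat_carrier])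
    also have "\<dots> = (B * ?A) * transpose_mat (B * ?A)"
      unfolding AA[symmetric] by (rule conj[OF entry_mat_carrier, symmetric])
    also have "\<dots> = 1\<^sub>m n" unfolding B(2) by simp
    finally have "transpose_mat U * U = 1\<^sub>m n"
      using mat_mult_left_right_inverse[OF U] U by simp
    then have UO: "U \<in> orthogonal_group n" using U by (simp add: orthogonal_group_def)
    have "U \<in> stabilizer n h"
      unfolding mem_stabilizer_iff
    proof (intro conjI UO allI ballI)
      fix d xs assume xs: "xs \<in> multi_indices n d"
      let ?H = "\<lambda>ys. h (list_count ys)"
      have H: "mat_act n g' ?H ys = mat_act n g ?H ys" if ys: "ys \<in> multi_indices n d" for ys
      proof -
        have "([], [d], ys) \<in> model_index n" using ys by (simp add: model_index_def)
        from eq[OF this] have "mat_act n g (vertex_tensor h [d]) ys = mat_act n g' (vertex_tensor h [d]) ys"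
          by (simp add: model_monom_def)
        moreover have "mat_act n g (vertex_tensor h [d]) ys = mat_act n g ?H ys" for g
          using ys by (intro mat_act_cong) (simp add: multi_indices_def)
        ultimately show ?thesis by simp
      qed
      have len: "length xs = d" using xs by (simp add: multi_indices_def)
      have "mat_act n (\<lambda>p. U $$ p) ?H xs = mat_act n (\<lambda>p. B $$ p) (mat_act n (\<lambda>p. ?A' $$ p) ?H) xs"
        unfolding U_def by (rule mat_act_mult[OF B(1) entry_mat_carrier xs])
      also have "\<dots> = mat_act n (\<lambda>p. B $$ p) (mat_act n (\<lambda>p. ?A $$ p) ?H) xs"
        by (intro mat_act_cong) (simp add: len mat_act_entry_mat[of _ n d] H)
      also have "\<dots> = ?H xs"
        unfolding mat_act_mult[OF B(1) entry_mat_carrier xs, symmetric] B(2) by (rule mat_act_one[OF xs])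
      finally show "mat_act n (\<lambda>p. U $$ p) ?H xs = ?H xs" .
    qed
    then have "tensor_act n k U T = T" using T by (simp add: tensor_invariants_def)
    then have UT: "mat_act n (\<lambda>p. U $$ p) T ys = T ys" if "ys \<in> multi_indices n k" for ys
      using tensor_act_eq_mat_act[OF that, of U T] by simp
    have len: "length w = k" using w by (simp add: multi_indices_def)
    have "mat_act n g' T w = mat_act n (\<lambda>p. (?A * U) $$ p) T w"
      unfolding AU mat_act_entry_mat[OF w] ..
    also have "\<dots> = mat_act n (\<lambda>p. ?A $$ p) (mat_act n (\<lambda>p. U $$ p) T) w"
      by (rule mat_act_mult[OF entry_mat_carrier U w])
    also have "\<dots> = mat_act n g T w"
      unfolding mat_act_entry_mat[OF w] by (intro mat_act_cong) (simp add: len UT)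
    finally show ?thesis using det by simp
  qed
qed

lemma compact_box: "compact (space (box_measure I))"
proof -
  have "space (box_measure I) = (\<Pi>\<^sub>E i\<in>UNIV. if i \<in> I then {-1/2..1/2} else {undefined})"
    unfolding space_box by (auto simp: PiE_def Pi_def extensional_def split: if_splits)
  moreover have "compactin (product_topology (\<lambda>_. euclidean) UNIV)
      (\<Pi>\<^sub>E i\<in>UNIV. if i \<in> I then {-1/2..1/2} else {undefined :: real})"
    unfolding compactin_PiE by auto
  ultimately show ?thesis
    by (simp add: euclidean_product_topology)
qed

text \<open>If \<open>T\<close> is invariant, \<open>det\<^sup>2 (g T)\<^sub>w\<close> is a uniform limit of functions that are orthogonal to
  \<open>(g T)\<^sub>w\<close>. Hence the integral of \<open>det\<^sup>2 (g T)\<^sub>w\<^sup>2\<close> vanishes, and so does the integrand at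
  small multiples of the identity.\<close>

lemma invariant_orthogonal_to_diagrams_eq_0:
  assumes T: "T \<in> tensor_invariants n k (stabilizer n h)"
    and orth: "\<And>(E :: nat set) ds u w. pairing E (u @ w) \<Longrightarrow> length u = sum_list ds \<Longrightarrow> length w = k \<Longrightarrow>
      tensor_inner n k T (diagram_tensor n h E ds u w) = 0"
  shows "T = 0"
proof
  fix w
  show "T w = 0 w"
  proof (cases "w \<in> multi_indices n k")
    case False
    then show ?thesis using T by (simp add: tensor_invariants_def tensor_power_def)
  next
    case w: True
    let ?I = "entries n"
    let ?K = "space (box_measure ?I)"
    define u where "u g = mat_act n g T w" for g
    define d where "d g = (det_at n g)\<^sup>2" for g
    have fin: "finite ?I" by simp
    have pu: "poly_fun ?I u" unfolding u_def by (rule poly_fun_mat_act[OF w])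
    have pd: "poly_fun ?I d" unfolding d_def by (rule poly_fun_power[OF poly_fun_det])
    have pdu: "poly_fun ?I (\<lambda>g. d g * u g)" by (rule poly_fun.mult[OF pd pu])
    have pduu: "poly_fun ?I (\<lambda>g. d g * u g * u g)" by (rule poly_fun.mult[OF pdu pu])
    obtain C where C: "\<And>g. g \<in> ?K \<Longrightarrow> \<bar>u g\<bar> \<le> C" using bounded_poly_fun[OF pu] by blast
    define f where "f t = (if t \<in> model_index n then model_monom n h t else (\<lambda>_. 0))" for t
    have approx: "\<exists>r\<in>model_polys n h. \<forall>g\<in>?K. \<bar>d g * u g - r g\<bar> < e" if "e > 0" for e
    proof (rule Stone_Weierstrass_fibres[where f = f])
      show "compact ?K" by (rule compact_box)
      show "continuous_on ?K r" if "r \<in> model_polys n h" for r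
        by (rule continuous_on_poly_fun[OF poly_fun_model_polys[OF that]])
      show "f t \<in> model_polys n h" for t
        using model_polys_const[of 0 n h] by (auto simp: f_def model_polys_def intro: fun_space.span_base)
      show "continuous_on ?K (\<lambda>g. d g * u g)" by (rule continuous_on_poly_fun[OF pdu])
      show "d g * u g = d g' * u g'" if "\<And>t. f t g = f t g'" for g g'
        unfolding d_def u_def using that
        by (intro det_mult_invariant_constant_on_fibres[OF T w]) (metis f_def)
    qed (use that model_polys_const model_polys_add model_polys_mult in auto)
    have small: "\<bar>ball_integral ?I 1 (\<lambda>g. d g * u g * u g)\<bar> \<le> e * C" if e: "e > 0" for e
    proof -
      obtain r where r: "r \<in> model_polys n h" "\<And>g. g \<in> ?K \<Longrightarrow> \<bar>d g * u g - r g\<bar> < e"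
        using approx[OF e] by blast
      have pr: "poly_fun ?I (\<lambda>g. r g * u g)" by (rule poly_fun.mult[OF poly_fun_model_polys[OF r(1)] pu])
      have pdiff: "poly_fun ?I (\<lambda>g. (d g * u g + (-1) * r g) * u g)"
        by (rule poly_fun.mult[OF poly_fun.add[OF pdu poly_fun.mult[OF poly_fun.const poly_fun_model_polys[OF r(1)]]] pu])
      have "ball_integral ?I 1 (\<lambda>g. r g * u g) = 0"
        unfolding u_def by (rule orthogonal_model_polys[OF orth r(1) w]) auto
      moreover have "ball_integral ?I 1 (\<lambda>g. (d g * u g + (-1) * r g) * u g + r g * u g) =
          ball_integral ?I 1 (\<lambda>g. (d g * u g + (-1) * r g) * u g) + ball_integral ?I 1 (\<lambda>g. r g * u g)"
        by (rule ball_integral_add[OF fin pdiff pr])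
      moreover have "(\<lambda>g. (d g * u g + (-1) * r g) * u g + r g * u g) = (\<lambda>g. d g * u g * u g)"
        by (simp add: fun_eq_iff algebra_simps)
      ultimately have "ball_integral ?I 1 (\<lambda>g. d g * u g * u g) = ball_integral ?I 1 (\<lambda>g. (d g * u g + (-1) * r g) * u g)"
        by simp
      also have "\<bar>\<dots>\<bar> \<le> e * C"
      proof (rule ball_integral_bound[OF fin pdiff])
        fix g assume g: "g \<in> ?K"
        have "\<bar>d g * u g + (-1) * r g\<bar> * \<bar>u g\<bar> \<le> e * C"
          using r(2)[OF g] C[OF g] by (intro mult_mono) auto
        then show "\<bar>(d g * u g + (-1) * r g) * u g\<bar> \<le> e * C" by (simp only: abs_mult)
      qed
      finally show ?thesis .
    qed
    have "ball_integral ?I 1 (\<lambda>g. d g * u g * u g) = 0"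
    proof (rule ccontr)
      \<comment> \<open>The bound holds for every \<open>e\<close>; choose \<open>e\<close> such that \<open>e C\<close> is at most half of the value.\<close>
      let ?b = "\<bar>ball_integral ?I 1 (\<lambda>g. d g * u g * u g)\<bar>"
      assume "ball_integral ?I 1 (\<lambda>g. d g * u g * u g) \<noteq> 0"
      then have b: "?b > 0" by simp
      have "?b \<le> ?b / (2 * (\<bar>C\<bar> + 1)) * C" using b by (intro small) simp
      also have "\<dots> \<le> ?b / (2 * (\<bar>C\<bar> + 1)) * (\<bar>C\<bar> + 1)"
        using b by (intro mult_left_mono) simp_all
      also have "\<dots> = ?b / 2" by (simp add: field_simps)
      finally show False using b by simp
    qed
    note zero = this
    \<comment> \<open>The value of \<open>\<epsilon>\<close> puts \<open>\<epsilon>\<close> times the identity into the open ball, where the sum of the squares of the entries is below \<open>1/4\<close>.\<close>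
    define \<epsilon> where "\<epsilon> = 1 / (2 * (real n + 1))"
    define x where "x = restrict (\<lambda>p. \<epsilon> * (1\<^sub>m n) $$ p) ?I"
    have eps: "\<epsilon> > 0" by (simp add: \<epsilon>_def)
    have xv: "x (i, j) = (if i = j then \<epsilon> else 0)" if "i < n" "j < n" for i j
      using that by (simp add: x_def)
    have half: "\<bar>x p\<bar> < 1/2" if "p \<in> ?I" for p
    proof -
      have "0 < n" using that by auto
      then have "\<epsilon> < 1/2" by (simp add: \<epsilon>_def field_simps)
      then show ?thesis using that xv[of "fst p" "snd p"] eps by auto
    qed
    have "x \<in> ?K"
      unfolding space_box
    proof (rule PiE_I)
      show "x p \<in> {-1/2..1/2}" if "p \<in> ?I" for p using half[OF that] by (auto simp: abs_less_iff)
      show "x p = undefined" if "p \<notin> ?I" for p using that by (simp add: x_def)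
    qed
    moreover have "(\<Sum>p\<in>?I. (x p)\<^sup>2) < 1/4"
    proof -
      have "(\<Sum>p\<in>?I. (x p)\<^sup>2) = (\<Sum>i<n. \<Sum>j<n. (x (i, j))\<^sup>2)"
        by (simp add: sum.cartesian_product case_prod_unfold)
      also have "\<dots> = (\<Sum>i<n. \<Sum>j<n. if i = j then \<epsilon>\<^sup>2 else 0)"
        using xv by (intro sum.cong) auto
      also have "\<dots> = real n * \<epsilon>\<^sup>2" by simp
      also have "\<dots> < (real n + 1)\<^sup>2 * \<epsilon>\<^sup>2"
      proof (rule mult_strict_right_mono)
        show "real n < (real n + 1)\<^sup>2" by (simp add: power2_eq_square algebra_simps) (simp add: add_pos_nonneg add_strict_increasing)
      qed (use eps in simp)
      also have "\<dots> = ((real n + 1) * \<epsilon>)\<^sup>2" by (simp only: power_mult_distrib)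
      also have "(real n + 1) * \<epsilon> = 1/2" by (simp add: \<epsilon>_def)
      also have "(1/2)\<^sup>2 = (1/4 :: real)" by (simp add: power2_eq_square)
      finally show ?thesis .
    qed
    moreover have "0 \<le> d g * u g * u g" for g
      by (simp add: d_def mult.assoc)
    ultimately have "d x * u x * u x = 0"
      using half by (intro ball_integral_definite[OF fin pduu _ zero]) auto
    moreover have "d x \<noteq> 0"
    proof -
      have "entry_mat n x = \<epsilon> \<cdot>\<^sub>m 1\<^sub>m n" by (rule eq_matI) (auto simp: entry_mat_def xv)
      then show ?thesis using eps by (simp add: d_def)
    qed
    ultimately have "u x = 0" by simp
    moreover have "u x = \<epsilon> ^ k * T w"
    proof -
      have scale: "monom_at (\<lambda>p. \<epsilon> * G p) cs = \<epsilon> ^ length cs * monom_at G cs" for G and cs :: "(nat \<times> nat) list"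
        by (induction cs) simp_all
      have len: "length w = k" using w by (simp add: multi_indices_def)
      have "u x = mat_act n (\<lambda>p. \<epsilon> * (1\<^sub>m n) $$ p) T w"
        unfolding u_def by (rule mat_act_cong_mat[OF _ w]) (simp add: x_def)
      also have "\<dots> = (\<Sum>ys\<in>multi_indices n k. \<epsilon> ^ k * (monom_at (\<lambda>p. (1\<^sub>m n) $$ p) (zip w ys) * T ys))"
        unfolding mat_act_def len scale by (intro sum.cong) (auto simp: len multi_indices_def)
      also have "\<dots> = \<epsilon> ^ k * mat_act n (\<lambda>p. (1\<^sub>m n) $$ p) T w"
        unfolding mat_act_def len sum_distrib_left ..
      finally show ?thesis unfolding mat_act_one[OF w] .
    qed
    ultimately show ?thesis using eps by simp
  qed
qed

section \<open>The span of the fragment tensors\<close>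

theorem theorem1:
  fixes n k :: nat and h :: "(nat \<Rightarrow>\<^sub>0 nat) \<Rightarrow> real"
  shows "edge_connection_rank (partition_function n h) k
           = fun_dim (tensor_invariants n k (stabilizer n h))"
proof -
  have "fun_space.span (fragment_tensor n h ` {F :: (nat, nat) fragment. wf_fragment k F}) =
      tensor_invariants n k (stabilizer n h)" (is "fun_space.span ?A = ?W")
  proof (rule span_eq_by_orthogonality)
    show "?A \<subseteq> ?W" using fragment_tensor_invariant by blast
    show "?W \<subseteq> tensor_power n k" by (auto simp: tensor_invariants_def)
    show "fun_space.subspace ?W" by (rule subspace_invariants)
  next
    fix T assume T: "T \<in> ?W" and orth: "\<forall>a\<in>?A. tensor_inner n k T a = 0"
    show "T = 0"
    proof (rule invariant_orthogonal_to_diagrams_eq_0[OF T])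
      fix E :: "nat set" and ds u w
      assume D: "pairing E (u @ w)" "length u = sum_list ds" "length w = k"
      obtain F :: "(nat, nat) fragment" where "wf_fragment k F" "fragment_tensor n h F = diagram_tensor n h E ds u w"
        using diagram_tensor_eq_fragment_tensor[OF D(1,2)] D(3) by metis
      then show "tensor_inner n k T (diagram_tensor n h E ds u w) = 0" using orth by force
    qed
  qed
  then show ?thesis by (simp add: edge_connection_rank_eq)
qed

end
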